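(* Let $f\in C^1(\mathbb{R}^n;\mathbb{R}^n)$ and $h\in C^2(\mathbb{R}^n;\mathbb{R})$ with $f(0)=0$, $h(0)=0$, and consider the system $$\dot x=f(x),\quad y=h(x),\qquad x\in\mathbb{R}^n,\ y\in\mathbb{R}. \tag{S}$$ Assume that (S) is Robustly Forward Complete, i.e. there exist $\mu\in K^+$ and $a\in K_\infty$ such that for every $x_0\in\mathbb{R}^n$ the solution $x(t)$ of (S) with $x(0)=x_0$ satisfies $|x(t)|\le \mu(t)\,a(|x_0|)$ for all $t\ge 0$. Let $F\in C^1(\mathbb{R}^k\times\mathbb{R};\mathbb{R}^k)$ and $\Psi\in C^1(\mathbb{R}^k;\mathbb{R}^n)$ with $F(0,0)=0$, $\Psi(0)=0$, and suppose that the system $\dot z=F(z,y)$, $\hat x=\Psi(z)$ is a robust observer for (S) with respect to measurement errors. Moreover, suppose that there exist a constant $K\ge 0$ and a function $\bar\sigma\in KL$ such that for every $(x_0,z_0)\in\mathbb{R}^n\times\mathbb{R}^k$ and every $v\in L^\infty_{loc}(\mathbb{R}^+;\mathbb{R})$, the solution $(x(t),z(t))$ of $$\dot x=f(x),\qquad \dot z=F(z,h(x)+v)$$ with $(x(0),z(0))=(x_0,z_0)$ corresponding to $v$ satisfies $$\big|L_fh(\Psi(z(t)))-L_fh(x(t))\big|\le \bar\sigma(|x_0|+|z_0|,t)+K\sup_{0\le\tau\le t}|v(\tau)|,\qquad \forall t\ge 0 .$$ Finally, let $r>0$ be the upper diameter of the sampling partition and suppose that $rK<1$. Then the system $$\begin{aligned}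 \dot z(t)&=F(z(t),w(t)),\quad t\in[\tau_i,\tau_{i+1}),\\ \dot w(t)&=L_fh(\Psi(z(t))),\quad t\in[\tau_i,\tau_{i+1}),\\ w(\tau_{i+1})&=y(\tau_{i+1}),\\ \hat x(t)&=\Psi(z(t)), \end{aligned}$$ with state $(z(t),w(t))\in\mathbb{R}^k\times\mathbb{R}$ ($z$ being continuous at the sampling times), is a robust sampled-data observer for (S) with respect to measurement errors.
   Context: Notation. $|\cdot|$ is the Euclidean norm; $\mathbb{R}^+=[0,\infty)$. $L_fh(x)=\nabla h(x)f(x)$. $K^+$ is the class of positive continuous functions on $\mathbb{R}^+$. $N$ is the class of non-decreasing continuous $\gamma:\mathbb{R}^+\to\mathbb{R}^+$ with $\gamma(0)=0$. $K$ is the class of continuous, increasing $\rho:\mathbb{R}^+\to\mathbb{R}^+$ with $\rho(0)=0$ and $\rho(s)>0$ for $s>0$; $K_\infty$ is the class of $\rho\in K$ with $\lim_{s\to\infty}\rho(s)=\infty$. $KL$ is the class of continuous $\sigma:\mathbb{R}^+\times\mathbb{R}^+\to\mathbb{R}^+$ such that $\sigma(\cdot,t)\in K$ for each $t\ge0$, and for each $s\ge 0$ the map $\sigma(s,\cdot)$ is non-increasing with $\lim_{t\to\infty}\sigma(s,t)=0$. $L^\infty_{loc}(\mathbb{R}^+;D)$ is the class of Lebesgue measurable and locally bounded maps $\mathbb{R}^+\to D$; $\sup$ always denotes the actual supremum, not the essential supremum. Robust observer. Given system $\dot x=f(x)$, $y=h(x)$, the system $\dot z=F(z,y)$, $\hat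 x=\Psi(z)$ (with $z\in\mathbb{R}^k$, $\hat x\in\mathbb{R}^n$, $F,\Psi$ of class $C^1$, $F(0,0)=0$, $\Psi(0)=0$) is a robust observer for it with respect to measurement errors if: (i) there exist $\sigma\in KL$, $\gamma,p\in N$, $\mu\in K^+$, $a\in K_\infty$ such that for every $(x_0,z_0)\in\mathbb{R}^n\times\mathbb{R}^k$ and $v\in L^\infty_{loc}(\mathbb{R}^+;\mathbb{R})$ the solution of $\dot x=f(x)$, $\dot z=F(z,h(x)+v)$, $\hat x=\Psi(z)$ with $(x(0),z(0))=(x_0,z_0)$ satisfies, for all $t\ge 0$, $|\hat x(t)-x(t)|\le\sigma(|x_0|+|z_0|,t)+\sup_{0\le\tau\le t}\gamma(|v(\tau)|)$ and $|z(t)|\le\mu(t)\big[a(|x_0|+|z_0|)+\sup_{0\le\tau\le t}p(|v(\tau)|)\big]$; (ii) for every $x_0\in\mathbb{R}^n$ there exists $z_0\in\mathbb{R}^k$ such that the solution with $(x(0),z(0))=(x_0,z_0)$ and $v\equiv0$ satisfies $x(t)=\Psi(z(t))$ for all $t\ge0$. Robust sampled-data observer. A sampled-data system with state $\zeta\in\mathbb{R}^m$ has the form $\dot\zeta(t)=g(\zeta(t),\zeta(\tau_i),y(\tau_i))$ for $t\in[\tau_i,\tau_{i+1})$, $\zeta(\tau_{i+1})=G\big(\lim_{t\to\tau_{i+1}^-}\zeta(t),y(\tau_{i+1})\big)$, $\hat x(t)=\Phi(\zeta(t))$, where $g\in C^1(\mathbb{R}^m\times\mathbb{R}^m\times\mathbb{R};\mathbb{R}^m)$,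 $G\in C^0(\mathbb{R}^m\times\mathbb{R};\mathbb{R}^m)$, $\Phi\in C^1(\mathbb{R}^m;\mathbb{R}^n)$, all vanishing at the origin. It is a robust sampled-data observer for $\dot x=f(x)$, $y=h(x)$ with respect to measurement errors, with upper diameter $r>0$ of the sampling partition, if: (i) there exist $\sigma\in KL$, $\gamma,p\in N$, $\mu\in K^+$, $a\in K_\infty$ such that for every $(x_0,\zeta_0,d,v)\in\mathbb{R}^n\times\mathbb{R}^m\times L^\infty_{loc}(\mathbb{R}^+;\mathbb{R}^+)\times L^\infty_{loc}(\mathbb{R}^+;\mathbb{R})$ the solution of the hybrid system $\dot x(t)=f(x(t))$; $\dot\zeta(t)=g(\zeta(t),\zeta(\tau_i),y(\tau_i)+v(\tau_i))$, $t\in[\tau_i,\tau_{i+1})$; $\zeta(\tau_{i+1})=G\big(\lim_{t\to\tau_{i+1}^-}\zeta(t),y(\tau_{i+1})+v(\tau_{i+1})\big)$; $\tau_0=0$, $\tau_{i+1}=\tau_i+r\exp(-d(\tau_i))$; $\hat x(t)=\Phi(\zeta(t))$, where $y=h(x)$, with $(x(0),\zeta(0))=(x_0,\zeta_0)$ satisfies, for all $t\ge0$, $|\hat x(t)-x(t)|\le\sigma(|x_0|+|\zeta_0|,t)+\sup_{0\le\tau\le t}\gamma(|v(\tau)|)$ and $|\zeta(t)|\le\mu(t)\big[a(|x_0|+|\zeta_0|)+\sup_{0\le\tau\le t}p(|v(\tau)|)\big]$; (ii) for every $x_0\in\mathbb{R}^n$ there exists $\zeta_0\in\mathbb{R}^m$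 such that for all $d\in L^\infty_{loc}(\mathbb{R}^+;\mathbb{R}^+)$ the solution with $(x(0),\zeta(0))=(x_0,\zeta_0)$ and $v\equiv0$ satisfies $x(t)=\Phi(\zeta(t))$ for all $t\ge0$. For the observer in the claim, $\zeta=(z,w)$, $m=k+1$, $g=(F(z,w),L_fh(\Psi(z)))$, $G((z,w),y)=(z,y)$ and $\Phi(z,w)=\Psi(z)$. *)

theory Defs
  imports "HOL-Analysis.Analysis"
begin

text \<open>Functions on the half-line \<open>[0,\<infinity>)\<close> are represented by functions on all of \<open>real\<close>
  of which only the values on \<open>{0..}\<close> matter.\<close>

subsection \<open>Comparison functions and inputs\<close>

definition Kplus :: "(real \<Rightarrow> real) set" where
  "Kplus = {\<mu>. continuous_on {0..} \<mu> \<and> (\<forall>t\<ge>0. \<mu> t > 0)}"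

definition class_N :: "(real \<Rightarrow> real) set" where
  "class_N = {\<gamma>. continuous_on {0..} \<gamma> \<and> mono_on {0..} \<gamma> \<and> (\<forall>s\<ge>0. \<gamma> s \<ge> 0) \<and> \<gamma> 0 = 0}"

text \<open>``Increasing'' means strictly increasing here (as opposed to ``non-decreasing'').\<close>

definition class_K :: "(real \<Rightarrow> real) set" where
  "class_K = {\<rho>. continuous_on {0..} \<rho> \<and> strict_mono_on {0..} \<rho> \<and> \<rho> 0 = 0 \<and> (\<forall>s>0. \<rho> s > 0)}"

definition class_K_inf :: "(real \<Rightarrow> real) set" where
  "class_K_inf = {\<rho> \<in> class_K. filterlim \<rho> at_top at_top}"

definition class_KL :: "(real \<Rightarrow> real \<Rightarrow> real) set" where
  "class_KL = {\<sigma>. continuous_on ({0..} \<times> {0..}) (\<lambda>(s, t). \<sigma> s t) \<and>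
                  (\<forall>t\<ge>0. (\<lambda>s. \<sigma> s t) \<in> class_K) \<and>
                  (\<forall>s\<ge>0. antimono_on {0..} (\<sigma> s) \<and> (\<sigma> s \<longlongrightarrow> 0) at_top)}"

definition Linf_loc :: "'a::euclidean_space set \<Rightarrow> (real \<Rightarrow> 'a) set" where
  "Linf_loc D = {v. v \<in> borel_measurable (lebesgue_on {0..}) \<and> v ` {0..} \<subseteq> D \<and>
                    (\<forall>T\<ge>0. bounded (v ` {0..T}))}"

subsection \<open>Smoothness\<close>

definition C1 :: "('a::real_normed_vector \<Rightarrow> 'b::real_normed_vector) \<Rightarrow> bool" where
  "C1 f \<longleftrightarrow> (\<exists>f' :: 'a \<Rightarrow> ('a \<Rightarrow>\<^sub>L 'b).
      (\<forall>x. (f has_derivative blinfun_apply (f' x)) (at x)) \<and> continuous_on UNIV f')"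

definition C2 :: "('a::real_normed_vector \<Rightarrow> 'b::real_normed_vector) \<Rightarrow> bool" where
  "C2 f \<longleftrightarrow> (\<exists>f' :: 'a \<Rightarrow> ('a \<Rightarrow>\<^sub>L 'b).
      (\<forall>x. (f has_derivative blinfun_apply (f' x)) (at x)) \<and> C1 f')"

definition Lie_deriv :: "('a::euclidean_space \<Rightarrow> 'a) \<Rightarrow> ('a \<Rightarrow> real) \<Rightarrow> 'a \<Rightarrow> real" where
  "Lie_deriv f h x = frechet_derivative h (at x) (f x)"

subsection \<open>Solutions of differential equations\<close>

definition classical_solution ::
    "('a::euclidean_space \<Rightarrow> 'a) \<Rightarrow> 'a \<Rightarrow> (real \<Rightarrow> 'a) \<Rightarrow> bool" where
  "classical_solution f x\<^sub>0 x \<longleftrightarrow>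
     x 0 = x\<^sub>0 \<and> (\<forall>t\<ge>0. (x has_vector_derivative f (x t)) (at t within {0..}))"

text \<open>For right-hand sides that are merely measurable in time, solutions are understood in the
  sense of Caratheodory: absolutely continuous on bounded intervals, with the equation holding
  almost everywhere; equivalently, the integral equation below holds (with a Lebesgue integral).\<close>

definition caratheodory_solution ::
    "(real \<Rightarrow> 'a::euclidean_space \<Rightarrow> 'a) \<Rightarrow> 'a \<Rightarrow> (real \<Rightarrow> 'a) \<Rightarrow> bool" where
  "caratheodory_solution R z\<^sub>0 z \<longleftrightarrow>
     (\<forall>t\<ge>0. (\<lambda>s. R s (z s)) absolutely_integrable_on {0..t} \<and>
             z t = z\<^sub>0 + integral {0..t} (\<lambda>s. R s (z s)))"

text \<open>``The solution satisfies \<open>P\<close>'': a solution exists on all of \<open>{0..}\<close>, and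
  every solution satisfies \<open>P\<close>. \<open>S\<close> is the property of being a solution
  with given initial condition and inputs; in all uses below it determines the solution on
  \<open>{0..}\<close> uniquely, by the regularity of the data.\<close>

definition the_solution_satisfies :: "('s \<Rightarrow> bool) \<Rightarrow> ('s \<Rightarrow> bool) \<Rightarrow> bool" where
  "the_solution_satisfies S P \<longleftrightarrow> (\<exists>u. S u) \<and> (\<forall>u. S u \<longrightarrow> P u)"

definition robustly_forward_complete :: "('a::euclidean_space \<Rightarrow> 'a) \<Rightarrow> bool" where
  "robustly_forward_complete f \<longleftrightarrow>
     (\<exists>\<mu>\<in>Kplus. \<exists>a\<in>class_K_inf. \<forall>x\<^sub>0.
        the_solution_satisfies (classical_solution f x\<^sub>0)
          (\<lambda>x. \<forall>t\<ge>0. norm (x t) \<le> \<mu> t * a (norm x\<^sub>0)))"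

subsection \<open>Robust observers\<close>

text \<open>The cascade \<open>x' = f x\<close>, \<open>z' = F (z, h x + v)\<close> with initial
  condition \<open>(x\<^sub>0, z\<^sub>0)\<close>.\<close>

definition observer_solution ::
    "('n::euclidean_space \<Rightarrow> 'n) \<Rightarrow> ('n \<Rightarrow> real) \<Rightarrow> ('k::euclidean_space \<times> real \<Rightarrow> 'k) \<Rightarrow>
     (real \<Rightarrow> real) \<Rightarrow> 'n \<Rightarrow> 'k \<Rightarrow> (real \<Rightarrow> 'n) \<times> (real \<Rightarrow> 'k) \<Rightarrow> bool" where
  "observer_solution f h F v x\<^sub>0 z\<^sub>0 = (\<lambda>(x, z).
     classical_solution f x\<^sub>0 x \<and>
     caratheodory_solution (\<lambda>t \<xi>. F (\<xi>, h (x t) + v t)) z\<^sub>0 z)"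

definition robust_observer ::
    "('n::euclidean_space \<Rightarrow> 'n) \<Rightarrow> ('n \<Rightarrow> real) \<Rightarrow>
     ('k::euclidean_space \<times> real \<Rightarrow> 'k) \<Rightarrow> ('k \<Rightarrow> 'n) \<Rightarrow> bool" where
  "robust_observer f h F \<Psi> \<longleftrightarrow>
     C1 F \<and> C1 \<Psi> \<and> F (0, 0) = 0 \<and> \<Psi> 0 = 0 \<and>
     (\<exists>\<sigma>\<in>class_KL. \<exists>\<gamma>\<in>class_N. \<exists>p\<in>class_N. \<exists>\<mu>\<in>Kplus. \<exists>a\<in>class_K_inf.
        \<forall>x\<^sub>0 z\<^sub>0. \<forall>v\<in>Linf_loc UNIV.
          the_solution_satisfies (observer_solution f h F v x\<^sub>0 z\<^sub>0) (\<lambda>(x, z). \<forall>t\<ge>0.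
            norm (\<Psi> (z t) - x t) \<le> \<sigma> (norm x\<^sub>0 + norm z\<^sub>0) t + (SUP s\<in>{0..t}. \<gamma> \<bar>v s\<bar>) \<and>
            norm (z t) \<le> \<mu> t * (a (norm x\<^sub>0 + norm z\<^sub>0) + (SUP s\<in>{0..t}. p \<bar>v s\<bar>)))) \<and>
     (\<forall>x\<^sub>0. \<exists>z\<^sub>0.
        the_solution_satisfies (observer_solution f h F (\<lambda>_. 0) x\<^sub>0 z\<^sub>0)
          (\<lambda>(x, z). \<forall>t\<ge>0. x t = \<Psi> (z t)))"

subsection \<open>Robust sampled-data observers\<close>

primrec sampling_time :: "real \<Rightarrow> (real \<Rightarrow> real) \<Rightarrow> nat \<Rightarrow> real" where
  "sampling_time r d 0 = 0"
| "sampling_time r d (Suc i) = sampling_time r d i + r * exp (- d (sampling_time r d i))"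

text \<open>For \<open>r > 0\<close> and locally bounded \<open>d\<close> the sampling times tend to infinity, so the
  sampling intervals cover \<open>{0..}\<close>. Between samples the right-hand side is continuous
  in time, so \<open>\<zeta>\<close> solves its equation classically, with one-sided derivative at the
  left end point.\<close>

definition hybrid_solution ::
    "('n::euclidean_space \<Rightarrow> 'n) \<Rightarrow> ('n \<Rightarrow> real) \<Rightarrow> real \<Rightarrow>
     ('m::euclidean_space \<times> 'm \<times> real \<Rightarrow> 'm) \<Rightarrow> ('m \<times> real \<Rightarrow> 'm) \<Rightarrow>
     (real \<Rightarrow> real) \<Rightarrow> (real \<Rightarrow> real) \<Rightarrow> 'n \<Rightarrow> 'm \<Rightarrow> (real \<Rightarrow> 'n) \<times> (real \<Rightarrow> 'm) \<Rightarrow> bool" where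
  "hybrid_solution f h r g G d v x\<^sub>0 \<zeta>\<^sub>0 = (\<lambda>(x, \<zeta>).
     let \<tau> = sampling_time r d; y = (\<lambda>t. h (x t)) in
     classical_solution f x\<^sub>0 x \<and> \<zeta> 0 = \<zeta>\<^sub>0 \<and>
     (\<forall>i. (\<forall>t\<in>{\<tau> i..<\<tau> (Suc i)}.
             (\<zeta> has_vector_derivative g (\<zeta> t, \<zeta> (\<tau> i), y (\<tau> i) + v (\<tau> i)))
               (at t within {\<tau> i..<\<tau> (Suc i)})) \<and>
          (\<exists>l. (\<zeta> \<longlongrightarrow> l) (at_left (\<tau> (Suc i))) \<and>
               \<zeta> (\<tau> (Suc i)) = G (l, y (\<tau> (Suc i)) + v (\<tau> (Suc i))))))"

definition robust_sampled_data_observer ::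
    "('n::euclidean_space \<Rightarrow> 'n) \<Rightarrow> ('n \<Rightarrow> real) \<Rightarrow> real \<Rightarrow>
     ('m::euclidean_space \<times> 'm \<times> real \<Rightarrow> 'm) \<Rightarrow> ('m \<times> real \<Rightarrow> 'm) \<Rightarrow> ('m \<Rightarrow> 'n) \<Rightarrow> bool" where
  "robust_sampled_data_observer f h r g G \<Phi> \<longleftrightarrow>
     C1 g \<and> continuous_on UNIV G \<and> C1 \<Phi> \<and> g (0, 0, 0) = 0 \<and> G (0, 0) = 0 \<and> \<Phi> 0 = 0 \<and> r > 0 \<and>
     (\<exists>\<sigma>\<in>class_KL. \<exists>\<gamma>\<in>class_N. \<exists>p\<in>class_N. \<exists>\<mu>\<in>Kplus. \<exists>a\<in>class_K_inf.
        \<forall>x\<^sub>0 \<zeta>\<^sub>0. \<forall>d\<in>Linf_loc {0..}. \<forall>v\<in>Linf_loc UNIV.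
          the_solution_satisfies (hybrid_solution f h r g G d v x\<^sub>0 \<zeta>\<^sub>0) (\<lambda>(x, \<zeta>). \<forall>t\<ge>0.
            norm (\<Phi> (\<zeta> t) - x t) \<le> \<sigma> (norm x\<^sub>0 + norm \<zeta>\<^sub>0) t + (SUP s\<in>{0..t}. \<gamma> \<bar>v s\<bar>) \<and>
            norm (\<zeta> t) \<le> \<mu> t * (a (norm x\<^sub>0 + norm \<zeta>\<^sub>0) + (SUP s\<in>{0..t}. p \<bar>v s\<bar>)))) \<and>
     (\<forall>x\<^sub>0. \<exists>\<zeta>\<^sub>0. \<forall>d\<in>Linf_loc {0..}.
        the_solution_satisfies (hybrid_solution f h r g G d (\<lambda>_. 0) x\<^sub>0 \<zeta>\<^sub>0)
          (\<lambda>(x, \<zeta>). \<forall>t\<ge>0. x t = \<Phi> (\<zeta> t)))"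

end

(* Write u = w - h(x). The z-part of a run is a trajectory of the original observer with measurement
   error u, at a sampling time u equals the sampling error v, and between samples u grows by at most
   r times the mismatch of the Lie derivatives, which the hypothesis bounds by a decaying term plus
   K sup|u|. As r K < 1 this loop closes and gives sup|u| <= b(s) + c sup|v|, where s is the size of
   the initial state and c = 1/(1 - r K). Restarting the same argument at later and later times
   contracts the part of u not due to v by the factor r K each time, uniformly in s <= R; uniform
   decay together with a uniform bound is turned into a KL estimate. *)
theory Submission
  imports Defs
begin

section \<open>Continuously differentiable maps\<close>

text \<open>The obstacle is uniformity in \<open>v\<close>. A restart at time \<open>T\<close>
  begins from a state whose size depends on V = sup|v| as well, so the time until its transient has
  died out would depend on \<open>v\<close>, and no KL function could come out. The way around it is
  to compare V with b(s). If V > b(s), the loop bound already gives |u| <= 2 c V, and the estimate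
  of the original observer from time zero suffices without any restart. If V <= b(s), all of
  \<open>u\<close> is bounded by (1 + c) b(s), so restart states and waiting times depend on R only.
  What has to decay is thus the estimation error minus a fixed gain of V, a quantity that may be
  negative and that takes many values for the same \<open>s\<close> and \<open>t\<close>. Two
  further difficulties: runs must be shown to exist, and finite escape between samples is excluded
  by the observer hypotheses themselves, applied to a plant at rest; and the growth bound has to
  split into a factor in \<open>t\<close> and a factor in \<open>s\<close>, although h(x) is
  controlled through a function of their product.\<close>

lemma continuous_on_atLeast_zeroI:
  fixes g :: "real \<Rightarrow> 'a::topological_space"
  assumes "\<And>T. continuous_on {0..T} g"
  shows "continuous_on {0..} g"
  unfolding continuous_on_eq_continuous_within
proof
  fix s :: real assume s: "s \<in> {0..}"
  have "continuous (at s within {0..s+1}) g"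
    using assms[of "s+1"] s by (auto simp: continuous_on_eq_continuous_within)
  moreover have "at s within {0..s+1} = at s within {0..}"
    by (rule at_within_nhd[of _ "{..<s+1}"]) auto
  ultimately show "continuous (at s within {0..}) g" by simp
qed

lemma C1_continuous_on:
  assumes "C1 f" shows "continuous_on S f"
  using assms unfolding C1_def
  by (meson continuous_at_imp_continuous_on has_derivative_continuous)

lemma C1_bounded_linear:
  assumes "bounded_linear f" shows "C1 f"
  unfolding C1_def
proof (intro exI conjI allI)
  show "(f has_derivative blinfun_apply (Blinfun f)) (at x)" for x
    using assms by (simp add: bounded_linear_Blinfun_apply bounded_linear_imp_has_derivative)
qed simp

lemma C1_compose:
  assumes "C1 f" "C1 g" shows "C1 (\<lambda>x. f (g x))"
proof -
  from assms obtain f' g' where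
    f: "\<And>x. (f has_derivative blinfun_apply (f' x)) (at x)" "continuous_on UNIV f'" and
    g: "\<And>x. (g has_derivative blinfun_apply (g' x)) (at x)" "continuous_on UNIV g'"
    unfolding C1_def by blast
  have cg: "continuous_on UNIV g" by (rule C1_continuous_on[OF assms(2)])
  show ?thesis unfolding C1_def
  proof (intro exI conjI allI)
    show "((\<lambda>x. f (g x)) has_derivative blinfun_apply (f' (g x) o\<^sub>L g' x)) (at x)" for x
      using has_derivative_compose[OF g(1) f(1), of x] by (simp add: blinfun_compose.rep_eq o_def)
    show "continuous_on UNIV (\<lambda>x. f' (g x) o\<^sub>L g' x)"
      by (intro continuous_intros g(2) continuous_on_compose2[OF f(2) cg]) auto
  qed
qed

lemma (in bounded_bilinear) C1_bilinear:
  assumes "C1 p" "C1 q" shows "C1 (\<lambda>x. prod (p x) (q x))"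
proof -
  from assms obtain p' q' where
    p: "\<And>x. (p has_derivative blinfun_apply (p' x)) (at x)" "continuous_on UNIV p'" and
    q: "\<And>x. (q has_derivative blinfun_apply (q' x)) (at x)" "continuous_on UNIV q'"
    unfolding C1_def by blast
  have c: "continuous_on UNIV p" "continuous_on UNIV q"
    using assms by (simp_all add: C1_continuous_on)
  show ?thesis unfolding C1_def
  proof (intro exI conjI allI)
    show "((\<lambda>x. prod (p x) (q x)) has_derivative
       blinfun_apply ((prod_right (p x) o\<^sub>L q' x) + (prod_left (q x) o\<^sub>L p' x))) (at x)" for x
      using FDERIV[OF p(1) q(1), of x] by (simp add: plus_blinfun.rep_eq)
    show "continuous_on UNIV (\<lambda>x. (prod_right (p x) o\<^sub>L q' x) + (prod_left (q x) o\<^sub>L p' x))"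
      by (intro continuous_intros p(2) q(2) c
          bounded_linear.continuous_on[OF bounded_linear_prod_right]
          bounded_linear.continuous_on[OF bounded_linear_prod_left])
  qed
qed

lemma C1_add:
  assumes "C1 f" "C1 g" shows "C1 (\<lambda>x. f x + g x)"
proof -
  from assms obtain f' g' where
    f: "\<And>x. (f has_derivative blinfun_apply (f' x)) (at x)" "continuous_on UNIV f'" and
    g: "\<And>x. (g has_derivative blinfun_apply (g' x)) (at x)" "continuous_on UNIV g'"
    unfolding C1_def by blast
  show ?thesis unfolding C1_def
  proof (intro exI conjI allI)
    show "((\<lambda>x. f x + g x) has_derivative blinfun_apply (f' x + g' x)) (at x)" for x
      using has_derivative_add[OF f(1) g(1), of x] by (simp add: plus_blinfun.rep_eq)
  qed (intro continuous_intros f g)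
qed

lemma C1_Pair:
  assumes "C1 f" "C1 g" shows "C1 (\<lambda>x. (f x, g x))"
proof -
  have "C1 (\<lambda>x. (f x, 0) + (0, g x))"
    by (intro C1_add C1_compose[OF _ assms(1)] C1_compose[OF _ assms(2)] C1_bounded_linear)
      (auto intro!: bounded_linear_intros)
  then show ?thesis by simp
qed

text \<open>The Lie derivative is the bilinear pairing of \<open>h'\<close> with \<open>f\<close>;
  as \<open>h\<close> is C2, \<open>h'\<close> is itself C1 and the product rule for bounded
  bilinear maps applies.\<close>

lemma C1_Lie_deriv:
  assumes "C1 f" "C2 h" shows "C1 (Lie_deriv f h)"
proof -
  from assms(2) obtain h' where
    h: "\<And>x. (h has_derivative blinfun_apply (h' x)) (at x)" "C1 h'"
    unfolding C2_def by blast
  have "Lie_deriv f h = (\<lambda>x. blinfun_apply (h' x) (f x))"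
    by (rule ext) (simp add: Lie_deriv_def frechet_derivative_at[OF h(1), symmetric])
  then show ?thesis
    using bounded_bilinear.C1_bilinear[OF bounded_bilinear_blinfun_apply h(2) assms(1)] by simp
qed

lemma C2_imp_C1: "C2 f \<Longrightarrow> C1 f"
  unfolding C2_def using C1_def C1_continuous_on by blast

lemma has_vector_derivative_Lie_deriv:
  assumes "C2 h" "(x has_vector_derivative f (x t)) (at t within S)"
  shows "((\<lambda>t. h (x t)) has_vector_derivative Lie_deriv f h (x t)) (at t within S)"
proof -
  from assms(1) obtain h' where
    h: "\<And>x. (h has_derivative blinfun_apply (h' x)) (at x)"
    unfolding C2_def by blast
  have "((h \<circ> x) has_vector_derivative blinfun_apply (h' (x t)) (f (x t))) (at t within S)"
    by (rule vector_derivative_diff_chain_within[OF assms(2)])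
      (rule has_derivative_at_withinI[OF h])
  then show ?thesis
    by (simp add: Lie_deriv_def frechet_derivative_at[OF h, symmetric] o_def)
qed

section \<open>Lipschitz and growth bounds from the derivative\<close>

lemma C1_lipschitz_cball:
  fixes f :: "'a::euclidean_space \<Rightarrow> 'b::real_normed_vector"
  assumes "C1 f"
  obtains L where "L \<ge> 0" "\<And>x y. norm x \<le> R \<Longrightarrow> norm y \<le> R \<Longrightarrow> norm (f x - f y) \<le> L * norm (x - y)"
proof -
  from assms obtain f' where
    f: "\<And>x. (f has_derivative blinfun_apply (f' x)) (at x)" "continuous_on UNIV f'"
    unfolding C1_def by blast
  have "compact (f' ` cball 0 R)"
    by (rule compact_continuous_image) (auto intro: continuous_on_subset[OF f(2)])
  then obtain L where L: "L > 0" "\<And>x. x \<in> cball 0 R \<Longrightarrow> norm (f' x) \<le> L"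
    by (metis compact_imp_bounded bounded_pos image_eqI)
  show thesis
  proof (rule that[of L])
    show "norm (f x - f y) \<le> L * norm (x - y)" if "norm x \<le> R" "norm y \<le> R" for x y
      by (rule differentiable_bound[where S="cball 0 R" and f'="\<lambda>x. blinfun_apply (f' x)"])
        (use that L f in \<open>auto intro: has_derivative_at_withinI simp: norm_blinfun.rep_eq[symmetric]\<close>)
  qed (use L in simp)
qed

text \<open>The majorant is the supremum of the norm of \<open>g\<close> over the ball of radius
  \<open>s\<close>. Writing this ball as \<open>s\<close> times the unit ball keeps the index set of
  the supremum fixed, so that continuity in \<open>s\<close> follows from uniform continuity on a
  compact product.\<close>

lemma continuous_majorant:
  fixes g :: "'a::euclidean_space \<Rightarrow> 'b::real_normed_vector"
  assumes g: "continuous_on UNIV g"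
  obtains m where "continuous_on {0..} m" "mono_on {0..} m" "\<And>s. s \<ge> 0 \<Longrightarrow> m s \<ge> 0"
    "\<And>x. norm (g x) \<le> m (norm x)"
proof -
  define m where "m = (\<lambda>s. SUP y\<in>cball (0::'a) 1. norm (g (s *\<^sub>R y)))"
  have cont: "continuous_on S (\<lambda>(s,y). norm (g (s *\<^sub>R y)))" for S :: "(real \<times> 'a) set"
    unfolding case_prod_unfold
    by (intro continuous_intros continuous_on_compose2[OF g]) auto
  have bdd: "bdd_above ((\<lambda>y. norm (g (s *\<^sub>R y))) ` cball 0 1)" for s
    by (intro compact_imp_bounded[THEN bounded_imp_bdd_above] compact_continuous_image
        continuous_intros continuous_on_compose2[OF g]) auto
  have le: "norm (g (s *\<^sub>R y)) \<le> m s" if "norm y \<le> 1" for s y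
    unfolding m_def by (rule cSUP_upper2[OF bdd]) (use that in auto)
  have m_le: "m s \<le> c" if "\<And>y. norm y \<le> 1 \<Longrightarrow> norm (g (s *\<^sub>R y)) \<le> c" for s c
    unfolding m_def by (rule cSUP_least) (use that in \<open>auto intro: exI[of _ 0]\<close>)
  have majorant: "norm (g x) \<le> m s" if "norm x \<le> s" for x s
  proof (cases "s = 0")
    case True
    then show ?thesis using that le[of 0 0] by simp
  next
    case False
    then have "s > 0" using that norm_ge_zero[of x] by linarith
    then show ?thesis using le[of "x /\<^sub>R s" s] that by (simp add: field_simps)
  qed
  show thesis
  proof (rule that[of m])
    show "norm (g x) \<le> m (norm x)" for x by (rule majorant) simp
    show "m s \<ge> 0" if "s \<ge> 0" for s using order_trans[OF norm_ge_zero le[of 0 s]] by simp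
    show "mono_on {0..} m"
    proof (rule mono_onI)
      fix s t :: real assume st: "s \<in> {0..}" "t \<in> {0..}" "s \<le> t"
      show "m s \<le> m t"
      proof (rule m_le)
        fix y :: 'a assume "norm y \<le> 1"
        then have "norm (s *\<^sub>R y) \<le> t"
          using st mult_mono[of s t "norm y" 1] by simp
        then show "norm (g (s *\<^sub>R y)) \<le> m t" by (rule majorant)
      qed
    qed
    show "continuous_on {0..} m"
    proof (rule continuous_on_atLeast_zeroI)
      fix S
      show "continuous_on {0..S} m"
        unfolding continuous_on_iff
      proof (intro ballI allI impI)
        fix s and e :: real assume s: "s \<in> {0..S}" and e: "e > 0"
        let ?C = "{0..S} \<times> cball (0::'a) 1"
        have "uniformly_continuous_on ?C (\<lambda>(s,y). norm (g (s *\<^sub>R y)))"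
          by (intro compact_uniformly_continuous cont compact_Times) auto
        then obtain d where d: "d > 0" "\<And>p q. p \<in> ?C \<Longrightarrow> q \<in> ?C \<Longrightarrow> dist p q < d \<Longrightarrow>
            dist (case p of (s,y) \<Rightarrow> norm (g (s *\<^sub>R y))) (case q of (s,y) \<Rightarrow> norm (g (s *\<^sub>R y))) < e / 2"
          unfolding uniformly_continuous_on_def using e by (metis half_gt_zero)
        have le': "m a \<le> m b + e / 2" if "a \<in> {0..S}" "b \<in> {0..S}" "dist a b < d" for a b
        proof (rule m_le)
          fix y :: 'a assume y: "norm y \<le> 1"
          then have "dist (norm (g (a *\<^sub>R y))) (norm (g (b *\<^sub>R y))) < e / 2"
            using d(2)[of "(a,y)" "(b,y)"] that by (auto simp: dist_Pair_Pair)
          then show "norm (g (a *\<^sub>R y)) \<le> m b + e / 2"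
            using le[OF y, of b] unfolding dist_real_def by linarith
        qed
        show "\<exists>d>0. \<forall>x'\<in>{0..S}. dist x' s < d \<longrightarrow> dist (m x') (m s) < e"
        proof (intro exI[of _ d] conjI ballI impI)
          fix t assume t: "t \<in> {0..S}" "dist t s < d"
          show "dist (m t) (m s) < e"
            using le'[of t s] le'[of s t] s t e by (auto simp: dist_real_def abs_less_iff abs_minus_commute)
        qed (use d in simp)
      qed
    qed
  qed
qed

text \<open>Mean value inequality on a ball, with a monotone majorant of the derivative. The factor
  \<open>norm x\<close>, which comes from \<open>h 0 = 0\<close>, makes the bound vanish at zero, so
  that it is a class N function of the size of the state.\<close>

lemma C1_growth:
  fixes h :: "'a::euclidean_space \<Rightarrow> 'b::real_normed_vector"
  assumes "C1 h" "h 0 = 0"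
  obtains m where "continuous_on {0..} m" "mono_on {0..} m" "\<And>s. s \<ge> 0 \<Longrightarrow> m s \<ge> 0"
    "\<And>x. norm (h x) \<le> norm x * m (norm x)"
proof -
  from assms obtain h' where
    h: "\<And>x. (h has_derivative blinfun_apply (h' x)) (at x)" "continuous_on UNIV h'"
    unfolding C1_def by blast
  obtain m where m: "continuous_on {0..} m" "mono_on {0..} m" "\<And>s. s \<ge> 0 \<Longrightarrow> m s \<ge> 0"
    "\<And>x. norm (h' x) \<le> m (norm x)"
    using continuous_majorant[OF h(2)] by blast
  have "norm (h x) \<le> norm x * m (norm x)" for x
  proof -
    have "norm (h x - h 0) \<le> m (norm x) * norm (x - 0)"
    proof (rule differentiable_bound[where S="cball 0 (norm x)" and f'="\<lambda>x. blinfun_apply (h' x)"])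
      fix y :: 'a assume "y \<in> cball 0 (norm x)"
      then show "onorm (blinfun_apply (h' y)) \<le> m (norm x)"
        using m(4)[of y] mono_onD[OF m(2), of "norm y" "norm x"]
        by (simp add: norm_blinfun.rep_eq[symmetric])
    qed (use h in \<open>auto intro: has_derivative_at_withinI\<close>)
    then show ?thesis using assms(2) by (simp add: mult.commute)
  qed
  then show thesis using m that by blast
qed

section \<open>Differential equations\<close>

text \<open>Gronwall's inequality in differential form: by Cauchy-Schwarz the weighted square
  \<open>\<phi>\<close> has nonpositive derivative, and it starts at zero. The uniqueness arguments
  for trajectories reduce to this.\<close>

lemma vanishing_of_linear_growth:
  fixes e :: "real \<Rightarrow> 'a::real_inner"
  assumes e: "\<And>t. t \<in> {a..b} \<Longrightarrow> (e has_vector_derivative p t) (at t within {a..b})"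
    and p: "\<And>t. t \<in> {a..b} \<Longrightarrow> norm (p t) \<le> L * norm (e t)"
    and e0: "e a = 0" and t: "t \<in> {a..b}"
  shows "e t = 0"
proof -
  define \<phi> where "\<phi> = (\<lambda>t. exp (- 2 * L * t) * (e t \<bullet> e t))"
  define \<psi> where "\<psi> = (\<lambda>s. exp (- 2 * L * s) * (2 * (e s \<bullet> p s) - 2 * L * (e s \<bullet> e s)))"
  have d: "(\<phi> has_real_derivative \<psi> s) (at s within {a..t})"
    if "s \<in> {a..t}" for s
  proof -
    have e': "(e has_vector_derivative p s) (at s within {a..t})"
      by (rule has_vector_derivative_within_subset[OF e]) (use that t in auto)
    have 1: "((\<lambda>s. e s \<bullet> e s) has_derivative (\<lambda>h. e s \<bullet> (h *\<^sub>R p s) + (h *\<^sub>R p s) \<bullet> e s)) (at s within {a..t})"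
      using e' unfolding has_vector_derivative_def
      by (intro has_derivative_inner)
    have 2: "((\<lambda>s. e s \<bullet> e s) has_real_derivative (2 * (e s \<bullet> p s))) (at s within {a..t})"
      unfolding has_field_derivative_def
      by (rule has_derivative_eq_rhs[OF 1]) (auto simp: inner_commute)
    show ?thesis unfolding \<phi>_def \<psi>_def
      by (rule derivative_eq_intros 2 refl)+ (simp add: algebra_simps)
  qed
  have "\<exists>s\<in>{a..t}. \<phi> t - \<phi> a = \<psi> s * (t - a)"
    by (rule mvt_very_simple) (use t d in \<open>auto simp: has_field_derivative_def\<close>)
  then obtain s where s: "s \<in> {a..t}" "\<phi> t - \<phi> a = \<psi> s * (t - a)" by blast
  have "e s \<bullet> p s \<le> norm (e s) * norm (p s)" by (rule norm_cauchy_schwarz)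
  also have "\<dots> \<le> norm (e s) * (L * norm (e s))" using p[of s] s t by (intro mult_left_mono) auto
  finally have "2 * (e s \<bullet> p s) - 2 * L * (e s \<bullet> e s) \<le> 0"
    by (simp add: dot_square_norm power2_eq_square algebra_simps)
  then have "\<psi> s \<le> 0" by (simp add: \<psi>_def mult_le_0_iff)
  then have "\<phi> t \<le> \<phi> a" using s t by (metis atLeastAtMost_iff diff_ge_0_iff_ge diff_le_0_iff_le mult_nonpos_nonneg)
  then have "\<phi> t \<le> 0" using e0 by (simp add: \<phi>_def)
  then have "e t \<bullet> e t \<le> 0" by (simp add: \<phi>_def mult_le_0_iff)
  then show ?thesis by (metis inner_ge_zero inner_eq_zero_iff antisym)
qed

text \<open>On a compact interval both trajectories stay in one ball, on which \<open>G\<close> is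
  Lipschitz; the derivative of their difference is then bounded by a multiple of the difference
  itself.\<close>

lemma C1_ode_unique:
  fixes G :: "'a::euclidean_space \<Rightarrow> 'a"
  assumes G: "C1 G"
    and y: "\<And>t. t \<in> {a..b} \<Longrightarrow> (y has_vector_derivative G (y t)) (at t within {a..b})"
    and y': "\<And>t. t \<in> {a..b} \<Longrightarrow> (y' has_vector_derivative G (y' t)) (at t within {a..b})"
    and eq: "y a = y' a" and t: "t \<in> {a..b}"
  shows "y t = y' t"
proof -
  have "continuous_on {a..b} y" "continuous_on {a..b} y'"
    by (rule continuous_on_vector_derivative, erule y y')+
  then have "bounded (y ` {a..b} \<union> y' ` {a..b})"
    by (intro bounded_Un[THEN iffD2] conjI compact_imp_bounded compact_continuous_image) auto
  then obtain R where "\<forall>x \<in> y ` {a..b} \<union> y' ` {a..b}. norm x \<le> R" unfolding bounded_iff ..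
  note bnd = bspec[OF this]
  have R: "norm (y s) \<le> R" "norm (y' s) \<le> R" if "s \<in> {a..b}" for s
    by (rule bnd, rule UnI1, rule imageI, rule that) (rule bnd, rule UnI2, rule imageI, rule that)
  obtain L where L: "L \<ge> 0" "\<And>x y. norm x \<le> R \<Longrightarrow> norm y \<le> R \<Longrightarrow> norm (G x - G y) \<le> L * norm (x - y)"
    using C1_lipschitz_cball[OF G, of R] by blast
  have "y t - y' t = 0"
  proof (rule vanishing_of_linear_growth[where e="\<lambda>s. y s - y' s" and p="\<lambda>s. G (y s) - G (y' s)", OF _ _ _ t])
    show "((\<lambda>s. y s - y' s) has_vector_derivative G (y s) - G (y' s)) (at s within {a..b})" if "s \<in> {a..b}" for s
      by (intro has_vector_derivative_diff y y' that)
    show "norm (G (y s) - G (y' s)) \<le> L * norm (y s - y' s)" if "s \<in> {a..b}" for s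
      by (rule L(2)[OF R[OF that]])
  qed (simp add: eq)
  then show ?thesis by simp
qed

text \<open>Picard iteration for the exponentially weighted curve
  \<open>exp (- l * t) *\<^sub>R \<zeta> t\<close>: the weight makes the integral operator a
  contraction on all of \<open>{0..T}\<close> at once, so that no short intervals have to be patched
  together.\<close>

lemma global_lipschitz_ode_exists:
  fixes G :: "'a::euclidean_space \<Rightarrow> 'a"
  assumes G: "\<And>x y. norm (G x - G y) \<le> L * norm (x - y)" and T: "T \<ge> 0"
  obtains \<zeta> where "\<zeta> 0 = \<zeta>\<^sub>0"
    "\<And>t. t \<in> {0..T} \<Longrightarrow> (\<zeta> has_vector_derivative G (\<zeta> t)) (at t within {0..T})"
proof -
  \<comment> \<open>Any positive rate of at least twice \<open>\<bar>L\<bar>\<close> would do: it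
    gives \<open>\<bar>L\<bar> / l \<le> 1 / 2\<close>.\<close>
  define l where "l = 2 * \<bar>L\<bar> + 1"
  have l: "l > 0" by (simp add: l_def)
  have Gc: "continuous_on UNIV G"
  proof (rule continuous_onI)
    fix x :: 'a and e :: real assume e: "e > 0"
    show "\<exists>d>0. \<forall>x'\<in>UNIV. dist x' x < d \<longrightarrow> dist (G x') (G x) \<le> e"
    proof (intro exI[of _ "e / l"] conjI ballI impI)
      fix y :: 'a assume y: "dist y x < e / l"
      have "norm (G y - G x) \<le> l * norm (y - x)"
        using order_trans[OF G[of y x] mult_right_mono[of L l "norm (y - x)"]] by (simp add: l_def)
      then show "dist (G y) (G x) \<le> e" using y l by (simp add: dist_norm field_simps)
    qed (use e l in simp)
  qed
  \<comment> \<open>Time is clamped to \<open>{0..T}\<close> so that the operator acts on bounded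
    continuous functions on the whole line, a complete space.\<close>
  define c where "c = (\<lambda>t. max 0 (min t T))"
  have c: "c t \<in> {0..T}" for t using T by (auto simp: c_def)
  have c_id: "c t = t" if "t \<in> {0..T}" for t using that by (auto simp: c_def)
  define g where "g = (\<lambda>(y :: real \<Rightarrow>\<^sub>C 'a) s. G (exp (l * s) *\<^sub>R y s))"
  have gc: "continuous_on S (g y)" for y S
    unfolding g_def by (intro continuous_on_compose2[OF Gc] continuous_intros) auto
  define A where "A = (\<lambda>y t. exp (- l * c t) *\<^sub>R (\<zeta>\<^sub>0 + integral {0..c t} (g y)))"
  define B where "B = (\<lambda>y s. exp (- l * s) *\<^sub>R (\<zeta>\<^sub>0 + integral {0..s} (g y)))"
  have Bc: "continuous_on {0..T} (B y)" for y
    unfolding B_def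
    by (intro continuous_intros indefinite_integral_continuous_1 integrable_continuous_interval gc)
  have AB: "A y = (\<lambda>t. B y (c t))" for y by (simp add: A_def B_def)
  have A: "A y \<in> bcontfun" for y
    unfolding bcontfun_def
  proof safe
    show "continuous_on UNIV (A y)"
      unfolding AB by (rule continuous_on_compose2[OF Bc]) (use c in \<open>auto simp: c_def intro!: continuous_intros\<close>)
    have "bounded (B y ` {0..T})"
      by (intro compact_imp_bounded compact_continuous_image Bc) auto
    then show "bounded (range (A y))"
      by (rule bounded_subset) (use c in \<open>auto simp: AB\<close>)
  qed
  have A_apply: "apply_bcontfun (Bcontfun (A y)) = A y" for y using A by (rule Bcontfun_inverse)
  have "dist (Bcontfun (A y)) (Bcontfun (A y')) \<le> 1 / 2 * dist y y'" for y y'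
  proof (rule dist_bound)
    fix t
    let ?s = "c t" and ?D = "dist y y'"
    have s: "?s \<ge> 0" using c by auto
    \<comment> \<open>The integrand bounds the difference of the two right-hand sides; its growth
      \<open>exp (l * s)\<close> is undone by the weight in front of the integral.\<close>
    have E: "((\<lambda>s. \<bar>L\<bar> * (exp (l * s) * ?D)) has_integral (\<bar>L\<bar> * (exp (l * ?s) / l * ?D) - \<bar>L\<bar> * (exp (l * 0) / l * ?D))) {0..?s}"
      by (rule fundamental_theorem_of_calculus)
        (use s l in \<open>auto intro!: derivative_eq_intros simp: has_real_derivative_iff_has_vector_derivative[symmetric]\<close>)
    have "norm (A y t - A y' t) = exp (- l * ?s) * norm (integral {0..?s} (g y) - integral {0..?s} (g y'))"
      unfolding A_def by (simp add: scaleR_diff_right[symmetric])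
    also have "integral {0..?s} (g y) - integral {0..?s} (g y') = integral {0..?s} (\<lambda>s. g y s - g y' s)"
      by (intro Henstock_Kurzweil_Integration.integral_diff[symmetric] integrable_continuous_interval gc)
    also have "norm \<dots> \<le> integral {0..?s} (\<lambda>s. \<bar>L\<bar> * (exp (l * s) * ?D))"
    proof (rule integral_norm_bound_integral)
      show "(\<lambda>s. g y s - g y' s) integrable_on {0..?s}"
        by (intro integrable_continuous_interval continuous_intros gc)
      show "(\<lambda>s. \<bar>L\<bar> * (exp (l * s) * ?D)) integrable_on {0..?s}"
        by (intro integrable_continuous_interval continuous_intros)
      fix s
      have "norm (g y s - g y' s) \<le> L * norm (exp (l * s) *\<^sub>R y s - exp (l * s) *\<^sub>R y' s)"
        unfolding g_def by (rule G)
      also have "\<dots> = L * (exp (l * s) * dist (y s) (y' s))"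
        by (simp add: scaleR_diff_right[symmetric] dist_norm)
      also have "\<dots> \<le> \<bar>L\<bar> * (exp (l * s) * ?D)"
        by (intro mult_mono) (auto intro: dist_bounded)
      finally show "norm (g y s - g y' s) \<le> \<bar>L\<bar> * (exp (l * s) * ?D)" .
    qed
    also have "\<dots> = \<bar>L\<bar> * (exp (l * ?s) / l * ?D) - \<bar>L\<bar> * (exp (l * 0) / l * ?D)"
      using E by (rule integral_unique)
    also have "\<dots> \<le> \<bar>L\<bar> * (exp (l * ?s) / l * ?D)" using l by simp
    also have "\<dots> = exp (l * ?s) * (\<bar>L\<bar> / l * ?D)" by simp
    also have "\<dots> \<le> exp (l * ?s) * (1 / 2 * ?D)"
      by (intro mult_left_mono mult_right_mono) (auto simp: l_def divide_simps)
    finally have "norm (A y t - A y' t) \<le> exp (- l * ?s) * (exp (l * ?s) * (1 / 2 * ?D))" by simp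
    also have "\<dots> = 1 / 2 * ?D" by (simp add: mult.assoc[symmetric] exp_minus)
    finally show "dist (apply_bcontfun (Bcontfun (A y)) t) (apply_bcontfun (Bcontfun (A y')) t) \<le> 1 / 2 * ?D"
      unfolding A_apply by (simp add: dist_norm)
  qed
  then obtain y where "Bcontfun (A y) = y"
    using banach_fix_type[of "1/2" "\<lambda>y. Bcontfun (A y)"] by auto
  then have y: "A y = apply_bcontfun y" using A_apply by metis
  define \<zeta> where "\<zeta> = (\<lambda>t. exp (l * t) *\<^sub>R y t)"
  have z: "\<zeta> t = \<zeta>\<^sub>0 + integral {0..t} (g y)" if "t \<in> {0..T}" for t
    using that by (simp add: \<zeta>_def y[symmetric] A_def c_id exp_minus)
  show thesis
  proof (rule that[of \<zeta>])
    show "\<zeta> 0 = \<zeta>\<^sub>0" using z[of 0] T by simp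
    fix t assume t: "t \<in> {0..T}"
    have "((\<lambda>t. \<zeta>\<^sub>0 + integral {0..t} (g y)) has_vector_derivative 0 + g y t) (at t within {0..T})"
      by (intro has_vector_derivative_add integral_has_vector_derivative gc t has_vector_derivative_const)
    then show "(\<zeta> has_vector_derivative G (\<zeta> t)) (at t within {0..T})"
      by (rule has_vector_derivative_transform[rotated 2, OF has_vector_derivative_eq_rhs])
        (use t z in \<open>auto simp: g_def \<zeta>_def\<close>)
  qed
qed

lemma increment_bound:
  fixes w :: "real \<Rightarrow> 'a::real_normed_vector"
  assumes "\<And>s. s \<in> {a..b} \<Longrightarrow> (w has_vector_derivative p s) (at s within {a..b})"
    and "\<And>s. s \<in> {a..b} \<Longrightarrow> norm (p s) \<le> D" and "a \<le> b"
  shows "norm (w b - w a) \<le> D * (b - a)"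
proof -
  have "norm (w b - w a) \<le> D * norm (b - a)"
  proof (rule differentiable_bound[where S="{a..b}" and f'="\<lambda>s h. h *\<^sub>R p s"])
    show "onorm (\<lambda>h. h *\<^sub>R p s) \<le> D" if "s \<in> {a..b}" for s
      using mult_right_mono[OF assms(2)[OF that] abs_ge_zero]
      by (intro onorm_le) (simp add: mult.commute)
  qed (use assms in \<open>auto simp: has_vector_derivative_def\<close>)
  then show ?thesis using assms(3) by simp
qed

lemma has_vector_derivative_translate:
  assumes "(f has_vector_derivative D) (at (c + t) within S')" "(+) c ` S \<subseteq> S'"
  shows "((\<lambda>s. f (c + s)) has_vector_derivative D) (at t within S)"
proof -
  have "((+) c has_vector_derivative 1) (at t within S)"
    by (auto intro!: derivative_eq_intros simp: has_real_derivative_iff_has_vector_derivative[symmetric])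
  from vector_diff_chain_within[OF this has_vector_derivative_within_subset[OF assms]]
  show ?thesis by (simp add: o_def)
qed

lemma caratheodory_solution_continuous:
  assumes "caratheodory_solution R z\<^sub>0 z"
  shows "continuous_on {0..} z"
proof (rule continuous_on_atLeast_zeroI)
  fix T :: real
  have "continuous_on {0..T} (\<lambda>t. z\<^sub>0 + integral {0..t} (\<lambda>s. R s (z s)))"
  proof (cases "T \<ge> 0")
    case True
    then show ?thesis
      using assms set_lebesgue_integral_eq_integral(1)
      by (intro continuous_intros indefinite_integral_continuous_1)
        (auto simp: caratheodory_solution_def)
  qed simp
  then show "continuous_on {0..T} z"
    by (rule continuous_on_eq) (use assms in \<open>auto simp: caratheodory_solution_def\<close>)
qed

text \<open>For a continuous input the integrand is continuous, so the integral equation can be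
  differentiated at every time and the solution is classical.\<close>

lemma caratheodory_has_vector_derivative:
  assumes z: "caratheodory_solution (\<lambda>t \<xi>. F (\<xi>, u t)) z\<^sub>0 z"
    and F: "continuous_on UNIV F" and u: "continuous_on {0..T} u" and t: "t \<in> {0..T}"
  shows "(z has_vector_derivative F (z t, u t)) (at t within {0..T})"
proof -
  have zc: "continuous_on {0..T} z"
    using caratheodory_solution_continuous[OF z] by (rule continuous_on_subset) auto
  have "continuous_on {0..T} (\<lambda>s. F (z s, u s))"
    by (intro continuous_on_compose2[OF F] continuous_intros zc u) auto
  then have "((\<lambda>t. z\<^sub>0 + integral {0..t} (\<lambda>s. F (z s, u s))) has_vector_derivative 0 + F (z t, u t)) (at t within {0..T})"
    by (intro has_vector_derivative_add integral_has_vector_derivative t has_vector_derivative_const)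
  then show ?thesis
    by (rule has_vector_derivative_transform[rotated 2, OF has_vector_derivative_eq_rhs])
      (use t z in \<open>auto simp: caratheodory_solution_def\<close>)
qed

section \<open>Comparison functions and inputs\<close>

lemma class_K_zero: "\<rho> \<in> class_K \<Longrightarrow> \<rho> 0 = 0"
  and class_K_continuous: "\<rho> \<in> class_K \<Longrightarrow> continuous_on {0..} \<rho>"
  by (simp_all add: class_K_def)

lemma class_K_mono:
  assumes "\<rho> \<in> class_K" "0 \<le> s" "s \<le> t"
  shows "\<rho> s \<le> \<rho> t"
proof -
  have "mono_on {0..} \<rho>"
    using assms(1) by (simp add: class_K_def strict_mono_on_imp_mono_on)
  then show ?thesis by (rule mono_onD) (use assms in auto)
qed

lemma class_K_nonneg: "\<rho> \<in> class_K \<Longrightarrow> 0 \<le> s \<Longrightarrow> 0 \<le> \<rho> s"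
  using class_K_mono[of \<rho> 0 s] by (simp add: class_K_zero)

lemma class_K_inf_K: "\<rho> \<in> class_K_inf \<Longrightarrow> \<rho> \<in> class_K"
  by (simp add: class_K_inf_def)

lemma class_N_zero: "\<rho> \<in> class_N \<Longrightarrow> \<rho> 0 = 0"
  and class_N_nonneg: "\<rho> \<in> class_N \<Longrightarrow> 0 \<le> s \<Longrightarrow> 0 \<le> \<rho> s"
  and class_N_continuous: "\<rho> \<in> class_N \<Longrightarrow> continuous_on {0..} \<rho>"
  by (simp_all add: class_N_def)

lemma class_N_mono:
  assumes "\<rho> \<in> class_N" "0 \<le> s" "s \<le> t"
  shows "\<rho> s \<le> \<rho> t"
proof -
  have "mono_on {0..} \<rho>" using assms(1) by (simp add: class_N_def)
  then show ?thesis by (rule mono_onD) (use assms in auto)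
qed

lemma class_KL_class_K: "\<beta> \<in> class_KL \<Longrightarrow> 0 \<le> t \<Longrightarrow> (\<lambda>s. \<beta> s t) \<in> class_K"
  by (simp add: class_KL_def)

lemma class_KL_mono: "\<beta> \<in> class_KL \<Longrightarrow> 0 \<le> s \<Longrightarrow> s \<le> s' \<Longrightarrow> 0 \<le> t \<Longrightarrow> \<beta> s t \<le> \<beta> s' t"
  by (rule class_K_mono[OF class_KL_class_K])

lemma class_KL_antimono:
  assumes "\<beta> \<in> class_KL" "0 \<le> s" "0 \<le> t" "t \<le> t'"
  shows "\<beta> s t' \<le> \<beta> s t"
proof -
  have "antimono_on {0..} (\<beta> s)" using assms(1,2) by (simp add: class_KL_def)
  then show ?thesis by (rule monotone_onD) (use assms in auto)
qed

lemma class_NI: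
  assumes "continuous_on {0..} \<rho>" "\<And>s t. 0 \<le> s \<Longrightarrow> s \<le> t \<Longrightarrow> \<rho> s \<le> \<rho> t" "\<rho> 0 = 0"
  shows "\<rho> \<in> class_N"
proof -
  have "\<rho> s \<ge> 0" if "s \<ge> 0" for s using assms(2)[of 0 s] assms(3) that by simp
  then show ?thesis using assms by (simp add: class_N_def mono_on_def)
qed

lemma class_K_imp_class_N: "\<rho> \<in> class_K \<Longrightarrow> \<rho> \<in> class_N"
  by (rule class_NI) (simp_all add: class_K_continuous class_K_mono class_K_zero)

lemma class_N_id: "(\<lambda>s. s) \<in> class_N"
  by (rule class_NI) (auto intro: continuous_intros)

lemma class_N_add:
  assumes "\<rho> \<in> class_N" "\<rho>' \<in> class_N" shows "(\<lambda>s. \<rho> s + \<rho>' s) \<in> class_N"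
  by (rule class_NI)
    (use assms in \<open>simp_all add: class_N_zero class_N_continuous class_N_mono add_mono continuous_on_add\<close>)

lemma class_N_mult:
  assumes \<rho>: "\<rho> \<in> class_N" and c: "continuous_on {0..} m" and mono: "mono_on {0..} m" and nn: "\<And>s. s \<ge> 0 \<Longrightarrow> m s \<ge> 0"
  shows "(\<lambda>s. \<rho> s * m s) \<in> class_N"
proof (rule class_NI)
  show "continuous_on {0..} (\<lambda>s. \<rho> s * m s)" by (intro continuous_on_mult class_N_continuous \<rho> c)
  fix s t :: real assume st: "0 \<le> s" "s \<le> t"
  have "m s \<le> m t" by (rule mono_onD[OF mono]) (use st in auto)
  then show "\<rho> s * m s \<le> \<rho> t * m t"
    using st by (intro mult_mono class_N_mono[OF \<rho>] class_N_nonneg[OF \<rho>] nn) auto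
qed (simp add: class_N_zero[OF \<rho>])

lemma class_N_scale:
  assumes "\<rho> \<in> class_N" "c \<ge> 0" shows "(\<lambda>s. c * \<rho> s) \<in> class_N"
  using class_N_mult[OF assms(1), of "\<lambda>_. c"] assms(2) by (simp add: mult.commute mono_on_def)

lemma class_N_compose:
  assumes \<rho>: "\<rho> \<in> class_N" and \<rho>': "\<rho>' \<in> class_N" shows "(\<lambda>s. \<rho> (\<rho>' s)) \<in> class_N"
proof (rule class_NI)
  show "continuous_on {0..} (\<lambda>s. \<rho> (\<rho>' s))"
    by (rule continuous_on_compose2[OF class_N_continuous[OF \<rho>] class_N_continuous[OF \<rho>']])
      (use class_N_nonneg[OF \<rho>'] in auto)
  show "\<rho> (\<rho>' s) \<le> \<rho> (\<rho>' t)" if "0 \<le> s" "s \<le> t" for s t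
    using that by (intro class_N_mono[OF \<rho>] class_N_nonneg[OF \<rho>'] class_N_mono[OF \<rho>'])
qed (simp add: class_N_zero[OF \<rho>] class_N_zero[OF \<rho>'])

text \<open>The sum of two arguments is at most twice the larger one. This replaces subadditivity,
  which class N functions need not have.\<close>

lemma class_N_add_arg:
  assumes "\<rho> \<in> class_N" "0 \<le> s" "0 \<le> t"
  shows "\<rho> (s + t) \<le> \<rho> (2 * s) + \<rho> (2 * t)"
proof (cases "s \<le> t")
  case True
  then show ?thesis using class_N_mono[OF assms(1), of "s + t" "2 * t"] class_N_nonneg[OF assms(1), of "2 * s"] assms by simp
next
  case False
  then show ?thesis using class_N_mono[OF assms(1), of "s + t" "2 * s"] class_N_nonneg[OF assms(1), of "2 * t"] assms by simp
qed

text \<open>One strictly increasing summand is enough; a class N bound can thus be promoted to class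
  K by adding a class K function.\<close>

lemma class_K_add_class_N:
  assumes \<rho>: "\<rho> \<in> class_K" and \<beta>: "\<beta> \<in> class_N" shows "(\<lambda>s. \<rho> s + \<beta> s) \<in> class_K"
proof -
  have "strict_mono_on {0..} (\<lambda>s. \<rho> s + \<beta> s)"
  proof (rule strict_mono_onI)
    fix s t :: real assume "s \<in> {0..}" "t \<in> {0..}" "s < t"
    moreover have "strict_mono_on {0..} \<rho>" using \<rho> by (simp add: class_K_def)
    ultimately show "\<rho> s + \<beta> s < \<rho> t + \<beta> t"
      using class_N_mono[OF \<beta>, of s t] by (intro add_less_le_mono) (auto elim: strict_mono_onD)
  qed
  moreover have "\<rho> s + \<beta> s > 0" if "s > 0" for s
    using \<rho> class_N_nonneg[OF \<beta>, of s] that by (auto simp: class_K_def intro: add_pos_nonneg)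
  ultimately show ?thesis
    using \<rho> \<beta> by (simp add: class_K_def class_N_zero class_N_continuous continuous_on_add)
qed

lemma class_K_inf_add_class_N:
  assumes "\<rho> \<in> class_K_inf" "\<beta> \<in> class_N" shows "(\<lambda>s. \<rho> s + \<beta> s) \<in> class_K_inf"
proof -
  have "filterlim \<rho> at_top at_top" using assms(1) by (simp add: class_K_inf_def)
  then have "filterlim (\<lambda>s. \<rho> s + \<beta> s) at_top at_top"
    by (rule filterlim_at_top_mono)
      (rule eventually_mono[OF eventually_ge_at_top[of 0]], simp add: class_N_nonneg[OF assms(2)])
  then show ?thesis using assms class_K_add_class_N by (simp add: class_K_inf_def)
qed

lemma class_KL_product:
  assumes A: "A \<in> class_K" and q: "continuous_on {0..} q" and q_pos: "\<And>t. t \<ge> 0 \<Longrightarrow> q t > 0"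
    and q_anti: "\<And>s t. 0 \<le> s \<Longrightarrow> s \<le> t \<Longrightarrow> q t \<le> q s" and q_lim: "(q \<longlongrightarrow> 0) at_top"
  shows "(\<lambda>s t. A s * q t) \<in> class_KL"
  unfolding class_KL_def
proof (intro CollectI conjI allI impI)
  show "continuous_on ({0..} \<times> {0..}) (\<lambda>(s, t). A s * q t)"
    unfolding case_prod_unfold
    by (intro continuous_on_mult continuous_on_compose2[OF class_K_continuous[OF A]]
        continuous_on_compose2[OF q] continuous_on_fst continuous_on_snd continuous_on_id) auto
  show "(\<lambda>s. A s * q t) \<in> class_K" if t: "t \<ge> 0" for t
  proof -
    have "strict_mono_on {0..} (\<lambda>s. A s * q t)"
    proof (rule strict_mono_onI)
      fix r s :: real assume "r \<in> {0..}" "s \<in> {0..}" "r < s"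
      moreover have "strict_mono_on {0..} A" using A by (simp add: class_K_def)
      ultimately have "A r < A s" by (auto elim: strict_mono_onD)
      then show "A r * q t < A s * q t" using q_pos[OF t] by simp
    qed
    moreover have "continuous_on {0..} (\<lambda>s. A s * q t)"
      by (intro continuous_on_mult class_K_continuous[OF A] continuous_on_const)
    ultimately show ?thesis using A q_pos[OF t] by (simp add: class_K_def)
  qed
  fix s :: real assume s: "s \<ge> 0"
  show "antimono_on {0..} (\<lambda>t. A s * q t)"
    by (rule monotone_onI) (use q_anti class_K_nonneg[OF A s] in \<open>auto intro: mult_left_mono\<close>)
  show "((\<lambda>t. A s * q t) \<longlongrightarrow> 0) at_top"
    using tendsto_mult_right_zero[OF q_lim, of "A s"] by simp
qed

text \<open>Times \<open>T k\<close> after which the values at arguments \<open>\<le> k\<close> are below \<open>exp (- k)\<close> are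
  interpolated by the nondecreasing 1-Lipschitz function \<open>\<kappa>\<close>, so that every value is at most
  \<open>(1 + B s * exp s) * exp (- \<kappa> t)\<close>. The geometric mean of this with the uniform bound
  \<open>B s\<close> vanishes at \<open>s = 0\<close> as well.\<close>

lemma class_KL_majorant:
  fixes P :: "real \<Rightarrow> real \<Rightarrow> real \<Rightarrow> bool"
  assumes B: "B \<in> class_N"
    and bound: "\<And>s t e. 0 \<le> s \<Longrightarrow> 0 \<le> t \<Longrightarrow> P s t e \<Longrightarrow> e \<le> B s"
    and decay: "\<And>R \<epsilon>. 0 \<le> R \<Longrightarrow> 0 < \<epsilon> \<Longrightarrow>
      \<exists>T. \<forall>s t e. 0 \<le> s \<longrightarrow> s \<le> R \<longrightarrow> 0 \<le> t \<longrightarrow> T \<le> t \<longrightarrow> P s t e \<longrightarrow> e \<le> \<epsilon>"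
  shows "\<exists>\<beta>\<in>class_KL. \<forall>s t e. 0 \<le> s \<longrightarrow> 0 \<le> t \<longrightarrow> P s t e \<longrightarrow> e \<le> \<beta> s t"
proof -
  have "\<exists>T. \<forall>k. \<forall>s t e. 0 \<le> s \<longrightarrow> s \<le> real k \<longrightarrow> 0 \<le> t \<longrightarrow> T k \<le> t \<longrightarrow> P s t e \<longrightarrow> e \<le> exp (- real k)"
    by (rule choice) (rule allI, rule decay, simp_all)
  then obtain T' where T': "\<forall>k. \<forall>s t e. 0 \<le> s \<longrightarrow> s \<le> real k \<longrightarrow> 0 \<le> t \<longrightarrow> T' k \<le> t \<longrightarrow> P s t e \<longrightarrow> e \<le> exp (- real k)" ..
  \<comment> \<open>The maximum with \<open>real k\<close> forces \<open>T\<close> to infinity, so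
    that every time lies below some \<open>T (Suc n)\<close>.\<close>
  define T where "T = (\<lambda>k. max (real k) (T' k))"
  have T: "e \<le> exp (- real k)" if "0 \<le> s" "s \<le> real k" "0 \<le> t" "T k \<le> t" "P s t e" for k s t e
    by (rule T'[rule_format, of s k t e]) (use that in \<open>simp_all add: T_def\<close>)
  \<comment> \<open>Each member of the family is a ramp that stays at height \<open>k\<close> until
    time \<open>T (Suc k)\<close> and then rises with slope one. Hence \<open>\<kappa>\<close> is at
    most \<open>k\<close> up to that time, and it tends to infinity because only finitely many ramps
    start below a given height.\<close>
  define \<kappa> where "\<kappa> = (\<lambda>t. INF k. real k + max 0 (t - T (Suc k)))"
  have bdd: "bdd_below (range (\<lambda>k. real k + max 0 (t - T (Suc k))))" for t
    by (rule bdd_belowI[of _ 0]) auto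
  have \<kappa>_le: "\<kappa> t \<le> real k + max 0 (t - T (Suc k))" for t k
    unfolding \<kappa>_def by (rule cINF_lower[OF bdd]) simp
  have \<kappa>_ge: "c \<le> \<kappa> t" if "\<And>k. c \<le> real k + max 0 (t - T (Suc k))" for c t
    unfolding \<kappa>_def by (rule cINF_greatest) (use that in auto)
  have \<kappa>_mono: "\<kappa> s \<le> \<kappa> t" if "s \<le> t" for s t
  proof (rule \<kappa>_ge)
    fix k show "\<kappa> s \<le> real k + max 0 (t - T (Suc k))" using \<kappa>_le[of s k] that by linarith
  qed
  have \<kappa>_lip: "\<kappa> s \<le> \<kappa> t + \<bar>s - t\<bar>" for s t
  proof -
    have "\<kappa> s - \<bar>s - t\<bar> \<le> \<kappa> t"
    proof (rule \<kappa>_ge)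
      fix k show "\<kappa> s - \<bar>s - t\<bar> \<le> real k + max 0 (t - T (Suc k))" using \<kappa>_le[of s k] by linarith
    qed
    then show ?thesis by linarith
  qed
  have \<kappa>_cont: "continuous_on A \<kappa>" for A
  proof (rule continuous_onI)
    fix t e :: real assume "e > 0"
    then show "\<exists>d>0. \<forall>t'\<in>A. dist t' t < d \<longrightarrow> dist (\<kappa> t') (\<kappa> t) \<le> e"
    proof (intro exI[of _ e] conjI ballI impI)
      fix t' assume "dist t' t < e"
      then show "dist (\<kappa> t') (\<kappa> t) \<le> e"
        using \<kappa>_lip[of t' t] \<kappa>_lip[of t t'] unfolding dist_real_def by linarith
    qed
  qed
  have \<kappa>_lim: "filterlim \<kappa> at_top at_top"
    unfolding filterlim_at_top
  proof
    fix Z :: real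
    obtain n :: nat where n: "Z \<le> real n" using real_arch_simple by blast
    define T0 where "T0 = Max ((\<lambda>k. T (Suc k)) ` {..n}) + real n"
    have "Z \<le> \<kappa> t" if t: "T0 \<le> t" for t
    proof (rule \<kappa>_ge)
      fix k
      show "Z \<le> real k + max 0 (t - T (Suc k))"
      proof (cases "k \<le> n")
        case True
        then have "T (Suc k) \<le> Max ((\<lambda>k. T (Suc k)) ` {..n})" by (intro Max_ge) auto
        then show ?thesis using n t unfolding T0_def by linarith
      next
        case False
        then show ?thesis using n by linarith
      qed
    qed
    then show "\<forall>\<^sub>F t in at_top. Z \<le> \<kappa> t" unfolding eventually_at_top_linorder by blast
  qed
  have main: "e \<le> (1 + B s * exp s) * exp (- \<kappa> t)" if s: "0 \<le> s" and t: "0 \<le> t" and P: "P s t e" for s t e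
  proof -
    obtain n :: nat where "t < real n" using reals_Archimedean2 by blast
    then have ex: "t < T (Suc n)" by (auto simp: T_def)
    \<comment> \<open>The least index whose time is still ahead: for \<open>k > 0\<close> the time
      \<open>T k\<close> has passed, so the decay at level \<open>k\<close> is available at
      \<open>t\<close>.\<close>
    define k where "k = (LEAST k. t < T (Suc k))"
    have k: "t < T (Suc k)" unfolding k_def using ex by (rule LeastI)
    have \<kappa>k: "\<kappa> t \<le> real k" using \<kappa>_le[of t k] k by simp
    have Bs: "0 \<le> B s" by (rule class_N_nonneg[OF B s])
    show ?thesis
    proof (cases "s \<le> real k \<and> k > 0")
      case True
      then have "\<not> t < T (Suc (k - 1))" unfolding k_def by (intro not_less_Least) (simp add: k_def)
      then have "e \<le> exp (- real k)" using True by (intro T[OF s _ t _ P]) auto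
      also have "\<dots> \<le> exp (- \<kappa> t)" using \<kappa>k by simp
      also have "\<dots> \<le> (1 + B s * exp s) * exp (- \<kappa> t)" using Bs by (simp add: algebra_simps)
      finally show ?thesis .
    next
      \<comment> \<open>For \<open>s\<close> above \<open>k\<close>, or \<open>k = 0\<close>, no
        decay is known at \<open>t\<close>, but then \<open>\<kappa> t \<le> s\<close>, and the
        factor \<open>exp s\<close> compensates for \<open>exp (- \<kappa> t)\<close>.\<close>
      case False
      then have "real k \<le> s" using s by auto
      then have "1 \<le> exp s * exp (- \<kappa> t)" using \<kappa>k by (simp add: exp_add[symmetric])
      have "e \<le> B s" by (rule bound[OF s t P])
      also have "\<dots> \<le> B s * (exp s * exp (- \<kappa> t))"
        using mult_left_mono[OF \<open>1 \<le> exp s * exp (- \<kappa> t)\<close> Bs] by simp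
      also have "\<dots> \<le> (1 + B s * exp s) * exp (- \<kappa> t)" by (simp add: algebra_simps)
      finally show ?thesis .
    qed
  qed
  define C where "C = (\<lambda>s. B s * (1 + B s * exp s))"
  have CN: "C \<in> class_N"
    unfolding C_def
  proof (rule class_N_mult[OF B])
    show "continuous_on {0..} (\<lambda>s. 1 + B s * exp s)"
      by (intro continuous_intros class_N_continuous[OF B])
    show "mono_on {0..} (\<lambda>s. 1 + B s * exp s)"
      by (rule mono_onI) (auto intro!: add_left_mono mult_mono class_N_mono[OF B] class_N_nonneg[OF B])
  qed (simp add: class_N_nonneg[OF B])
  have sqrtC: "(\<lambda>s. sqrt (C s)) \<in> class_N"
    by (rule class_NI)
      (simp_all add: class_N_zero[OF CN] class_N_mono[OF CN] continuous_on_real_sqrt class_N_continuous[OF CN])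
  have id: "(\<lambda>s. s) \<in> class_K" by (auto simp: class_K_def strict_mono_on_def intro: continuous_intros)
  \<comment> \<open>\<open>sqrt (C s)\<close> is only of class N; the summand \<open>s\<close>
    supplies strict monotonicity. The halved exponent comes from the square root of the product of
    the two bounds.\<close>
  define \<beta> where "\<beta> = (\<lambda>s t. (s + sqrt (C s)) * exp (- \<kappa> t / 2))"
  have "LIM t at_top. 1 / 2 * \<kappa> t :> at_top"
    by (rule filterlim_tendsto_pos_mult_at_top[OF tendsto_const _ \<kappa>_lim]) simp
  then have "LIM t at_top. - \<kappa> t / 2 :> at_bot"
    by (simp add: filterlim_uminus_at_top)
  then have "((\<lambda>t. exp (- \<kappa> t / 2)) \<longlongrightarrow> 0) at_top"
    by (rule filterlim_compose[OF exp_at_bot])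
  then have "\<beta> \<in> class_KL"
    unfolding \<beta>_def
    by (intro class_KL_product class_K_add_class_N[OF id sqrtC] continuous_intros \<kappa>_cont) (auto intro: \<kappa>_mono)
  moreover have "e \<le> \<beta> s t" if s: "0 \<le> s" and t: "0 \<le> t" and P: "P s t e" for s t e
  proof (cases "e \<le> 0")
    case True
    then show ?thesis using s class_N_nonneg[OF sqrtC s] by (auto simp: \<beta>_def intro: order_trans mult_nonneg_nonneg)
  next
    case False
    have Bs: "0 \<le> B s" by (rule class_N_nonneg[OF B s])
    have "e * e \<le> B s * ((1 + B s * exp s) * exp (- \<kappa> t))"
      using False by (intro mult_mono bound[OF s t P] main[OF s t P] Bs) auto
    also have "\<dots> = (sqrt (C s) * exp (- \<kappa> t / 2))\<^sup>2"
      using Bs by (simp add: C_def power_mult_distrib exp_double[symmetric] algebra_simps)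
    finally have "e\<^sup>2 \<le> (sqrt (C s) * exp (- \<kappa> t / 2))\<^sup>2" by (simp add: power2_eq_square)
    then have "e \<le> sqrt (C s) * exp (- \<kappa> t / 2)"
      by (rule power2_le_imp_le) (use class_N_nonneg[OF sqrtC s] in simp)
    also have "\<dots> \<le> \<beta> s t" using s by (simp add: \<beta>_def)
    finally show ?thesis .
  qed
  ultimately show ?thesis by blast
qed

lemma class_KL_small:
  assumes "\<beta> \<in> class_KL" "0 \<le> \<rho>" "0 < \<epsilon>"
  obtains L where "0 \<le> L" "\<beta> \<rho> L \<le> \<epsilon>"
proof -
  have "(\<beta> \<rho> \<longlongrightarrow> 0) at_top" using assms by (simp add: class_KL_def)
  then have "\<forall>\<^sub>F t in at_top. \<beta> \<rho> t < \<epsilon>" using assms(3) by (rule order_tendstoD)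
  then obtain N where "\<And>t. t \<ge> N \<Longrightarrow> \<beta> \<rho> t < \<epsilon>" unfolding eventually_at_top_linorder by blast
  then show thesis by (intro that[of "max 0 N"]) (auto intro: less_imp_le)
qed

lemma class_N_small:
  assumes "\<rho> \<in> class_N" "0 < \<epsilon>"
  obtains \<delta> where "0 < \<delta>" "\<rho> \<delta> \<le> \<epsilon>"
proof -
  have "\<exists>d>0. \<forall>t\<in>{0..}. dist t 0 < d \<longrightarrow> dist (\<rho> t) (\<rho> 0) < \<epsilon>"
    using class_N_continuous[OF assms(1)] assms(2) unfolding continuous_on_iff by force
  then obtain d where d: "d > 0" "\<And>t. t \<in> {0..} \<Longrightarrow> dist t 0 < d \<Longrightarrow> dist (\<rho> t) (\<rho> 0) < \<epsilon>" by blast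
  have "dist (\<rho> (d / 2)) (\<rho> 0) < \<epsilon>" by (rule d(2)) (use d(1) in auto)
  then show thesis using d(1) class_N_zero[OF assms(1)] by (intro that[of "d / 2"]) (auto simp: dist_real_def)
qed

section \<open>Admissible inputs and their suprema\<close>

lemma Linf_locI:
  fixes g :: "real \<Rightarrow> 'a::euclidean_space"
  assumes "f \<in> borel_measurable borel" "\<And>t. t \<ge> 0 \<Longrightarrow> g t = f t"
    and "\<And>T. T \<ge> 0 \<Longrightarrow> bounded (g ` {0..T})"
  shows "g \<in> Linf_loc UNIV"
proof -
  have "f \<in> borel_measurable (lebesgue_on {0..})"
    using assms(1) by (intro measurable_restrict_space1) (auto simp: measurable_completion)
  then have "g \<in> borel_measurable (lebesgue_on {0..})"
    by (rule measurable_cong[THEN iffD1, rotated]) (use assms(2) in \<open>auto simp: space_restrict_space\<close>)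
  then show ?thesis using assms(3) by (simp add: Linf_loc_def)
qed

lemma continuous_Linf_loc:
  fixes g :: "real \<Rightarrow> 'a::euclidean_space"
  assumes "continuous_on UNIV g"
  shows "g \<in> Linf_loc UNIV"
proof (rule Linf_locI)
  show "g \<in> borel_measurable borel" using assms by (rule borel_measurable_continuous_onI)
  show "bounded (g ` {0..T})" for T
    by (intro compact_imp_bounded compact_continuous_image continuous_on_subset[OF assms]) auto
qed simp

lemma bounded_imageE:
  assumes "bounded (g ` A)"
  obtains B where "\<And>s. s \<in> A \<Longrightarrow> norm (g s) \<le> B"
proof -
  from assms obtain B where "\<forall>y \<in> g ` A. norm y \<le> B" unfolding bounded_iff ..
  then show thesis by (intro that[of B]) simp
qed

lemma Linf_loc_bounded:
  assumes "v \<in> Linf_loc D"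
  obtains B where "\<And>s. s \<in> {0..T} \<Longrightarrow> norm (v s) \<le> B"
proof (cases "T \<ge> 0")
  case True
  then have "bounded (v ` {0..T})" using assms by (simp add: Linf_loc_def)
  then show thesis by (rule bounded_imageE) (rule that)
qed (use that in auto)

definition sup_norm :: "(real \<Rightarrow> real) \<Rightarrow> real \<Rightarrow> real" where
  "sup_norm v t = (SUP s\<in>{0..t}. \<bar>v s\<bar>)"

lemma Linf_loc_bdd_above:
  fixes v :: "real \<Rightarrow> real"
  assumes "v \<in> Linf_loc D"
  shows "bdd_above ((\<lambda>s. \<bar>v s\<bar>) ` {0..t})"
proof -
  obtain B where B: "\<And>s. s \<in> {0..t} \<Longrightarrow> norm (v s) \<le> B" using Linf_loc_bounded[OF assms] by blast
  show ?thesis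
  proof (rule bdd_aboveI2)
    show "\<bar>v s\<bar> \<le> B" if "s \<in> {0..t}" for s using B[OF that] by simp
  qed
qed

lemma le_sup_norm: "v \<in> Linf_loc D \<Longrightarrow> s \<in> {0..t} \<Longrightarrow> \<bar>v s\<bar> \<le> sup_norm v t"
  unfolding sup_norm_def by (rule cSUP_upper[OF _ Linf_loc_bdd_above])

lemma sup_norm_nonneg: "v \<in> Linf_loc D \<Longrightarrow> 0 \<le> t \<Longrightarrow> 0 \<le> sup_norm v t"
  using le_sup_norm[of v D 0 t] by (auto intro: order_trans[OF abs_ge_zero])

text \<open>Doubling the argument absorbs the fact that the supremum need not be attained.\<close>

lemma class_N_sup_norm_le:
  assumes \<rho>: "\<rho> \<in> class_N" and v: "v \<in> Linf_loc D" and t: "0 \<le> t"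
  shows "\<rho> (sup_norm v t) \<le> (SUP s\<in>{0..t}. \<rho> (2 * \<bar>v s\<bar>))"
proof -
  have bdd: "bdd_above ((\<lambda>s. \<rho> (2 * \<bar>v s\<bar>)) ` {0..t})"
  proof (rule bdd_aboveI2)
    show "\<rho> (2 * \<bar>v s\<bar>) \<le> \<rho> (2 * sup_norm v t)" if "s \<in> {0..t}" for s
      using le_sup_norm[OF v that] by (intro class_N_mono[OF \<rho>]) auto
  qed
  have "\<exists>s\<in>{0..t}. sup_norm v t \<le> 2 * \<bar>v s\<bar>"
  proof (rule ccontr)
    assume "\<not> (\<exists>s\<in>{0..t}. sup_norm v t \<le> 2 * \<bar>v s\<bar>)"
    then have lt: "2 * \<bar>v s\<bar> < sup_norm v t" if "s \<in> {0..t}" for s using that by force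
    have half: "\<bar>v s\<bar> \<le> sup_norm v t / 2" if "s \<in> {0..t}" for s using lt[OF that] by linarith
    \<comment> \<open>The supremum would be at most half of itself, hence nonpositive, against the
      strict inequality at \<open>s = 0\<close>.\<close>
    have "(SUP s\<in>{0..t}. \<bar>v s\<bar>) \<le> sup_norm v t / 2"
      by (rule cSUP_least) (use t in simp, rule half)
    then have "2 * \<bar>v 0\<bar> < 0" using lt[of 0] t unfolding sup_norm_def[symmetric] by simp
    then show False by simp
  qed
  then obtain s where s: "s \<in> {0..t}" "sup_norm v t \<le> 2 * \<bar>v s\<bar>" ..
  then have "\<rho> (sup_norm v t) \<le> \<rho> (2 * \<bar>v s\<bar>)"
    by (intro class_N_mono[OF \<rho>] sup_norm_nonneg[OF v t])
  also have "\<dots> \<le> (SUP s\<in>{0..t}. \<rho> (2 * \<bar>v s\<bar>))" by (rule cSUP_upper[OF s(1) bdd])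
  finally show ?thesis .
qed

section \<open>Sampling times\<close>

locale sampling =
  fixes r :: real and d :: "real \<Rightarrow> real"
  assumes r_pos: "r > 0" and d: "d \<in> Linf_loc {0..}"
begin

abbreviation "\<tau> \<equiv> sampling_time r d"

lemma \<tau>_less_Suc: "\<tau> i < \<tau> (Suc i)"
  using r_pos by simp

lemma \<tau>_strict_mono: "strict_mono \<tau>"
  by (rule strict_monoI_Suc) (rule \<tau>_less_Suc)

lemma \<tau>_nonneg: "0 \<le> \<tau> i"
  using strict_mono_leD[OF \<tau>_strict_mono, of 0 i] by simp

lemma \<tau>_Suc_le: "\<tau> (Suc i) \<le> \<tau> i + r"
proof -
  have "d (\<tau> i) \<ge> 0" using d \<tau>_nonneg[of i] by (auto simp: Linf_loc_def)
  then show ?thesis using r_pos by simp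
qed

declare sampling_time.simps(2) [simp del]

text \<open>If the sampling times stayed below \<open>T\<close>, the bound \<open>B\<close> of
  \<open>d\<close> on \<open>{0..T}\<close> would keep every step at least
  \<open>r * exp (- B)\<close>, and these steps add up to infinity: local boundedness of
  \<open>d\<close> rules out accumulation of samples.\<close>

lemma \<tau>_unbounded: "\<exists>i. T < \<tau> i"
proof (rule ccontr)
  assume "\<nexists>i. T < \<tau> i"
  then have le: "\<tau> i \<le> T" for i by (meson not_le)
  obtain B where B: "\<And>s. s \<in> {0..T} \<Longrightarrow> norm (d s) \<le> B"
    using Linf_loc_bounded[OF d] by blast
  have lower: "real i * (r * exp (- B)) \<le> \<tau> i" for i
  proof (induction i)
    case (Suc i)
    have "d (\<tau> i) \<le> B" using B[of "\<tau> i"] le \<tau>_nonneg by (simp add: abs_le_iff)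
    then have "r * exp (- B) \<le> r * exp (- d (\<tau> i))" using r_pos by simp
    then show ?case using Suc by (simp add: algebra_simps sampling_time.simps(2))
  qed simp
  obtain n where "T < real n * (r * exp (- B))"
    using reals_Archimedean3[of "r * exp (- B)" ] r_pos by (metis exp_gt_zero mult_pos_pos)
  then show False using lower[of n] le[of n] by linarith
qed

lemma \<tau>_covers:
  assumes "0 \<le> t"
  obtains i where "t \<in> {\<tau> i..<\<tau> (Suc i)}"
proof -
  define n where "n = (LEAST i. t < \<tau> i)"
  have n: "t < \<tau> n" unfolding n_def using \<tau>_unbounded by (rule LeastI_ex)
  obtain i where i: "n = Suc i" using n assms by (cases n) auto
  have "\<not> t < \<tau> i" using i unfolding n_def by (metis lessI not_less_Least)
  then show thesis using n i that[of i] by simp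
qed

lemma \<tau>_cell_unique:
  assumes "t \<in> {\<tau> i..<\<tau> (Suc i)}" "t \<in> {\<tau> j..<\<tau> (Suc j)}"
  shows "i = j"
proof -
  have "\<tau> i < \<tau> (Suc j)" "\<tau> j < \<tau> (Suc i)" using assms by auto
  then have "i < Suc j" "j < Suc i" using strict_mono_less[OF \<tau>_strict_mono] by blast+
  then show ?thesis by simp
qed

lemma finite_\<tau>: "finite (range \<tau> \<inter> {..T})"
proof -
  obtain n where n: "T < \<tau> n" using \<tau>_unbounded by blast
  have "range \<tau> \<inter> {..T} \<subseteq> \<tau> ` {..n}"
  proof
    fix t assume "t \<in> range \<tau> \<inter> {..T}"
    then obtain i where i: "t = \<tau> i" "\<tau> i \<le> T" by auto
    then have "\<tau> i < \<tau> n" using n by simp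
    then have "i < n" using strict_mono_less[OF \<tau>_strict_mono] by blast
    then show "t \<in> \<tau> ` {..n}" using i by auto
  qed
  then show ?thesis by (rule finite_subset) simp
qed

end

lemma hybrid_solution_iff:
  "hybrid_solution f h r g G d v x\<^sub>0 \<zeta>\<^sub>0 (x, \<zeta>) \<longleftrightarrow>
     classical_solution f x\<^sub>0 x \<and> \<zeta> 0 = \<zeta>\<^sub>0 \<and>
     (\<forall>i. (\<forall>t\<in>{sampling_time r d i..<sampling_time r d (Suc i)}.
             (\<zeta> has_vector_derivative g (\<zeta> t, \<zeta> (sampling_time r d i), h (x (sampling_time r d i)) + v (sampling_time r d i)))
               (at t within {sampling_time r d i..<sampling_time r d (Suc i)})) \<and>
          (\<exists>l. (\<zeta> \<longlongrightarrow> l) (at_left (sampling_time r d (Suc i))) \<and>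
               \<zeta> (sampling_time r d (Suc i)) = G (l, h (x (sampling_time r d (Suc i))) + v (sampling_time r d (Suc i)))))"
  by (simp add: hybrid_solution_def Let_def)

section \<open>Existence of runs\<close>

text \<open>The constants that the hypotheses only assert to exist are fixed here as parameters, so
  that the bounds and waiting times derived from them are visibly the same for all runs.
  \<open>m\<close> is the growth function of the output, \<open>\<sigma>'\<close> the transient in
  the bound for the Lie derivatives.\<close>

locale sampled_observer =
  fixes f :: "'n::euclidean_space \<Rightarrow> 'n" and h :: "'n \<Rightarrow> real"
    and F :: "'k::euclidean_space \<times> real \<Rightarrow> 'k" and \<Psi> :: "'k \<Rightarrow> 'n"
    and K r :: real and \<sigma>' \<sigma> :: "real \<Rightarrow> real \<Rightarrow> real" and \<gamma> p \<mu> a \<mu>\<^sub>x a\<^sub>x m :: "real \<Rightarrow> real"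
  assumes C1_f: "C1 f" and C2_h: "C2 h" and f_0: "f 0 = 0" and h_0: "h 0 = 0"
    and m_continuous: "continuous_on {0..} m" and m_mono: "mono_on {0..} m"
    and m_nonneg: "\<And>s. s \<ge> 0 \<Longrightarrow> m s \<ge> 0" and h_growth: "\<And>x. norm (h x) \<le> norm x * m (norm x)"
    and \<mu>x: "\<mu>\<^sub>x \<in> Kplus" and ax: "a\<^sub>x \<in> class_K_inf"
    and complete: "\<And>x\<^sub>0. the_solution_satisfies (classical_solution f x\<^sub>0)
          (\<lambda>x. \<forall>t\<ge>0. norm (x t) \<le> \<mu>\<^sub>x t * a\<^sub>x (norm x\<^sub>0))"
    and C1_F: "C1 F" and C1_\<Psi>: "C1 \<Psi>" and F_0: "F (0, 0) = 0" and \<Psi>_0: "\<Psi> 0 = 0"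
    and \<sigma>: "\<sigma> \<in> class_KL" and \<gamma>: "\<gamma> \<in> class_N" and p: "p \<in> class_N" and \<mu>: "\<mu> \<in> Kplus"
    and a: "a \<in> class_K_inf"
    and observer: "\<And>x\<^sub>0 z\<^sub>0 v. v \<in> Linf_loc UNIV \<Longrightarrow>
          the_solution_satisfies (observer_solution f h F v x\<^sub>0 z\<^sub>0) (\<lambda>(x, z). \<forall>t\<ge>0.
            norm (\<Psi> (z t) - x t) \<le> \<sigma> (norm x\<^sub>0 + norm z\<^sub>0) t + (SUP s\<in>{0..t}. \<gamma> \<bar>v s\<bar>) \<and>
            norm (z t) \<le> \<mu> t * (a (norm x\<^sub>0 + norm z\<^sub>0) + (SUP s\<in>{0..t}. p \<bar>v s\<bar>)))"
    and K: "K \<ge> 0" and \<sigma>': "\<sigma>' \<in> class_KL"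
    and Lie: "\<And>x\<^sub>0 z\<^sub>0 v. v \<in> Linf_loc UNIV \<Longrightarrow>
      the_solution_satisfies (observer_solution f h F v x\<^sub>0 z\<^sub>0) (\<lambda>(x, z). \<forall>t\<ge>0.
        \<bar>Lie_deriv f h (\<Psi> (z t)) - Lie_deriv f h (x t)\<bar>
          \<le> \<sigma>' (norm x\<^sub>0 + norm z\<^sub>0) t + K * (SUP s\<in>{0..t}. \<bar>v s\<bar>))"
    and r: "r > 0" and rK: "r * K < 1"
begin

text \<open>The right-hand side between samples depends on the current state only, so all cells of a
  run are pieces of the flow of this one autonomous vector field.\<close>

definition field :: "'k \<times> real \<Rightarrow> 'k \<times> real" where
  "field = (\<lambda>\<zeta>. (F \<zeta>, Lie_deriv f h (\<Psi> (fst \<zeta>))))"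

lemma C1_field: "C1 field"
  unfolding field_def
  by (intro C1_Pair C1_F C1_compose[OF C1_Lie_deriv[OF C1_f C2_h]] C1_compose[OF C1_\<Psi>]
      C1_bounded_linear bounded_linear_fst)

lemma Lie_deriv_0: "Lie_deriv f h 0 = 0"
proof -
  obtain h' where h': "\<And>x. (h has_derivative blinfun_apply (h' x)) (at x)"
    using C2_h unfolding C2_def by blast
  then show ?thesis
    by (simp add: Lie_deriv_def frechet_derivative_at[OF h', symmetric] f_0)
qed

text \<open>The suprema of the input are traded for an arbitrary bound \<open>B\<close>, the form in
  which control of the error is obtained later.\<close>

lemma observer_bounds:
  assumes "v \<in> Linf_loc UNIV" "observer_solution f h F v x\<^sub>0 z\<^sub>0 (x, z)"
    and "0 \<le> t" and B: "\<And>s. s \<in> {0..t} \<Longrightarrow> \<bar>v s\<bar> \<le> B"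
  shows "norm (\<Psi> (z t) - x t) \<le> \<sigma> (norm x\<^sub>0 + norm z\<^sub>0) t + \<gamma> B"
    and "norm (z t) \<le> \<mu> t * (a (norm x\<^sub>0 + norm z\<^sub>0) + p B)"
    and "\<bar>Lie_deriv f h (\<Psi> (z t)) - Lie_deriv f h (x t)\<bar> \<le> \<sigma>' (norm x\<^sub>0 + norm z\<^sub>0) t + K * B"
proof -
  have SUP_le: "(SUP s\<in>{0..t}. \<rho> \<bar>v s\<bar>) \<le> \<rho> B" if "\<rho> \<in> class_N" for \<rho>
    by (rule cSUP_least) (use \<open>0 \<le> t\<close> in \<open>auto intro!: class_N_mono[OF that] B\<close>)
  have SUP_le': "(SUP s\<in>{0..t}. \<bar>v s\<bar>) \<le> B"
    by (rule cSUP_least) (use B \<open>0 \<le> t\<close> in auto)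
  have mu: "\<mu> t \<ge> 0" using \<mu> \<open>0 \<le> t\<close> unfolding Kplus_def by (auto intro: less_imp_le)
  have "\<forall>t\<ge>0. norm (\<Psi> (z t) - x t) \<le> \<sigma> (norm x\<^sub>0 + norm z\<^sub>0) t + (SUP s\<in>{0..t}. \<gamma> \<bar>v s\<bar>) \<and>
            norm (z t) \<le> \<mu> t * (a (norm x\<^sub>0 + norm z\<^sub>0) + (SUP s\<in>{0..t}. p \<bar>v s\<bar>))"
    using observer[OF assms(1), of x\<^sub>0 z\<^sub>0, unfolded the_solution_satisfies_def, THEN conjunct2, THEN spec, THEN mp, OF assms(2)]
    unfolding prod.case .
  then have est: "norm (\<Psi> (z t) - x t) \<le> \<sigma> (norm x\<^sub>0 + norm z\<^sub>0) t + (SUP s\<in>{0..t}. \<gamma> \<bar>v s\<bar>)"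
    "norm (z t) \<le> \<mu> t * (a (norm x\<^sub>0 + norm z\<^sub>0) + (SUP s\<in>{0..t}. p \<bar>v s\<bar>))"
    using assms(3) by blast+
  show "norm (\<Psi> (z t) - x t) \<le> \<sigma> (norm x\<^sub>0 + norm z\<^sub>0) t + \<gamma> B"
    using est(1) SUP_le[OF \<gamma>] by linarith
  show "norm (z t) \<le> \<mu> t * (a (norm x\<^sub>0 + norm z\<^sub>0) + p B)"
    by (rule order_trans[OF est(2) mult_left_mono[OF add_left_mono[OF SUP_le[OF p]] mu]])
  have "\<forall>t\<ge>0. \<bar>Lie_deriv f h (\<Psi> (z t)) - Lie_deriv f h (x t)\<bar>
          \<le> \<sigma>' (norm x\<^sub>0 + norm z\<^sub>0) t + K * (SUP s\<in>{0..t}. \<bar>v s\<bar>)"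
    using Lie[OF assms(1), of x\<^sub>0 z\<^sub>0, unfolded the_solution_satisfies_def, THEN conjunct2, THEN spec, THEN mp, OF assms(2)]
    unfolding prod.case .
  then have "\<bar>Lie_deriv f h (\<Psi> (z t)) - Lie_deriv f h (x t)\<bar>
          \<le> \<sigma>' (norm x\<^sub>0 + norm z\<^sub>0) t + K * (SUP s\<in>{0..t}. \<bar>v s\<bar>)"
    using assms(3) by blast
  then show "\<bar>Lie_deriv f h (\<Psi> (z t)) - Lie_deriv f h (x t)\<bar> \<le> \<sigma>' (norm x\<^sub>0 + norm z\<^sub>0) t + K * B"
    using mult_left_mono[OF SUP_le' K] by linarith
qed

lemma solution_bound:
  assumes "classical_solution f x\<^sub>0 x" "t \<ge> 0"
  shows "norm (x t) \<le> \<mu>\<^sub>x t * a\<^sub>x (norm x\<^sub>0)"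
  using complete[of x\<^sub>0] assms unfolding the_solution_satisfies_def by blast

text \<open>The plant may be frozen at its equilibrium, where the output vanishes; the second component
  of an integral curve of the field then acts as a measurement error of the observer. This is
  what prevents finite escape.\<close>

lemma field_a_priori_bound:
  fixes z\<^sub>0 :: 'k and w\<^sub>0 :: real
  obtains M where "\<And>\<zeta> T t. \<zeta> 0 = (z\<^sub>0, w\<^sub>0) \<Longrightarrow> T \<le> r \<Longrightarrow>
    (\<And>t. t \<in> {0..T} \<Longrightarrow> (\<zeta> has_vector_derivative field (\<zeta> t)) (at t within {0..T})) \<Longrightarrow>
    t \<in> {0..T} \<Longrightarrow> norm (\<zeta> t) \<le> M"
proof -
  \<comment> \<open>\<open>W\<close> solves \<open>W = \<bar>w\<^sub>0\<bar> + r * (\<sigma>' (norm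
    z\<^sub>0) 0 + K * W)\<close>: it is the fixed point of the loop estimate for \<open>w\<close>
    over a time of at most \<open>r\<close>.\<close>
  define W where "W = (\<bar>w\<^sub>0\<bar> + r * \<sigma>' (norm z\<^sub>0) 0) / (1 - r * K)"
  have "compact (\<mu> ` {0..r})"
    using \<mu> by (intro compact_continuous_image) (auto simp: Kplus_def intro: continuous_on_subset)
  then obtain k where k: "\<And>t. t \<in> {0..r} \<Longrightarrow> \<mu> t \<le> k"
    using compact_imp_bounded[THEN bounded_imp_bdd_above] unfolding bdd_above_def by fastforce
  have "norm (\<zeta> t) \<le> k * (a (norm z\<^sub>0) + p W) + W"
    if z0: "\<zeta> 0 = (z\<^sub>0, w\<^sub>0)" and T: "T \<le> r" and
      d: "\<And>t. t \<in> {0..T} \<Longrightarrow> (\<zeta> has_vector_derivative field (\<zeta> t)) (at t within {0..T})"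
      and t: "t \<in> {0..T}" for \<zeta> T t
  proof -
    define z w where "z = (\<lambda>t. fst (\<zeta> t))" and "w = (\<lambda>t. snd (\<zeta> t))"
    have T0: "T \<ge> 0" using t by simp
    have zd: "(z has_vector_derivative F (z t, w t)) (at t within {0..T})"
      and wd: "(w has_vector_derivative Lie_deriv f h (\<Psi> (z t))) (at t within {0..T})"
      if "t \<in> {0..T}" for t
      using bounded_linear.has_vector_derivative[OF bounded_linear_fst d[OF that]]
        bounded_linear.has_vector_derivative[OF bounded_linear_snd d[OF that]]
      by (simp_all add: z_def w_def field_def)
    have zc: "continuous_on {0..T} z" and wc: "continuous_on {0..T} w"
      by (rule continuous_on_vector_derivative, erule zd wd)+
    \<comment> \<open>Clamping time extends \<open>w\<close> from \<open>{0..T}\<close> to a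
      continuous, hence admissible, input on the whole half-line.\<close>
    define v where "v = (\<lambda>s. w (max 0 (min s T)))"
    have vc: "continuous_on UNIV v"
      unfolding v_def by (rule continuous_on_compose2[OF wc]) (use T0 in \<open>auto intro!: continuous_intros\<close>)
    have v_eq: "v s = w s" if "s \<in> {0..T}" for s using that by (auto simp: v_def)
    have v: "v \<in> Linf_loc UNIV" by (rule continuous_Linf_loc[OF vc])
    obtain x z' where xz: "observer_solution f h F v 0 z\<^sub>0 (x, z')"
      using Lie[OF v, of 0 z\<^sub>0] unfolding the_solution_satisfies_def by auto
    then have x: "classical_solution f 0 x"
      and z': "caratheodory_solution (\<lambda>t \<xi>. F (\<xi>, h (x t) + v t)) z\<^sub>0 z'"
      by (simp_all add: observer_solution_def)
    have x0: "x t = 0" if "t \<ge> 0" for t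
      using solution_bound[OF x that] class_K_zero[OF class_K_inf_K[OF ax]] by simp
    have hv: "h (x s) + v s = w s" if "s \<in> {0..T}" for s
      using that x0 v_eq h_0 by simp
    have hvc: "continuous_on {0..T} (\<lambda>s. h (x s) + v s)"
      by (rule continuous_on_eq[OF wc]) (use hv in auto)
    have z'd: "(z' has_vector_derivative F (z' t, w t)) (at t within {0..T})" if "t \<in> {0..T}" for t
      using caratheodory_has_vector_derivative[OF z' C1_continuous_on[OF C1_F] hvc that] hv[OF that] by simp
    have z'c: "continuous_on {0..T} z'"
      by (rule continuous_on_vector_derivative, erule z'd)
    have "bounded ((\<lambda>s. (z s, w s)) ` {0..T} \<union> (\<lambda>s. (z' s, w s)) ` {0..T})"
      by (intro bounded_Un[THEN iffD2] conjI compact_imp_bounded compact_continuous_image continuous_intros zc wc z'c) auto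
    then obtain R where "\<forall>x \<in> (\<lambda>s. (z s, w s)) ` {0..T} \<union> (\<lambda>s. (z' s, w s)) ` {0..T}. norm x \<le> R"
      unfolding bounded_iff by blast
    then have R: "\<And>s. s \<in> {0..T} \<Longrightarrow> norm (z s, w s) \<le> R"
        "\<And>s. s \<in> {0..T} \<Longrightarrow> norm (z' s, w s) \<le> R"
      by blast+
    obtain L where L: "L \<ge> 0" "\<And>x y. norm x \<le> R \<Longrightarrow> norm y \<le> R \<Longrightarrow> norm (F x - F y) \<le> L * norm (x - y)"
      using C1_lipschitz_cball[OF C1_F, of R] by blast
    \<comment> \<open>The hypotheses speak about the observer's own trajectory \<open>z'\<close>.
      Both \<open>z\<close> and \<open>z'\<close> obey the same equation with input \<open>w\<close>
      from the same initial state, so they coincide.\<close>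
    have eq: "z s = z' s" if "s \<in> {0..T}" for s
    proof -
      have "z s - z' s = 0"
      proof (rule vanishing_of_linear_growth[where a=0 and b=T and L=L and
            e="\<lambda>s. z s - z' s" and p="\<lambda>s. F (z s, w s) - F (z' s, w s)"])
        show "norm (F (z s, w s) - F (z' s, w s)) \<le> L * norm (z s - z' s)" if "s \<in> {0..T}" for s
          using L(2)[OF R(1)[OF that] R(2)[OF that]] by (simp add: norm_Pair)
        show "z 0 - z' 0 = 0" using z0 z' by (auto simp: z_def caratheodory_solution_def)
      qed (use that zd z'd in \<open>auto intro: has_vector_derivative_diff\<close>)
      then show ?thesis by simp
    qed
    define B where "B = (SUP s\<in>{0..T}. \<bar>w s\<bar>)"
    have "bdd_above ((\<lambda>s. \<bar>w s\<bar>) ` {0..T})"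
      by (intro bounded_imp_bdd_above compact_imp_bounded compact_continuous_image continuous_intros wc) auto
    then have wB: "\<bar>w s\<bar> \<le> B" if "s \<in> {0..T}" for s
      unfolding B_def using that by (rule cSUP_upper[rotated])
    have Lz: "\<bar>Lie_deriv f h (\<Psi> (z s))\<bar> \<le> \<sigma>' (norm z\<^sub>0) 0 + K * B" if s: "s \<in> {0..T}" for s
    proof -
      have "\<bar>Lie_deriv f h (\<Psi> (z' s)) - Lie_deriv f h (x s)\<bar> \<le> \<sigma>' (norm (0::'n) + norm z\<^sub>0) s + K * B"
        by (rule observer_bounds(3)[OF v xz]) (use s wB v_eq in auto)
      also have "\<sigma>' (norm (0::'n) + norm z\<^sub>0) s \<le> \<sigma>' (norm z\<^sub>0) 0"
        using class_KL_antimono[OF \<sigma>', of "norm z\<^sub>0" 0 s] s by simp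
      finally show ?thesis using eq[OF s] x0[of s] s Lie_deriv_0 by simp
    qed
    \<comment> \<open>Here \<open>T \<le> r\<close> enters: the increment of \<open>w\<close> is at
      most \<open>r\<close> times its rate, and the dependence of that rate on \<open>B\<close> is
      absorbed because \<open>r * K < 1\<close>.\<close>
    have "B \<le> \<bar>w\<^sub>0\<bar> + r * (\<sigma>' (norm z\<^sub>0) 0 + K * B)"
      unfolding B_def
    proof (rule cSUP_least)
      fix s assume s: "s \<in> {0..T}"
      have nn: "0 \<le> \<sigma>' (norm z\<^sub>0) 0 + K * B" using Lz[OF s] by linarith
      have "norm (w s - w 0) \<le> (\<sigma>' (norm z\<^sub>0) 0 + K * B) * (s - 0)"
        by (rule increment_bound[where p="\<lambda>s. Lie_deriv f h (\<Psi> (z s))"])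
          (use s Lz in \<open>auto intro: has_vector_derivative_within_subset[OF wd]\<close>)
      also have "\<dots> \<le> (\<sigma>' (norm z\<^sub>0) 0 + K * B) * r" using nn s T by (intro mult_left_mono) auto
      finally show "\<bar>w s\<bar> \<le> \<bar>w\<^sub>0\<bar> + r * (\<sigma>' (norm z\<^sub>0) 0 + K * (SUP s\<in>{0..T}. \<bar>w s\<bar>))"
        using z0 by (simp add: w_def B_def mult.commute)
    qed (use T0 in simp)
    then have "B * (1 - r * K) \<le> \<bar>w\<^sub>0\<bar> + r * \<sigma>' (norm z\<^sub>0) 0" by (simp add: algebra_simps)
    then have BW: "B \<le> W" using rK by (simp add: W_def pos_le_divide_eq)
    have wW: "\<bar>w s\<bar> \<le> W" if "s \<in> {0..T}" for s using wB[OF that] BW by simp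
    have "norm (z' t) \<le> \<mu> t * (a (norm (0::'n) + norm z\<^sub>0) + p W)"
      by (rule observer_bounds(2)[OF v xz]) (use t wW v_eq in auto)
    also have "\<dots> \<le> k * (a (norm z\<^sub>0) + p W)"
      using k[of t] t T class_K_nonneg[OF class_K_inf_K[OF a], of "norm z\<^sub>0"]
        class_N_nonneg[OF p, of W] wW[OF t] by (auto intro!: mult_right_mono add_nonneg_nonneg)
    finally have "norm (z t) \<le> k * (a (norm z\<^sub>0) + p W)" using eq[OF t] by simp
    moreover have "norm (\<zeta> t) \<le> norm (z t) + norm (w t)"
      unfolding z_def w_def by (metis norm_Pair_le prod.collapse)
    ultimately show ?thesis using wW[OF t] by simp
  qed
  then show thesis using that by blast
qed

text \<open>The field is cut off by composing it with the projection onto a ball whose radius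
  exceeds the a priori bound. The cut-off field is globally Lipschitz, so a trajectory exists on
  \<open>{0..r}\<close>; the a priori bound keeps it inside the ball, where the two fields
  agree.\<close>

lemma field_flow_exists:
  "\<exists>\<zeta>. \<zeta> 0 = \<zeta>\<^sub>0 \<and> (\<forall>t\<in>{0..r}. (\<zeta> has_vector_derivative field (\<zeta> t)) (at t within {0..r}))"
proof -
  obtain M where M: "\<And>\<zeta> T t. \<zeta> 0 = \<zeta>\<^sub>0 \<Longrightarrow> T \<le> r \<Longrightarrow>
    (\<And>t. t \<in> {0..T} \<Longrightarrow> (\<zeta> has_vector_derivative field (\<zeta> t)) (at t within {0..T})) \<Longrightarrow>
    t \<in> {0..T} \<Longrightarrow> norm (\<zeta> t) \<le> M"
    using field_a_priori_bound[of "fst \<zeta>\<^sub>0" "snd \<zeta>\<^sub>0"] unfolding prod.collapse by blast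
  define R where "R = max M (norm \<zeta>\<^sub>0) + 1"
  have R: "M < R" "norm \<zeta>\<^sub>0 < R" by (auto simp: R_def)
  then have R0: "R > 0" using norm_ge_zero[of \<zeta>\<^sub>0] by linarith
  define cp where "cp = closest_point (cball (0::'k \<times> real) R)"
  have cp: "norm (cp x) \<le> R" for x
    using closest_point_in_set[of "cball (0::'k \<times> real) R" x] R0 by (simp add: cp_def)
  obtain L where L: "L \<ge> 0"
    "\<And>x y. norm x \<le> R \<Longrightarrow> norm y \<le> R \<Longrightarrow> norm (field x - field y) \<le> L * norm (x - y)"
    using C1_lipschitz_cball[OF C1_field, of R] by blast
  have "norm (field (cp x) - field (cp y)) \<le> L * norm (x - y)" for x y
  proof -
    have "norm (cp x - cp y) \<le> norm (x - y)"
      using closest_point_lipschitz[of "cball (0::'k \<times> real) R" x y] R0 by (simp add: cp_def dist_norm)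
    then show ?thesis using L(2)[OF cp cp, of x y] L(1) by (meson mult_left_mono order_trans)
  qed
  then obtain \<zeta> where z0: "\<zeta> 0 = \<zeta>\<^sub>0" and zd:
    "\<And>t. t \<in> {0..r} \<Longrightarrow> (\<zeta> has_vector_derivative field (cp (\<zeta> t))) (at t within {0..r})"
    using global_lipschitz_ode_exists[of "\<lambda>x. field (cp x)" L r \<zeta>\<^sub>0] r by (metis less_imp_le)
  have zc: "continuous_on {0..r} \<zeta>"
    by (rule continuous_on_vector_derivative, erule zd)
  \<comment> \<open>As long as the trajectory has stayed in the ball it solves the original
    equation, and the a priori bound improves \<open>R\<close> to the strictly smaller
    \<open>M\<close>.\<close>
  have local: "norm (\<zeta> T) < R" if T: "T \<in> {0..r}" and le: "\<And>t. t \<in> {0..T} \<Longrightarrow> norm (\<zeta> t) \<le> R" for T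
  proof -
    have "(\<zeta> has_vector_derivative field (\<zeta> t)) (at t within {0..T})" if "t \<in> {0..T}" for t
      using has_vector_derivative_within_subset[OF zd, of t "{0..T}"] that T le[OF that]
        closest_point_self[of "\<zeta> t" "cball 0 R"] by (simp add: cp_def)
    note d = this
    have "norm (\<zeta> T) \<le> M" by (rule M[of \<zeta> T T, OF z0 _ d]) (use T in auto)
    then show ?thesis using R(1) by simp
  qed
  have inside: "norm (\<zeta> t) \<le> R" if t: "t \<in> {0..r}" for t
  proof (rule ccontr)
    assume nle: "\<not> norm (\<zeta> t) \<le> R"
    \<comment> \<open>If the ball were left, the set of times on its boundary sphere would be
      nonempty and compact; its least element contradicts \<open>local\<close>.\<close>
    let ?S = "{s \<in> {0..t}. norm (\<zeta> s) = R}"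
    have ivt: "\<exists>s\<in>{0..u}. norm (\<zeta> s) = R" if "u \<in> {0..r}" "norm (\<zeta> u) \<ge> R" for u
    proof -
      have "continuous_on {0..u} (\<lambda>s. norm (\<zeta> s))"
        by (intro continuous_on_norm continuous_on_subset[OF zc]) (use that in auto)
      then show ?thesis
        using IVT'[of "\<lambda>s. norm (\<zeta> s)" 0 R u] that R(2) z0 by auto
    qed
    have ne: "?S \<noteq> {}" using ivt[OF t] nle by auto
    have "compact ?S"
      unfolding compact_eq_bounded_closed
    proof
      show "bounded ?S" by (rule bounded_subset[of "{0..t}"]) auto
      show "closed ?S"
        by (intro continuous_closed_preimage_constant continuous_intros continuous_on_subset[OF zc]) (use t in auto)
    qed
    then obtain T where T: "T \<in> ?S" "\<And>s. s \<in> ?S \<Longrightarrow> T \<le> s"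
      using compact_attains_inf[OF _ ne] by blast
    have "norm (\<zeta> s) \<le> R" if s: "s \<in> {0..T}" for s
    proof (rule ccontr)
      assume "\<not> norm (\<zeta> s) \<le> R"
      then obtain s' where s': "s' \<in> {0..s}" "norm (\<zeta> s') = R" using ivt[of s] s T(1) t by auto
      then have "T \<le> s'" using T(1) s by (intro T(2)) auto
      then have "s = T" "s' = T" using s' s by auto
      then show False using s' \<open>\<not> norm (\<zeta> s) \<le> R\<close> by simp
    qed
    then show False using local[of T] T(1) t by auto
  qed
  show ?thesis
  proof (intro exI[of _ \<zeta>] conjI ballI)
    show "(\<zeta> has_vector_derivative field (\<zeta> t)) (at t within {0..r})" if "t \<in> {0..r}" for t
      using zd[OF that] closest_point_self[of "\<zeta> t" "cball 0 R"] inside[OF that] by (simp add: cp_def)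
  qed (rule z0)
qed

section \<open>Runs of the sampled observer\<close>

abbreviation "observer_field \<equiv> (\<lambda>((z, w), _, _). (F (z, w), Lie_deriv f h (\<Psi> z)))
  :: ('k \<times> real) \<times> ('k \<times> real) \<times> real \<Rightarrow> 'k \<times> real"

abbreviation "observer_reset \<equiv> (\<lambda>((z, w), y). (z, y)) :: ('k \<times> real) \<times> real \<Rightarrow> 'k \<times> real"

lemma observer_field_eq: "observer_field (\<zeta>, q) = field \<zeta>"
  by (simp add: field_def split: prod.split)

lemma observer_reset_eq: "observer_reset (\<zeta>, y) = (fst \<zeta>, y)"
  by (simp split: prod.split)

text \<open>Pieces of the flow on \<open>{0..r}\<close> are glued together, which suffices because
  no cell is longer than \<open>r\<close>. The plant trajectory can be given in advance, since the
  observer feeds nothing back into it.\<close>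

lemma hybrid_solution_exists:
  assumes d: "d \<in> Linf_loc {0..}" and x: "classical_solution f x\<^sub>0 x"
  obtains \<zeta> where "hybrid_solution f h r observer_field observer_reset d v x\<^sub>0 \<zeta>\<^sub>0 (x, \<zeta>)"
proof -
  interpret sampling r d using r d by unfold_locales
  have "\<exists>S. \<forall>\<xi>. S \<xi> 0 = \<xi> \<and> (\<forall>t\<in>{0..r}. (S \<xi> has_vector_derivative field (S \<xi> t)) (at t within {0..r}))"
    by (rule choice) (rule allI, rule field_flow_exists)
  then obtain S where S: "\<forall>\<xi>. S \<xi> 0 = \<xi> \<and> (\<forall>t\<in>{0..r}. (S \<xi> has_vector_derivative field (S \<xi> t)) (at t within {0..r}))" ..
  have S0: "S \<zeta> 0 = \<zeta>" for \<zeta> by (rule conjunct1[OF spec[OF S]])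
  have Sd: "(S \<zeta> has_vector_derivative field (S \<zeta> t)) (at t within {0..r})" if "t \<in> {0..r}" for \<zeta> t
    by (rule bspec[OF conjunct2[OF spec[OF S]] that])
  \<comment> \<open>\<open>c i\<close> is the state at the start of cell \<open>i\<close>: the
    \<open>z\<close>-part is carried over from the end of the previous piece, the
    \<open>w\<close>-part is replaced by the measured output.\<close>
  define c where "c = rec_nat \<zeta>\<^sub>0 (\<lambda>i \<xi>. (fst (S \<xi> (\<tau> (Suc i) - \<tau> i)), h (x (\<tau> (Suc i))) + v (\<tau> (Suc i))))"
  have c0: "c 0 = \<zeta>\<^sub>0"
    and c_Suc: "c (Suc i) = (fst (S (c i) (\<tau> (Suc i) - \<tau> i)), h (x (\<tau> (Suc i))) + v (\<tau> (Suc i)))" for i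
    by (simp_all add: c_def)
  define \<zeta> where "\<zeta> = (\<lambda>t. let i = THE i. t \<in> {\<tau> i..<\<tau> (Suc i)} in S (c i) (t - \<tau> i))"
  have \<zeta>: "\<zeta> t = S (c i) (t - \<tau> i)" if "t \<in> {\<tau> i..<\<tau> (Suc i)}" for t i
  proof -
    have "(THE i. t \<in> {\<tau> i..<\<tau> (Suc i)}) = i"
      by (rule the_equality) (rule that, rule \<tau>_cell_unique[OF _ that])
    then show ?thesis by (simp add: \<zeta>_def Let_def del: atLeastLessThan_iff)
  qed
  have \<zeta>_\<tau>: "\<zeta> (\<tau> i) = c i" for i using \<zeta>[of "\<tau> i" i] \<tau>_less_Suc[of i] S0 by simp
  \<comment> \<open>The closed cell is used, right end included, because the left limit at the next
    sample is read off from continuity there.\<close>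
  have piece: "((\<lambda>t. S (c i) (t - \<tau> i)) has_vector_derivative field (S (c i) (t - \<tau> i)))
      (at t within {\<tau> i..\<tau> (Suc i)})" if "t \<in> {\<tau> i..\<tau> (Suc i)}" for t i
  proof -
    have m: "- \<tau> i + t \<in> {0..r}" using that \<tau>_Suc_le[of i] by auto
    have "(+) (- \<tau> i) ` {\<tau> i..\<tau> (Suc i)} \<subseteq> {0..r}" using \<tau>_Suc_le[of i] by auto
    from has_vector_derivative_translate[OF Sd[OF m] this] show ?thesis by simp
  qed
  have "hybrid_solution f h r observer_field observer_reset d v x\<^sub>0 \<zeta>\<^sub>0 (x, \<zeta>)"
    unfolding hybrid_solution_iff observer_field_eq observer_reset_eq
  proof (intro conjI allI ballI)
    show "classical_solution f x\<^sub>0 x" by (rule x)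
    show "\<zeta> 0 = \<zeta>\<^sub>0" using \<zeta>_\<tau>[of 0] c0 by simp
    fix i
    show "(\<zeta> has_vector_derivative field (\<zeta> t)) (at t within {\<tau> i..<\<tau> (Suc i)})"
      if t: "t \<in> {\<tau> i..<\<tau> (Suc i)}" for t
    proof (rule has_vector_derivative_transform[OF t])
      have "((\<lambda>t. S (c i) (t - \<tau> i)) has_vector_derivative field (S (c i) (t - \<tau> i)))
        (at t within {\<tau> i..<\<tau> (Suc i)})"
        by (rule has_vector_derivative_within_subset[OF piece]) (use t in auto)
      then show "((\<lambda>t. S (c i) (t - \<tau> i)) has_vector_derivative field (\<zeta> t)) (at t within {\<tau> i..<\<tau> (Suc i)})"
        using \<zeta>[OF t] by simp
    qed (rule \<zeta>)
    have cont: "continuous_on {\<tau> i..\<tau> (Suc i)} (\<lambda>t. S (c i) (t - \<tau> i))"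
      by (rule continuous_on_vector_derivative, erule piece)
    have "((\<lambda>t. S (c i) (t - \<tau> i)) \<longlongrightarrow> S (c i) (\<tau> (Suc i) - \<tau> i)) (at_left (\<tau> (Suc i)))"
      by (rule continuous_on_Icc_at_leftD[OF cont \<tau>_less_Suc])
    moreover have "\<forall>\<^sub>F t in at_left (\<tau> (Suc i)). S (c i) (t - \<tau> i) = \<zeta> t"
      by (rule eventually_at_leftI[OF _ \<tau>_less_Suc[of i]], rule \<zeta>[symmetric]) simp
    ultimately have "(\<zeta> \<longlongrightarrow> S (c i) (\<tau> (Suc i) - \<tau> i)) (at_left (\<tau> (Suc i)))"
      by (rule Lim_transform_eventually)
    moreover have "\<zeta> (\<tau> (Suc i)) = (fst (S (c i) (\<tau> (Suc i) - \<tau> i)), h (x (\<tau> (Suc i))) + v (\<tau> (Suc i)))"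
      unfolding \<zeta>_\<tau> by (rule c_Suc)
    ultimately show "\<exists>l. (\<zeta> \<longlongrightarrow> l) (at_left (\<tau> (Suc i))) \<and>
         \<zeta> (\<tau> (Suc i)) = (fst l, h (x (\<tau> (Suc i))) + v (\<tau> (Suc i)))"
      by (intro exI[of _ "S (c i) (\<tau> (Suc i) - \<tau> i)"] conjI)
  qed
  then show thesis using that by blast
qed

text \<open>The closed-loop gain, that is the sum of the geometric series of \<open>r * K\<close>: a
  term fed through the loop again and again is amplified by this factor in total.\<close>

definition c where "c = 1 / (1 - r * K)"

text \<open>Before amplification by \<open>c\<close>, the summand \<open>s\<close> bounds the
  initial \<open>w\<close>, \<open>s * m s\<close> bounds the initial output, and
  \<open>r * \<sigma>' s 0\<close> bounds what the transient adds within one cell.\<close>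

definition b where "b s = c * (s + s * m s + r * \<sigma>' s 0)"

text \<open>The a priori bound for the error \<open>u\<close> of runs of size at most \<open>R\<close> whose measurement error
  is dominated by \<open>b\<close> of their size.\<close>

definition M where "M R = (1 + c) * b R"

lemma c: "c \<ge> 1" "1 + r * K * c = c"
  using r rK K by (simp_all add: c_def field_simps)

lemma b_class_N: "b \<in> class_N"
proof -
  have "(\<lambda>s. \<sigma>' s 0) \<in> class_N"
    by (rule class_K_imp_class_N[OF class_KL_class_K[OF \<sigma>']]) simp
  then have "(\<lambda>s. r * \<sigma>' s 0) \<in> class_N" by (rule class_N_scale) (use r in simp)
  moreover have "(\<lambda>s. s + s * m s) \<in> class_N"
    by (rule class_N_add[OF class_N_id class_N_mult[OF class_N_id m_continuous m_mono m_nonneg]])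
  ultimately have "(\<lambda>s. s + s * m s + r * \<sigma>' s 0) \<in> class_N" by (rule class_N_add[rotated])
  then have "(\<lambda>s. c * (s + s * m s + r * \<sigma>' s 0)) \<in> class_N" by (rule class_N_scale) (use c(1) in simp)
  then show ?thesis unfolding b_def .
qed

lemma M_class_N: "M \<in> class_N"
  unfolding M_def by (rule class_N_scale[OF b_class_N]) (use c(1) in simp)

lemma \<mu>_nonneg: "t \<ge> 0 \<Longrightarrow> 0 \<le> \<mu> t" and \<mu>x_nonneg: "t \<ge> 0 \<Longrightarrow> 0 \<le> \<mu>\<^sub>x t"
  using \<mu> \<mu>x unfolding Kplus_def by (auto intro: less_imp_le)

lemmas a_mono = class_K_mono[OF class_K_inf_K[OF a]] and a_nonneg = class_K_nonneg[OF class_K_inf_K[OF a]]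
  and ax_mono = class_K_mono[OF class_K_inf_K[OF ax]] and ax_nonneg = class_K_nonneg[OF class_K_inf_K[OF ax]]

text \<open>The product \<open>s * t\<close> is at most the larger of the two squares. This
  separates variables: the output along a solution is bounded through the product of a function of
  time and a function of the initial state, while the growth estimate demands separate
  factors.\<close>

lemma m_product: "0 \<le> s \<Longrightarrow> 0 \<le> t \<Longrightarrow> m (s * t) \<le> (1 + m (s\<^sup>2)) * (1 + m (t\<^sup>2))"
proof -
  assume s: "0 \<le> s" and t: "0 \<le> t"
  have nn: "0 \<le> m (s\<^sup>2)" "0 \<le> m (t\<^sup>2)" by (simp_all add: m_nonneg)
  have "m (s * t) \<le> m (s\<^sup>2) \<or> m (s * t) \<le> m (t\<^sup>2)"
  proof (cases "s \<le> t")
    case True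
    then have "s * t \<le> t\<^sup>2" using t by (simp add: power2_eq_square mult_right_mono)
    then show ?thesis using mono_onD[OF m_mono, of "s * t" "t\<^sup>2"] s t by simp
  next
    case False
    then have "s * t \<le> s\<^sup>2" using s by (simp add: power2_eq_square mult_left_mono)
    then show ?thesis using mono_onD[OF m_mono, of "s * t" "s\<^sup>2"] s t by simp
  qed
  moreover have "(1 + m (s\<^sup>2)) * (1 + m (t\<^sup>2)) = 1 + m (s\<^sup>2) + m (t\<^sup>2) + m (s\<^sup>2) * m (t\<^sup>2)"
    by (simp add: algebra_simps)
  moreover have "0 \<le> m (s\<^sup>2) * m (t\<^sup>2)" using nn by (rule mult_nonneg_nonneg)
  ultimately show ?thesis using nn by linarith
qed

end

section \<open>Estimates along a run\<close>

locale hybrid_run = sampled_observer +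
  fixes d v x\<^sub>0 \<zeta>\<^sub>0 x \<zeta>
  assumes d: "d \<in> Linf_loc {0..}" and v: "v \<in> Linf_loc UNIV"
    and run: "hybrid_solution f h r observer_field observer_reset d v x\<^sub>0 \<zeta>\<^sub>0 (x, \<zeta>)"
begin

sublocale sampling r d
  using r d by unfold_locales

abbreviation "z t \<equiv> fst (\<zeta> t)"
abbreviation "w t \<equiv> snd (\<zeta> t)"

definition u where "u t = w t - h (x t)"

lemma x: "classical_solution f x\<^sub>0 x"
  and \<zeta>_init: "\<zeta> 0 = \<zeta>\<^sub>0"
  and \<zeta>_deriv: "t \<in> {\<tau> i..<\<tau> (Suc i)} \<Longrightarrow>
    (\<zeta> has_vector_derivative field (\<zeta> t)) (at t within {\<tau> i..<\<tau> (Suc i)})"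
  and \<zeta>_jump: "\<exists>l. (\<zeta> \<longlongrightarrow> l) (at_left (\<tau> (Suc i))) \<and>
         \<zeta> (\<tau> (Suc i)) = (fst l, h (x (\<tau> (Suc i))) + v (\<tau> (Suc i)))"
proof -
  note run' = run[unfolded hybrid_solution_iff observer_field_eq observer_reset_eq]
  show "classical_solution f x\<^sub>0 x" "\<zeta> 0 = \<zeta>\<^sub>0"
    using conjunct1[OF run'] conjunct1[OF conjunct2[OF run']] .
  note step = spec[OF conjunct2[OF conjunct2[OF run']], of i]
  show "\<exists>l. (\<zeta> \<longlongrightarrow> l) (at_left (\<tau> (Suc i))) \<and>
         \<zeta> (\<tau> (Suc i)) = (fst l, h (x (\<tau> (Suc i))) + v (\<tau> (Suc i)))"
    by (rule conjunct2[OF step])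
  show "(\<zeta> has_vector_derivative field (\<zeta> t)) (at t within {\<tau> i..<\<tau> (Suc i)})"
    if "t \<in> {\<tau> i..<\<tau> (Suc i)}"
    by (rule bspec[OF conjunct1[OF step] that])
qed

lemma x_init: "x 0 = x\<^sub>0"
  and x_deriv: "t \<ge> 0 \<Longrightarrow> (x has_vector_derivative f (x t)) (at t within {0..})"
  using x by (auto simp: classical_solution_def)

lemma x_continuous: "continuous_on {0..} x"
  by (rule continuous_on_vector_derivative[where f'="\<lambda>t. f (x t)"]) (simp add: x_deriv)

lemma hx_continuous: "continuous_on {0..} (\<lambda>t. h (x t))"
  by (rule continuous_on_compose2[OF C1_continuous_on[OF C2_imp_C1[OF C2_h], of UNIV] x_continuous]) simp

text \<open>The index starts at one: at time zero \<open>w\<close> belongs to the freely chosen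
  initial state, so the error there is not a measurement error.\<close>

lemma u_sample: "u (\<tau> (Suc i)) = v (\<tau> (Suc i))"
  using \<zeta>_jump[of i] by (auto simp: u_def)

text \<open>On the closed cell the value at the right end is replaced by the left limit. A reset
  alters only \<open>w\<close>, so the \<open>z\<close>-part of the modified curve still ends at its
  true value.\<close>

lemma \<zeta>_left_continuation:
  obtains \<xi> where "continuous_on {\<tau> i..\<tau> (Suc i)} \<xi>" "\<And>t. t \<in> {\<tau> i..<\<tau> (Suc i)} \<Longrightarrow> \<xi> t = \<zeta> t"
    "fst (\<xi> (\<tau> (Suc i))) = z (\<tau> (Suc i))"
proof -
  obtain l where l: "(\<zeta> \<longlongrightarrow> l) (at_left (\<tau> (Suc i)))"
     "\<zeta> (\<tau> (Suc i)) = (fst l, h (x (\<tau> (Suc i))) + v (\<tau> (Suc i)))"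
    using \<zeta>_jump by blast
  define \<xi> where "\<xi> = \<zeta>(\<tau> (Suc i) := l)"
  have "continuous (at t within {\<tau> i..\<tau> (Suc i)}) \<xi>" if t: "t \<in> {\<tau> i..\<tau> (Suc i)}" for t
  proof (cases "t = \<tau> (Suc i)")
    case True
    have "\<forall>\<^sub>F t in at_left (\<tau> (Suc i)). \<zeta> t = \<xi> t"
      by (rule eventually_at_leftI[OF _ \<tau>_less_Suc[of i]]) (simp add: \<xi>_def)
    then have "(\<xi> \<longlongrightarrow> l) (at_left (\<tau> (Suc i)))" by (rule Lim_transform_eventually[OF l(1)])
    moreover have "\<xi> t = l" using True by (simp add: \<xi>_def)
    ultimately show ?thesis unfolding continuous_within True
      by (simp only: at_within_Icc_at_left[OF \<tau>_less_Suc])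
  next
    case False
    then have t': "t \<in> {\<tau> i..<\<tau> (Suc i)}" using t by auto
    have eq: "at t within {\<tau> i..<\<tau> (Suc i)} = at t within {\<tau> i..\<tau> (Suc i)}"
      by (rule at_within_nhd[of _ "{..<\<tau> (Suc i)}"]) (use t' in auto)
    have "(\<xi> has_vector_derivative field (\<zeta> t)) (at t within {\<tau> i..<\<tau> (Suc i)})"
      by (rule has_vector_derivative_transform[OF t' _ \<zeta>_deriv[OF t']]) (auto simp: \<xi>_def)
    then show ?thesis unfolding eq by (rule has_vector_derivative_continuous)
  qed
  then have "continuous_on {\<tau> i..\<tau> (Suc i)} \<xi>" by (simp add: continuous_on_eq_continuous_within)
  then show thesis by (rule that) (use l in \<open>auto simp: \<xi>_def\<close>)
qed

lemma z_continuous: "continuous_on {0..} z"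
proof (rule continuous_on_atLeast_zeroI)
  fix T
  have "continuous_on {0..\<tau> n} z" for n
  proof (induction n)
    case (Suc n)
    obtain \<xi> where \<xi>: "continuous_on {\<tau> n..\<tau> (Suc n)} \<xi>" "\<And>t. t \<in> {\<tau> n..<\<tau> (Suc n)} \<Longrightarrow> \<xi> t = \<zeta> t"
      "fst (\<xi> (\<tau> (Suc n))) = z (\<tau> (Suc n))"
      using \<zeta>_left_continuation[of n] by blast
    have "continuous_on {\<tau> n..\<tau> (Suc n)} z"
    proof (rule continuous_on_eq[OF continuous_on_fst[OF \<xi>(1)]])
      show "fst (\<xi> t) = z t" if "t \<in> {\<tau> n..\<tau> (Suc n)}" for t
        using that \<xi>(2)[of t] \<xi>(3) by (cases "t = \<tau> (Suc n)") auto
    qed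
    then have "continuous_on ({0..\<tau> n} \<union> {\<tau> n..\<tau> (Suc n)}) z"
      by (intro continuous_on_closed_Un Suc) auto
    then show ?case
      using \<tau>_nonneg[of n] \<tau>_less_Suc[of n] by (simp add: ivl_disj_un_two_touch(4))
  qed simp
  note cell = this
  obtain n where "T < \<tau> n" using \<tau>_unbounded by blast
  then show "continuous_on {0..T} z" by (intro continuous_on_subset[OF cell[of n]]) auto
qed

lemma \<zeta>_bounded: "bounded (\<zeta> ` {0..T})"
proof -
  have "bounded (\<zeta> ` {0..<\<tau> n})" for n
  proof (induction n)
    case (Suc n)
    obtain \<xi> where \<xi>: "continuous_on {\<tau> n..\<tau> (Suc n)} \<xi>" "\<And>t. t \<in> {\<tau> n..<\<tau> (Suc n)} \<Longrightarrow> \<xi> t = \<zeta> t"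
      using \<zeta>_left_continuation[of n] by blast
    have "bounded (\<xi> ` {\<tau> n..\<tau> (Suc n)})"
      by (intro compact_imp_bounded compact_continuous_image \<xi>) auto
    moreover have "\<zeta> ` {\<tau> n..<\<tau> (Suc n)} \<subseteq> \<xi> ` {\<tau> n..\<tau> (Suc n)}"
      using \<xi>(2) by (force)
    ultimately have "bounded (\<zeta> ` {\<tau> n..<\<tau> (Suc n)})" by (rule bounded_subset)
    with Suc have "bounded (\<zeta> ` {0..<\<tau> n} \<union> \<zeta> ` {\<tau> n..<\<tau> (Suc n)})" by simp
    moreover have "{0..<\<tau> (Suc n)} \<subseteq> {0..<\<tau> n} \<union> {\<tau> n..<\<tau> (Suc n)}" by auto
    ultimately show ?case by (rule bounded_subset[OF _ order_trans[OF image_mono eq_refl[OF image_Un]]])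
  qed simp
  note cell = this
  obtain n where "T < \<tau> n" using \<tau>_unbounded by blast
  then show ?thesis by (intro bounded_subset[OF cell[of n]] image_mono) auto
qed

lemma \<zeta>_deriv_at:
  assumes "t > 0" "t \<notin> range \<tau>"
  shows "(\<zeta> has_vector_derivative field (\<zeta> t)) (at t)"
proof -
  obtain i where i: "t \<in> {\<tau> i..<\<tau> (Suc i)}" using \<tau>_covers[of t] assms(1) by auto
  have "t \<noteq> \<tau> i" using assms(2) by blast
  with i have "t \<in> {\<tau> i<..<\<tau> (Suc i)}" by simp
  moreover have "(\<zeta> has_vector_derivative field (\<zeta> t)) (at t within {\<tau> i<..<\<tau> (Suc i)})"
    by (rule has_vector_derivative_within_subset[OF \<zeta>_deriv[OF i]])
      (rule greaterThanLessThan_subseteq_atLeastLessThan_iff[THEN iffD2], simp)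
  ultimately show ?thesis
    using has_vector_derivative_within_open[OF _ open_greaterThanLessThan] by blast
qed

text \<open>The error is continuous off the countable set of sampling times, hence Borel, and it is
  locally bounded; so it is an admissible input for the original observer.\<close>

lemma u_Linf_loc:
  assumes "T \<ge> 0"
  shows "(\<lambda>s. u (T + s)) \<in> Linf_loc UNIV"
proof (rule Linf_locI)
  \<comment> \<open>Before time zero \<open>\<zeta>\<close> is arbitrary, so \<open>u\<close> is
    replaced by zero there. The jump this may create at zero does no harm, because
    \<open>\<tau> 0 = 0\<close> is among the exceptional points.\<close>
  define \<omega> where "\<omega> = (\<lambda>t. if t \<ge> 0 then u t else 0)"
  have "continuous_on (- range \<tau>) \<omega>"
    unfolding continuous_on_eq_continuous_within
  proof
    fix t assume t: "t \<in> - range \<tau>"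
    then have "t \<noteq> \<tau> 0" by blast
    then have "t \<noteq> 0" by simp
    then consider "t < 0" | "t > 0" by linarith
    then have "isCont \<omega> t"
    proof cases
      case 1
      have "isCont \<omega> t \<longleftrightarrow> isCont (\<lambda>_. 0 :: real) t"
        by (rule isCont_cong, rule eventually_mono[OF eventually_nhds_in_open[of "{..<0}"]])
          (use 1 in \<open>auto simp: \<omega>_def\<close>)
      then show ?thesis by simp
    next
      case 2
      have "isCont \<zeta> t" using \<zeta>_deriv_at[OF 2] t by (auto dest: has_vector_derivative_continuous)
      moreover have "isCont (\<lambda>t. h (x t)) t"
        using hx_continuous 2 by (auto intro: continuous_on_interior[of "{0..}"])
      ultimately have "isCont u t" unfolding u_def by (intro continuous_intros)
      moreover have "isCont \<omega> t \<longleftrightarrow> isCont u t"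
        by (rule isCont_cong, rule eventually_mono[OF eventually_nhds_in_open[of "{0<..}"]])
          (use 2 in \<open>auto simp: \<omega>_def\<close>)
      ultimately show ?thesis by simp
    qed
    then show "continuous (at t within - range \<tau>) \<omega>" by (rule continuous_at_imp_continuous_at_within)
  qed
  then have [measurable]: "\<omega> \<in> borel_measurable borel"
    by (rule borel_measurable_continuous_countable_exceptions[rotated]) simp
  show "(\<lambda>s. \<omega> (T + s)) \<in> borel_measurable borel" by measurable
  show "u (T + t) = \<omega> (T + t)" if "t \<ge> 0" for t using that assms by (simp add: \<omega>_def)
  fix S :: real assume "S \<ge> 0"
  have "bounded ((\<lambda>t. h (x t)) ` {0..T+S})"
    by (intro compact_imp_bounded compact_continuous_image continuous_on_subset[OF hx_continuous]) auto
  then obtain A where A: "\<And>t. t \<in> {0..T+S} \<Longrightarrow> norm (h (x t)) \<le> A"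
    by (rule bounded_imageE) blast
  obtain B where B: "\<And>t. t \<in> {0..T+S} \<Longrightarrow> norm (\<zeta> t) \<le> B"
    using bounded_imageE[OF \<zeta>_bounded[of "T+S"]] by blast
  have "norm (u (T + s)) \<le> B + A" if "s \<in> {0..S}" for s
  proof -
    have "\<bar>w (T + s)\<bar> \<le> norm (\<zeta> (T + s))" using norm_snd_le[of "w (T + s)" "z (T + s)"] by simp
    then show ?thesis using A[of "T+s"] B[of "T+s"] that assms by (simp add: u_def)
  qed
  then show "bounded ((\<lambda>s. u (T + s)) ` {0..S})" unfolding bounded_iff by blast
qed

text \<open>The continuous part of the run is a trajectory of the original observer driven by the
  error \<open>u\<close>, and by autonomy this remains so after a restart at any time \<open>T\<close>.\<close>

lemma observer_restart:
  assumes T: "T \<ge> 0"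
  shows "observer_solution f h F (\<lambda>s. u (T + s)) (x T) (z T) (\<lambda>s. x (T + s), \<lambda>s. z (T + s))"
  unfolding observer_solution_def prod.case
proof
  show "classical_solution f (x T) (\<lambda>s. x (T + s))"
    unfolding classical_solution_def
  proof (intro conjI allI impI)
    show "((\<lambda>s. x (T + s)) has_vector_derivative f (x (T + t))) (at t within {0..})" if "t \<ge> 0" for t
      by (rule has_vector_derivative_translate[OF x_deriv]) (use that T in auto)
  qed simp
  have eq: "F (z (T + s), h (x (T + s)) + u (T + s)) = F (\<zeta> (T + s))" for s by (simp add: u_def)
  show "caratheodory_solution (\<lambda>t \<xi>. F (\<xi>, h (x (T + t)) + u (T + t))) (z T) (\<lambda>s. z (T + s))"
    unfolding caratheodory_solution_def eq
  proof (intro allI impI)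
    fix t :: real assume t: "t \<ge> 0"
    \<comment> \<open>\<open>w\<close>, and with it the derivative of \<open>z\<close>, may jump at
      samples. Since \<open>z\<close> is continuous and only finitely many samples fall into a
      bounded interval, the fundamental theorem of calculus still holds.\<close>
    have I: "((\<lambda>s. F (\<zeta> (T + s))) has_integral z (T + t) - z (T + 0)) {0..t}"
    proof (rule fundamental_theorem_of_calculus_interior_strong)
      let ?S = "(\<lambda>s. s - T) ` (range \<tau> \<inter> {..T + t})"
      show "finite ?S" by (intro finite_imageI finite_\<tau>)
      show "((\<lambda>s. z (T + s)) has_vector_derivative F (\<zeta> (T + s))) (at s)" if s: "s \<in> {0<..<t} - ?S" for s
      proof -
        have "T + s \<notin> range \<tau>"
        proof
          assume "T + s \<in> range \<tau>"
          then have "T + s \<in> range \<tau> \<inter> {..T + t}" using s by auto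
          then have "(T + s) - T \<in> ?S" by (rule imageI)
          then show False using s by simp
        qed
        then have "(\<zeta> has_vector_derivative field (\<zeta> (T + s))) (at (T + s))"
          using s T by (intro \<zeta>_deriv_at) auto
        then have "(z has_vector_derivative F (\<zeta> (T + s))) (at (T + s))"
          using bounded_linear.has_vector_derivative[OF bounded_linear_fst] by (force simp: field_def)
        then show ?thesis by (rule has_vector_derivative_translate) simp
      qed
      show "continuous_on {0..t} (\<lambda>s. z (T + s))"
        by (rule continuous_on_compose2[OF z_continuous]) (use T in \<open>auto intro!: continuous_intros\<close>)
    qed (rule t)
    obtain B where B: "\<And>s. s \<in> {0..T+t} \<Longrightarrow> norm (\<zeta> s) \<le> B"
      using bounded_imageE[OF \<zeta>_bounded[of "T+t"]] by blast
    have "bounded (F ` cball 0 B)"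
      by (intro compact_imp_bounded compact_continuous_image C1_continuous_on[OF C1_F]) auto
    then obtain A where A: "\<And>\<xi>. \<xi> \<in> cball 0 B \<Longrightarrow> norm (F \<xi>) \<le> A" by (rule bounded_imageE) blast
    show "(\<lambda>s. F (\<zeta> (T + s))) absolutely_integrable_on {0..t} \<and>
       z (T + t) = z T + integral {0..t} (\<lambda>s. F (\<zeta> (T + s)))"
    proof
      show "(\<lambda>s. F (\<zeta> (T + s))) absolutely_integrable_on {0..t}"
        by (rule absolutely_integrable_integrable_bound[where g="\<lambda>_. A"])
          (use I A B T in \<open>auto simp: has_integral_integrable\<close>)
      show "z (T + t) = z T + integral {0..t} (\<lambda>s. F (\<zeta> (T + s)))"
        using integral_unique[OF I] by simp
    qed
  qed
qed

text \<open>Within a cell \<open>w\<close> integrates the Lie derivative at the estimate, while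
  \<open>h (x t)\<close> integrates it at the true state. The derivative of \<open>u\<close> is
  therefore exactly the mismatch, and a cell lasts at most \<open>r\<close>.\<close>

lemma u_increment:
  assumes s: "s \<in> {\<tau> i..<\<tau> (Suc i)}"
    and D: "\<And>t. t \<in> {\<tau> i..s} \<Longrightarrow> \<bar>Lie_deriv f h (\<Psi> (z t)) - Lie_deriv f h (x t)\<bar> \<le> D"
  shows "\<bar>u s\<bar> \<le> \<bar>u (\<tau> i)\<bar> + r * D"
proof -
  have D0: "0 \<le> D" using D[of s] s by (auto intro: order_trans[OF abs_ge_zero])
  have "norm (u s - u (\<tau> i)) \<le> D * (s - \<tau> i)"
  proof (rule increment_bound)
    fix t assume t: "t \<in> {\<tau> i..s}"
    have 1: "(\<zeta> has_vector_derivative field (\<zeta> t)) (at t within {\<tau> i..s})"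
      by (rule has_vector_derivative_within_subset[OF \<zeta>_deriv]) (use t s in auto)
    have "(w has_vector_derivative Lie_deriv f h (\<Psi> (z t))) (at t within {\<tau> i..s})"
      using bounded_linear.has_vector_derivative[OF bounded_linear_snd 1] by (simp add: field_def)
    moreover have "((\<lambda>t. h (x t)) has_vector_derivative Lie_deriv f h (x t)) (at t within {\<tau> i..s})"
    proof (rule has_vector_derivative_Lie_deriv[OF C2_h])
      show "(x has_vector_derivative f (x t)) (at t within {\<tau> i..s})"
        by (rule has_vector_derivative_within_subset[OF x_deriv]) (use t \<tau>_nonneg[of i] in auto)
    qed
    ultimately show "(u has_vector_derivative Lie_deriv f h (\<Psi> (z t)) - Lie_deriv f h (x t)) (at t within {\<tau> i..s})"
      unfolding u_def by (rule has_vector_derivative_diff)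
    show "norm (Lie_deriv f h (\<Psi> (z t)) - Lie_deriv f h (x t)) \<le> D" using D[OF t] by simp
  qed (use s in simp)
  also have "\<dots> \<le> D * r" using D0 s \<tau>_Suc_le[of i] by (intro mult_left_mono) auto
  finally show ?thesis by (simp add: mult.commute)
qed

abbreviation "s\<^sub>0 \<equiv> norm x\<^sub>0 + norm \<zeta>\<^sub>0"

lemma s0_nonneg: "0 \<le> s\<^sub>0" by simp

text \<open>Autonomy turns the estimates from time zero into estimates from \<open>T\<close>. The
  size of the restart state is weakened to a bound \<open>\<rho>\<close>, so that the run enters
  only through \<open>\<rho>\<close> and \<open>B\<close>.\<close>

lemma restart_bounds:
  assumes "0 \<le> T" "T \<le> t" and B: "\<And>s. s \<in> {T..t} \<Longrightarrow> \<bar>u s\<bar> \<le> B"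
    and \<rho>: "norm (x T) + norm (z T) \<le> \<rho>"
  shows "norm (\<Psi> (z t) - x t) \<le> \<sigma> \<rho> (t - T) + \<gamma> B"
    and "norm (z t) \<le> \<mu> (t - T) * (a \<rho> + p B)"
    and "\<bar>Lie_deriv f h (\<Psi> (z t)) - Lie_deriv f h (x t)\<bar> \<le> \<sigma>' \<rho> (t - T) + K * B"
proof -
  let ?n = "norm (x T) + norm (z T)"
  have B': "\<bar>u (T + s)\<bar> \<le> B" if "s \<in> {0..t - T}" for s using that by (intro B) auto
  note est = observer_bounds[OF u_Linf_loc[OF assms(1)] observer_restart[OF assms(1)] _ B', of "t - T"]
  have "norm (\<Psi> (z t) - x t) \<le> \<sigma> ?n (t - T) + \<gamma> B" using est(1) assms(2) by simp
  moreover have "\<sigma> ?n (t - T) \<le> \<sigma> \<rho> (t - T)" by (rule class_KL_mono[OF \<sigma>]) (use \<rho> assms in auto)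
  ultimately show "norm (\<Psi> (z t) - x t) \<le> \<sigma> \<rho> (t - T) + \<gamma> B" by linarith
  have "norm (z t) \<le> \<mu> (t - T) * (a ?n + p B)" using est(2) assms(2) by simp
  also have "\<dots> \<le> \<mu> (t - T) * (a \<rho> + p B)"
    by (intro mult_left_mono add_right_mono a_mono \<mu>_nonneg) (use \<rho> assms in auto)
  finally show "norm (z t) \<le> \<mu> (t - T) * (a \<rho> + p B)" .
  have "\<bar>Lie_deriv f h (\<Psi> (z t)) - Lie_deriv f h (x t)\<bar> \<le> \<sigma>' ?n (t - T) + K * B" using est(3) assms(2) by simp
  moreover have "\<sigma>' ?n (t - T) \<le> \<sigma>' \<rho> (t - T)" by (rule class_KL_mono[OF \<sigma>']) (use \<rho> assms in auto)
  ultimately show "\<bar>Lie_deriv f h (\<Psi> (z t)) - Lie_deriv f h (x t)\<bar> \<le> \<sigma>' \<rho> (t - T) + K * B" by linarith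
qed

lemma initial_size: "norm (x 0) + norm (z 0) \<le> s\<^sub>0" "\<bar>w 0\<bar> \<le> norm \<zeta>\<^sub>0"
  using norm_fst_le[of "z 0" "w 0"] norm_snd_le[of "w 0" "z 0"] by (simp_all add: x_init \<zeta>_init)

text \<open>Between samples the error grows by at most \<open>r\<close> times the mismatch of the Lie derivatives,
  which depends on the error itself with gain \<open>K\<close>: as \<open>r * K < 1\<close>, the loop closes.\<close>

lemma u_bound:
  assumes t: "0 \<le> t" and s: "s \<in> {0..t}"
  shows "\<bar>u s\<bar> \<le> b s\<^sub>0 + c * sup_norm v t"
proof -
  \<comment> \<open>\<open>U\<close> is a genuine upper bound because \<open>u\<close> is locally
    bounded; this permits moving the term with \<open>U\<close> to the left-hand side at the
    end.\<close>
  define U where "U = sup_norm u t"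
  have u_L: "u \<in> Linf_loc UNIV" using u_Linf_loc[of 0] by simp
  have U: "\<bar>u s\<bar> \<le> U" if "s \<in> {0..t}" for s
    unfolding U_def by (rule le_sup_norm[OF u_L that])
  have U0: "0 \<le> U" unfolding U_def by (rule sup_norm_nonneg[OF u_L t])
  let ?V = "sup_norm v t"
  have V0: "0 \<le> ?V" by (rule sup_norm_nonneg[OF v t])
  define I where "I = s\<^sub>0 + s\<^sub>0 * m s\<^sub>0"
  have I: "\<bar>u 0\<bar> \<le> I"
  proof -
    have "norm (h (x 0)) \<le> norm x\<^sub>0 * m (norm x\<^sub>0)" using h_growth[of "x 0"] by (simp add: x_init)
    also have "\<dots> \<le> s\<^sub>0 * m s\<^sub>0"
      using mono_onD[OF m_mono, of "norm x\<^sub>0" s\<^sub>0] by (intro mult_mono m_nonneg) auto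
    finally have "\<bar>h (x 0)\<bar> \<le> s\<^sub>0 * m s\<^sub>0" by simp
    moreover have "\<bar>w 0\<bar> \<le> s\<^sub>0" using initial_size(2) norm_ge_zero[of x\<^sub>0] by linarith
    ultimately show ?thesis unfolding u_def I_def by linarith
  qed
  have I0: "0 \<le> I" using I abs_ge_zero[of "u 0"] by linarith
  define D where "D = \<sigma>' s\<^sub>0 0 + K * U"
  have D: "\<bar>Lie_deriv f h (\<Psi> (z q)) - Lie_deriv f h (x q)\<bar> \<le> D" if q: "q \<in> {0..t}" for q
  proof -
    have "\<bar>Lie_deriv f h (\<Psi> (z q)) - Lie_deriv f h (x q)\<bar> \<le> \<sigma>' s\<^sub>0 (q - 0) + K * U"
      by (rule restart_bounds(3)[OF _ _ U initial_size(1)]) (use q in auto)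
    also have "\<sigma>' s\<^sub>0 (q - 0) \<le> \<sigma>' s\<^sub>0 0" by (rule class_KL_antimono[OF \<sigma>']) (use q in auto)
    finally show ?thesis by (simp add: D_def)
  qed
  have "\<bar>u q\<bar> \<le> I + ?V + r * D" if q: "q \<in> {0..t}" for q
  proof -
    obtain i where i: "q \<in> {\<tau> i..<\<tau> (Suc i)}" using \<tau>_covers[of q] q by auto
    have "\<bar>u q\<bar> \<le> \<bar>u (\<tau> i)\<bar> + r * D"
      by (rule u_increment[OF i D]) (use i q \<tau>_nonneg[of i] in auto)
    \<comment> \<open>The error at the start of the cell is the initial error for
      \<open>i = 0\<close> and a measurement error otherwise; the sum of the two bounds covers both
      cases.\<close>
    moreover have "\<bar>u (\<tau> i)\<bar> \<le> I + ?V"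
    proof (cases i)
      case 0
      then show ?thesis using I V0 by simp
    next
      case (Suc j)
      have "\<bar>v (\<tau> i)\<bar> \<le> ?V" by (rule le_sup_norm[OF v]) (use i q \<tau>_nonneg[of i] in auto)
      then show ?thesis using I0 u_sample[of j] Suc by simp
    qed
    ultimately show ?thesis by linarith
  qed
  then have "U \<le> I + ?V + r * D"
    unfolding U_def sup_norm_def[of u] by (intro cSUP_least) (use t in auto)
  then have "U * (1 - r * K) \<le> I + ?V + r * \<sigma>' s\<^sub>0 0" by (simp add: D_def algebra_simps)
  then have "U \<le> (I + ?V + r * \<sigma>' s\<^sub>0 0) / (1 - r * K)" using rK by (simp add: pos_le_divide_eq)
  also have "\<dots> = b s\<^sub>0 + c * ?V" by (simp add: b_def c_def I_def add_divide_distrib)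
  finally show ?thesis using U[OF s] by linarith
qed

lemma u_bound_M:
  assumes t: "0 \<le> t" and V: "sup_norm v t \<le> b s\<^sub>0" and s: "s \<in> {0..t}"
  shows "\<bar>u s\<bar> \<le> M s\<^sub>0"
proof -
  have "c * sup_norm v t \<le> c * b s\<^sub>0" using c(1) V by (intro mult_left_mono) auto
  then show ?thesis using u_bound[OF t s] by (simp add: M_def algebra_simps)
qed

text \<open>\<open>w\<close> is the error plus the output, and the observer bounds \<open>z\<close>.
  The result is arranged as a factor in \<open>t\<close> times the sum of a part in
  \<open>s\<^sub>0\<close> and a part in \<open>sup_norm v t\<close>, the shape that a robust
  observer demands.\<close>

lemma \<zeta>_bound:
  assumes t: "0 \<le> t"
  shows "norm (\<zeta> t) \<le> (1 + \<mu> t + \<mu>\<^sub>x t * (1 + m ((\<mu>\<^sub>x t)\<^sup>2))) *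
     ((a s\<^sub>0 + (p (2 * b s\<^sub>0) + b s\<^sub>0 + a\<^sub>x s\<^sub>0 * (1 + m ((a\<^sub>x s\<^sub>0)\<^sup>2)))) +
      (p (2 * (c * sup_norm v t)) + c * sup_norm v t))"
proof -
  let ?V = "sup_norm v t"
  define B where "B = b s\<^sub>0 + c * ?V"
  have b0: "0 \<le> b s\<^sub>0" and V0: "0 \<le> c * ?V"
    using class_N_nonneg[OF b_class_N] c(1) sup_norm_nonneg[OF v t] by simp_all
  have X: "norm (x t) \<le> \<mu>\<^sub>x t * a\<^sub>x s\<^sub>0"
    by (rule order_trans[OF solution_bound[OF x t]])
      (use \<mu>x_nonneg[OF t] in \<open>auto intro!: mult_left_mono ax_mono\<close>)
  define A1 A2 where "A1 = \<mu>\<^sub>x t * (1 + m ((\<mu>\<^sub>x t)\<^sup>2))" and "A2 = a\<^sub>x s\<^sub>0 * (1 + m ((a\<^sub>x s\<^sub>0)\<^sup>2))"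
  have A: "0 \<le> A1" "0 \<le> A2"
    unfolding A1_def A2_def by (auto intro!: mult_nonneg_nonneg add_nonneg_nonneg m_nonneg \<mu>x_nonneg t ax_nonneg)
  have "norm (h (x t)) \<le> norm (x t) * m (norm (x t))" by (rule h_growth)
  also have "\<dots> \<le> (\<mu>\<^sub>x t * a\<^sub>x s\<^sub>0) * m (\<mu>\<^sub>x t * a\<^sub>x s\<^sub>0)"
    using X mono_onD[OF m_mono, of "norm (x t)" "\<mu>\<^sub>x t * a\<^sub>x s\<^sub>0"] order_trans[OF norm_ge_zero X]
    by (intro mult_mono m_nonneg) auto
  also have "\<dots> \<le> (\<mu>\<^sub>x t * a\<^sub>x s\<^sub>0) * ((1 + m ((\<mu>\<^sub>x t)\<^sup>2)) * (1 + m ((a\<^sub>x s\<^sub>0)\<^sup>2)))"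
    by (intro mult_left_mono m_product \<mu>x_nonneg t ax_nonneg mult_nonneg_nonneg) auto
  also have "\<dots> = A1 * A2" by (simp add: A1_def A2_def algebra_simps)
  finally have hx: "\<bar>h (x t)\<bar> \<le> A1 * A2" by simp
  have "norm (z t) \<le> \<mu> (t - 0) * (a s\<^sub>0 + p B)"
    by (rule restart_bounds(2)[OF _ _ _ initial_size(1)])
      (use t u_bound[OF t] in \<open>auto simp: B_def\<close>)
  also have "\<dots> \<le> \<mu> t * (a s\<^sub>0 + (p (2 * b s\<^sub>0) + p (2 * (c * ?V))))"
    using class_N_add_arg[OF p b0 V0] by (intro mult_mono) (simp_all add: B_def \<mu>_nonneg[OF t] a_nonneg class_N_nonneg[OF p] b0 V0)
  finally have zt: "norm (z t) \<le> \<mu> t * (a s\<^sub>0 + (p (2 * b s\<^sub>0) + p (2 * (c * ?V))))" .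
  have wt: "\<bar>w t\<bar> \<le> B + A1 * A2"
    using u_bound[OF t, of t] hx t unfolding u_def B_def by simp
  define N1 where "N1 = a s\<^sub>0 + p (2 * b s\<^sub>0) + p (2 * (c * ?V))"
  have N1: "0 \<le> N1"
    unfolding N1_def using b0 V0 by (auto intro!: add_nonneg_nonneg a_nonneg class_N_nonneg[OF p])
  have "norm (\<zeta> t) \<le> norm (z t) + norm (w t)" using norm_Pair_le[of "z t" "w t"] by simp
  also have "\<dots> \<le> \<mu> t * N1 + (B + A1 * A2)" using zt wt by (simp add: N1_def add.assoc)
  \<comment> \<open>A sum of products is bounded by the product of the sums, as the additional cross
    terms are nonnegative.\<close>
  also have "\<dots> \<le> (1 + \<mu> t + A1) * (N1 + B + A2)"
  proof -
    have "0 \<le> \<mu> t * B" "0 \<le> \<mu> t * A2" "0 \<le> A1 * N1" "0 \<le> A1 * B"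
      using \<mu>_nonneg[OF t] A N1 b0 V0 by (simp_all add: B_def)
    then show ?thesis using N1 A by (simp add: algebra_simps)
  qed
  finally show ?thesis by (simp add: N1_def A1_def A2_def B_def algebra_simps)
qed

text \<open>The size of the state from which a restart at \<open>T\<close> begins is controlled by
  \<open>R\<close>, \<open>T\<close> and a bound for \<open>u\<close> up to \<open>T\<close>; this
  makes the later waiting times uniform over runs.\<close>

lemma restart_size:
  assumes R: "s\<^sub>0 \<le> R" and T: "0 \<le> T" and B: "\<And>s. s \<in> {0..T} \<Longrightarrow> \<bar>u s\<bar> \<le> B"
  shows "norm (x T) + norm (z T) \<le> \<mu>\<^sub>x T * a\<^sub>x R + \<mu> T * (a R + p B)"
proof -
  have "norm (x T) \<le> \<mu>\<^sub>x T * a\<^sub>x R"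
  proof (rule order_trans[OF solution_bound[OF x T]])
    have "norm x\<^sub>0 \<le> R" using R norm_ge_zero[of \<zeta>\<^sub>0] by linarith
    then show "\<mu>\<^sub>x T * a\<^sub>x (norm x\<^sub>0) \<le> \<mu>\<^sub>x T * a\<^sub>x R"
      by (intro mult_left_mono ax_mono \<mu>x_nonneg T) auto
  qed
  moreover have "norm (z T) \<le> \<mu> (T - 0) * (a R + p B)"
    by (rule restart_bounds(2)) (use T B R initial_size(1) in auto)
  ultimately show ?thesis by simp
qed

text \<open>The cell of a time from \<open>T + L + r\<close> on has length at most \<open>r\<close>,
  so it begins after \<open>T + L\<close>, when the transient of the restart has fallen to
  \<open>\<epsilon>\<close>. It is also not the initial cell, so the error at its start is a
  measurement error.\<close>

lemma restart_step:
  assumes T: "0 \<le> T" and L: "0 \<le> L" and B: "\<And>s. s \<in> {T..t} \<Longrightarrow> \<bar>u s\<bar> \<le> B"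
    and \<rho>: "norm (x T) + norm (z T) \<le> \<rho>" and L\<epsilon>: "\<sigma>' \<rho> L \<le> \<epsilon>"
    and s: "s \<in> {T + L + r..t}"
  shows "\<bar>u s\<bar> \<le> sup_norm v t + r * (\<epsilon> + K * B)"
proof -
  have "s \<ge> 0" using s T L r by auto
  then obtain i where i: "s \<in> {\<tau> i..<\<tau> (Suc i)}" using \<tau>_covers by blast
  have \<tau>i: "T + L \<le> \<tau> i" using i s \<tau>_Suc_le[of i] by auto
  have "i \<noteq> 0"
  proof
    assume "i = 0"
    then have "s < r" using i \<tau>_Suc_le[of 0] by simp
    then show False using s T L by auto
  qed
  then obtain j where j: "i = Suc j" by (cases i) auto
  have "\<bar>u s\<bar> \<le> \<bar>u (\<tau> i)\<bar> + r * (\<epsilon> + K * B)"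
  proof (rule u_increment[OF i])
    fix q assume q: "q \<in> {\<tau> i..s}"
    have "\<bar>Lie_deriv f h (\<Psi> (z q)) - Lie_deriv f h (x q)\<bar> \<le> \<sigma>' \<rho> (q - T) + K * B"
      by (rule restart_bounds(3)[OF T _ B \<rho>]) (use q s \<tau>i L in auto)
    also have "\<sigma>' \<rho> (q - T) \<le> \<sigma>' \<rho> L"
      by (rule class_KL_antimono[OF \<sigma>']) (use q \<tau>i L order_trans[OF _ \<rho>, of 0] in auto)
    finally show "\<bar>Lie_deriv f h (\<Psi> (z q)) - Lie_deriv f h (x q)\<bar> \<le> \<epsilon> + K * B"
      using L\<epsilon> by linarith
  qed
  moreover have "\<bar>u (\<tau> i)\<bar> \<le> sup_norm v t"
    unfolding j u_sample by (rule le_sup_norm[OF v]) (use i s j \<tau>_nonneg[of i] in auto)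
  ultimately show ?thesis by linarith
qed

end

section \<open>Uniform decay\<close>

context sampled_observer
begin

abbreviation "is_run \<equiv> hybrid_run f h F \<Psi> K r \<sigma>' \<sigma> \<gamma> p \<mu> a \<mu>\<^sub>x a\<^sub>x m"

text \<open>Each restart contracts the part of the error that is not due to the measurement error by
  the factor \<open>r * K\<close>, at the price of waiting until the transient has decayed. The waiting
  time depends only on the bound \<open>R\<close> of the initial states.\<close>

lemma u_decay:
  assumes R: "0 \<le> R" and \<epsilon>: "0 < \<epsilon>"
  shows "\<exists>T\<ge>0. \<forall>d v x\<^sub>0 \<zeta>\<^sub>0 x \<zeta> t s. is_run d v x\<^sub>0 \<zeta>\<^sub>0 x \<zeta> \<longrightarrow> norm x\<^sub>0 + norm \<zeta>\<^sub>0 \<le> R \<longrightarrow>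
    sup_norm v t \<le> b (norm x\<^sub>0 + norm \<zeta>\<^sub>0) \<longrightarrow> s \<in> {T..t} \<longrightarrow>
    \<bar>snd (\<zeta> s) - h (x s)\<bar> \<le> c * (sup_norm v t + r * \<epsilon>) + (r * K) ^ j * M R"
proof (induction j)
  case 0
  show ?case
  proof (intro exI[of _ 0] conjI allI impI)
    fix d v x\<^sub>0 \<zeta>\<^sub>0 x \<zeta> t s
    assume "is_run d v x\<^sub>0 \<zeta>\<^sub>0 x \<zeta>" and s0: "norm x\<^sub>0 + norm \<zeta>\<^sub>0 \<le> R"
      and V: "sup_norm v t \<le> b (norm x\<^sub>0 + norm \<zeta>\<^sub>0)" and s: "s \<in> {0..t}"
    interpret hybrid_run f h F \<Psi> K r \<sigma>' \<sigma> \<gamma> p \<mu> a \<mu>\<^sub>x a\<^sub>x m d v x\<^sub>0 \<zeta>\<^sub>0 x \<zeta> by fact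
    have t: "0 \<le> t" using s by simp
    have "\<bar>u s\<bar> \<le> M (norm x\<^sub>0 + norm \<zeta>\<^sub>0)" by (rule u_bound_M[OF t V s])
    also have "\<dots> \<le> M R" by (rule class_N_mono[OF M_class_N]) (use s0 in auto)
    finally have "\<bar>u s\<bar> \<le> M R" .
    moreover have "0 \<le> c * (sup_norm v t + r * \<epsilon>)"
      using c(1) sup_norm_nonneg[OF v t] r \<epsilon> by (intro mult_nonneg_nonneg add_nonneg_nonneg) auto
    ultimately show "\<bar>snd (\<zeta> s) - h (x s)\<bar> \<le> c * (sup_norm v t + r * \<epsilon>) + (r * K) ^ 0 * M R"
      by (simp add: u_def)
  qed simp
next
  case (Suc j)
  then obtain T where T: "0 \<le> T" and IH: "\<forall>d v x\<^sub>0 \<zeta>\<^sub>0 x \<zeta> t s. is_run d v x\<^sub>0 \<zeta>\<^sub>0 x \<zeta> \<longrightarrow> norm x\<^sub>0 + norm \<zeta>\<^sub>0 \<le> R \<longrightarrow>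
    sup_norm v t \<le> b (norm x\<^sub>0 + norm \<zeta>\<^sub>0) \<longrightarrow> s \<in> {T..t} \<longrightarrow>
    \<bar>snd (\<zeta> s) - h (x s)\<bar> \<le> c * (sup_norm v t + r * \<epsilon>) + (r * K) ^ j * M R"
    by (elim exE conjE)
  \<comment> \<open>Up to \<open>T\<close> the error is bounded by \<open>M R\<close>, whatever the
    run and \<open>v\<close>; hence \<open>\<rho>\<close> bounds all restart states, and
    \<open>L\<close> can be chosen before the run.\<close>
  define \<rho> where "\<rho> = \<mu>\<^sub>x T * a\<^sub>x R + \<mu> T * (a R + p (M R))"
  have \<rho>: "0 \<le> \<rho>"
    unfolding \<rho>_def using T R
    by (auto intro!: add_nonneg_nonneg mult_nonneg_nonneg \<mu>_nonneg \<mu>x_nonneg a_nonneg ax_nonneg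
        class_N_nonneg[OF p] class_N_nonneg[OF M_class_N])
  obtain L where L: "0 \<le> L" "\<sigma>' \<rho> L \<le> \<epsilon>" using class_KL_small[OF \<sigma>' \<rho> \<epsilon>] .
  show ?case
  proof (intro exI[of _ "T + L + r"] conjI allI impI)
    show "0 \<le> T + L + r" using T L r by simp
    fix d v x\<^sub>0 \<zeta>\<^sub>0 x \<zeta> t s
    assume hyb: "is_run d v x\<^sub>0 \<zeta>\<^sub>0 x \<zeta>" and s0: "norm x\<^sub>0 + norm \<zeta>\<^sub>0 \<le> R"
      and V: "sup_norm v t \<le> b (norm x\<^sub>0 + norm \<zeta>\<^sub>0)" and s: "s \<in> {T + L + r..t}"
    interpret hybrid_run f h F \<Psi> K r \<sigma>' \<sigma> \<gamma> p \<mu> a \<mu>\<^sub>x a\<^sub>x m d v x\<^sub>0 \<zeta>\<^sub>0 x \<zeta> by (rule hyb)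
    have t: "0 \<le> t" "T \<le> t" using s T L r by auto
    define B where "B = c * (sup_norm v t + r * \<epsilon>) + (r * K) ^ j * M R"
    have B: "\<bar>u q\<bar> \<le> B" if "q \<in> {T..t}" for q
      unfolding B_def u_def using IH[rule_format, OF hyb s0 V that] .
    have "\<bar>u q\<bar> \<le> M R" if "q \<in> {0..T}" for q
    proof -
      have "\<bar>u q\<bar> \<le> M (norm x\<^sub>0 + norm \<zeta>\<^sub>0)" by (rule u_bound_M[OF t(1) V]) (use that t in auto)
      also have "\<dots> \<le> M R" by (rule class_N_mono[OF M_class_N]) (use s0 in auto)
      finally show ?thesis .
    qed
    then have size: "norm (x T) + norm (z T) \<le> \<rho>"
      unfolding \<rho>_def by (intro restart_size[OF s0 T])
    have "\<bar>u s\<bar> \<le> sup_norm v t + r * (\<epsilon> + K * B)"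
      by (rule restart_step[OF T L(1) B size L(2) s])
    \<comment> \<open>The coefficient of the measurement error does not build up over the
      iterations, because \<open>1 + r * K * c = c\<close>.\<close>
    also have "\<dots> = (1 + r * K * c) * (sup_norm v t + r * \<epsilon>) + (r * K) ^ Suc j * M R"
      by (simp add: B_def algebra_simps)
    finally show "\<bar>snd (\<zeta> s) - h (x s)\<bar> \<le> c * (sup_norm v t + r * \<epsilon>) + (r * K) ^ Suc j * M R"
      unfolding c(2) u_def .
  qed
qed

text \<open>When \<open>sup_norm v t\<close> exceeds \<open>b\<close> of the initial size, the error
  \<open>u\<close> is bounded by a multiple of \<open>sup_norm v t\<close> alone, and the estimate
  from time zero leaves only \<open>\<sigma>\<close>. Otherwise the a priori bound \<open>M\<close>
  applies. The subtracted gain is the same in both regimes.\<close>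

lemma error_bound:
  assumes "is_run d v x\<^sub>0 \<zeta>\<^sub>0 x \<zeta>" and t: "0 \<le> t"
  shows "norm (\<Psi> (fst (\<zeta> t)) - x t) - \<gamma> (2 * (c * sup_norm v t))
    \<le> \<sigma> (norm x\<^sub>0 + norm \<zeta>\<^sub>0) 0 + \<gamma> (M (norm x\<^sub>0 + norm \<zeta>\<^sub>0))"
    and "b (norm x\<^sub>0 + norm \<zeta>\<^sub>0) < sup_norm v t \<Longrightarrow>
      norm (\<Psi> (fst (\<zeta> t)) - x t) - \<gamma> (2 * (c * sup_norm v t)) \<le> \<sigma> (norm x\<^sub>0 + norm \<zeta>\<^sub>0) t"
proof -
  interpret hybrid_run f h F \<Psi> K r \<sigma>' \<sigma> \<gamma> p \<mu> a \<mu>\<^sub>x a\<^sub>x m d v x\<^sub>0 \<zeta>\<^sub>0 x \<zeta> by fact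
  let ?V = "sup_norm v t"
  have V0: "0 \<le> ?V" by (rule sup_norm_nonneg[OF v t])
  have g0: "0 \<le> \<gamma> (2 * (c * ?V))" and g0': "0 \<le> \<gamma> (M s\<^sub>0)"
    using c(1) V0 by (simp_all add: class_N_nonneg[OF \<gamma>] class_N_nonneg[OF M_class_N])
  have \<sigma>t: "\<sigma> s\<^sub>0 t \<le> \<sigma> s\<^sub>0 0" by (rule class_KL_antimono[OF \<sigma>]) (use t in auto)
  have large: "norm (\<Psi> (z t) - x t) - \<gamma> (2 * (c * ?V)) \<le> \<sigma> s\<^sub>0 t" if V: "b s\<^sub>0 < ?V"
  proof -
    \<comment> \<open>As \<open>c \<ge> 1\<close>, the regime \<open>b s\<^sub>0 < ?V\<close> gives
      \<open>b s\<^sub>0 \<le> c * ?V\<close>, whence the factor two in the gain.\<close>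
    have "?V \<le> c * ?V" using mult_right_mono[OF c(1) V0] by simp
    then have "\<bar>u s\<bar> \<le> 2 * (c * ?V)" if "s \<in> {0..t}" for s
      using u_bound[OF t that] V by linarith
    then have "norm (\<Psi> (z t) - x t) \<le> \<sigma> s\<^sub>0 (t - 0) + \<gamma> (2 * (c * ?V))"
      by (intro restart_bounds(1)[OF _ t _ initial_size(1)]) auto
    then show ?thesis by simp
  qed
  then show "norm (\<Psi> (z t) - x t) - \<gamma> (2 * (c * ?V)) \<le> \<sigma> s\<^sub>0 t" if "b s\<^sub>0 < ?V" using that .
  show "norm (\<Psi> (z t) - x t) - \<gamma> (2 * (c * ?V)) \<le> \<sigma> s\<^sub>0 0 + \<gamma> (M s\<^sub>0)"
  proof (cases "b s\<^sub>0 < ?V")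
    case True
    then show ?thesis using large \<sigma>t g0' by linarith
  next
    case False
    then have "norm (\<Psi> (z t) - x t) \<le> \<sigma> s\<^sub>0 (t - 0) + \<gamma> (M s\<^sub>0)"
      by (intro restart_bounds(1)[OF _ t _ initial_size(1)] u_bound_M[OF t]) auto
    then show ?thesis using \<sigma>t g0 by simp
  qed
qed

text \<open>By \<open>u_decay\<close> the error \<open>u\<close> is eventually at most
  \<open>c * sup_norm v t\<close> plus a small \<open>\<delta>\<close>; one more restart after that
  time lets \<open>\<sigma>\<close> decay as well. Large measurement errors are handled by the
  second part of \<open>error_bound\<close>.\<close>

lemma error_decay:
  assumes R: "0 \<le> R" and \<epsilon>: "0 < \<epsilon>"
  shows "\<exists>T. \<forall>d v x\<^sub>0 \<zeta>\<^sub>0 x \<zeta> t. is_run d v x\<^sub>0 \<zeta>\<^sub>0 x \<zeta> \<longrightarrow> norm x\<^sub>0 + norm \<zeta>\<^sub>0 \<le> R \<longrightarrow> 0 \<le> t \<longrightarrow> T \<le> t \<longrightarrow>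
    norm (\<Psi> (fst (\<zeta> t)) - x t) - \<gamma> (2 * (c * sup_norm v t)) \<le> \<epsilon>"
proof -
  \<comment> \<open>The tolerance is split in half between \<open>\<sigma>\<close> and
    \<open>\<gamma>\<close> at \<open>2 * \<delta>\<close>, the doubling being that of
    \<open>class_N_add_arg\<close>. In turn \<open>\<delta>\<close> is shared equally by the
    residual transient \<open>c * r * \<epsilon>\<^sub>1\<close> and the remainder
    \<open>(r * K) ^ j * M R\<close>.\<close>
  obtain \<delta>' where \<delta>': "0 < \<delta>'" "\<gamma> \<delta>' \<le> \<epsilon> / 2" using class_N_small[OF \<gamma>, of "\<epsilon> / 2"] \<epsilon> by auto
  define \<delta> where "\<delta> = \<delta>' / 2"
  have \<delta>: "0 < \<delta>" "\<gamma> (2 * \<delta>) \<le> \<epsilon> / 2" using \<delta>' by (simp_all add: \<delta>_def)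
  define \<epsilon>\<^sub>1 where "\<epsilon>\<^sub>1 = \<delta> / (2 * c * r)"
  have \<epsilon>1: "0 < \<epsilon>\<^sub>1" "c * r * \<epsilon>\<^sub>1 = \<delta> / 2" using \<delta> c(1) r by (simp_all add: \<epsilon>\<^sub>1_def)
  have "(\<lambda>j. (r * K) ^ j * M R) \<longlonglongrightarrow> 0 * M R"
    using r K rK by (intro tendsto_mult LIMSEQ_power_zero tendsto_const) simp
  then have "\<forall>\<^sub>F j in sequentially. (r * K) ^ j * M R < \<delta> / 2"
    by (rule order_tendstoD(2)) (use \<delta> in simp)
  then obtain j where j: "(r * K) ^ j * M R < \<delta> / 2" by (auto simp: eventually_sequentially)
  obtain T where T: "0 \<le> T" and dec: "\<forall>d v x\<^sub>0 \<zeta>\<^sub>0 x \<zeta> t s. is_run d v x\<^sub>0 \<zeta>\<^sub>0 x \<zeta> \<longrightarrow> norm x\<^sub>0 + norm \<zeta>\<^sub>0 \<le> R \<longrightarrow>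
    sup_norm v t \<le> b (norm x\<^sub>0 + norm \<zeta>\<^sub>0) \<longrightarrow> s \<in> {T..t} \<longrightarrow>
    \<bar>snd (\<zeta> s) - h (x s)\<bar> \<le> c * (sup_norm v t + r * \<epsilon>\<^sub>1) + (r * K) ^ j * M R"
    using u_decay[OF R \<epsilon>1(1), of j] by (elim exE conjE)
  define \<rho> where "\<rho> = \<mu>\<^sub>x T * a\<^sub>x R + \<mu> T * (a R + p (M R))"
  have \<rho>: "0 \<le> \<rho>"
    unfolding \<rho>_def using T R
    by (auto intro!: add_nonneg_nonneg mult_nonneg_nonneg \<mu>_nonneg \<mu>x_nonneg a_nonneg ax_nonneg
        class_N_nonneg[OF p] class_N_nonneg[OF M_class_N])
  obtain L where L: "0 \<le> L" "\<sigma> \<rho> L \<le> \<epsilon> / 2" using class_KL_small[OF \<sigma> \<rho>, of "\<epsilon> / 2"] \<epsilon> by auto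
  \<comment> \<open>\<open>L'\<close> serves the runs with large measurement error, where
    \<open>\<sigma>\<close> decays from time zero and no restart takes place.\<close>
  obtain L' where L': "0 \<le> L'" "\<sigma> R L' \<le> \<epsilon>" using class_KL_small[OF \<sigma> R \<epsilon>] .
  show ?thesis
  proof (intro exI[of _ "max (T + L) L'"] allI impI)
    fix d v x\<^sub>0 \<zeta>\<^sub>0 x \<zeta> t
    assume hyb: "is_run d v x\<^sub>0 \<zeta>\<^sub>0 x \<zeta>" and s0: "norm x\<^sub>0 + norm \<zeta>\<^sub>0 \<le> R" and t: "0 \<le> t"
      and t_large: "max (T + L) L' \<le> t"
    interpret hybrid_run f h F \<Psi> K r \<sigma>' \<sigma> \<gamma> p \<mu> a \<mu>\<^sub>x a\<^sub>x m d v x\<^sub>0 \<zeta>\<^sub>0 x \<zeta> by (rule hyb)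
    let ?V = "sup_norm v t"
    show "norm (\<Psi> (z t) - x t) - \<gamma> (2 * (c * ?V)) \<le> \<epsilon>"
    proof (cases "b s\<^sub>0 < ?V")
      case True
      have "norm (\<Psi> (z t) - x t) - \<gamma> (2 * (c * ?V)) \<le> \<sigma> s\<^sub>0 t" by (rule error_bound(2)[OF hyb t True])
      also have "\<dots> \<le> \<sigma> R t" by (rule class_KL_mono[OF \<sigma>]) (use s0 t in auto)
      also have "\<dots> \<le> \<sigma> R L'" by (rule class_KL_antimono[OF \<sigma> R]) (use L' t_large in auto)
      finally show ?thesis using L' by linarith
    next
      case False
      then have V: "?V \<le> b s\<^sub>0" by simp
      have Tt: "T \<le> t" "L \<le> t - T" using t_large L by auto
      have "\<bar>u q\<bar> \<le> M R" if "q \<in> {0..T}" for q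
      proof -
        have "\<bar>u q\<bar> \<le> M (norm x\<^sub>0 + norm \<zeta>\<^sub>0)" by (rule u_bound_M[OF t V]) (use that Tt in auto)
        also have "\<dots> \<le> M R" by (rule class_N_mono[OF M_class_N]) (use s0 in auto)
        finally show ?thesis .
      qed
      then have size: "norm (x T) + norm (z T) \<le> \<rho>"
        unfolding \<rho>_def by (intro restart_size[OF s0 T])
      have B: "\<bar>u q\<bar> \<le> c * ?V + \<delta>" if "q \<in> {T..t}" for q
      proof -
        have "\<bar>u q\<bar> \<le> c * (?V + r * \<epsilon>\<^sub>1) + (r * K) ^ j * M R"
          unfolding u_def using dec[rule_format, OF hyb s0 V that] .
        also have "c * (?V + r * \<epsilon>\<^sub>1) = c * ?V + c * r * \<epsilon>\<^sub>1" by (simp add: algebra_simps)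
        finally show ?thesis using j \<epsilon>1(2) by linarith
      qed
      have "norm (\<Psi> (z t) - x t) \<le> \<sigma> \<rho> (t - T) + \<gamma> (c * ?V + \<delta>)"
        by (rule restart_bounds(1)[OF T Tt(1) B size])
      moreover have "\<sigma> \<rho> (t - T) \<le> \<sigma> \<rho> L" by (rule class_KL_antimono[OF \<sigma> \<rho> L(1) Tt(2)])
      moreover have "\<gamma> (c * ?V + \<delta>) \<le> \<gamma> (2 * (c * ?V)) + \<gamma> (2 * \<delta>)"
        using c(1) sup_norm_nonneg[OF v t] \<delta> by (intro class_N_add_arg[OF \<gamma>]) auto
      ultimately show ?thesis using L(2) \<delta>(2) by linarith
    qed
  qed
qed

lemma robust_estimates:
  "\<exists>\<sigma>\<in>class_KL. \<exists>\<gamma>\<in>class_N. \<exists>p\<in>class_N. \<exists>\<mu>\<in>Kplus. \<exists>a\<in>class_K_inf.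
     \<forall>x\<^sub>0 \<zeta>\<^sub>0. \<forall>d\<in>Linf_loc {0..}. \<forall>v\<in>Linf_loc UNIV.
       the_solution_satisfies (hybrid_solution f h r observer_field observer_reset d v x\<^sub>0 \<zeta>\<^sub>0) (\<lambda>(x, \<zeta>). \<forall>t\<ge>0.
         norm (\<Psi> (fst (\<zeta> t)) - x t) \<le> \<sigma> (norm x\<^sub>0 + norm \<zeta>\<^sub>0) t + (SUP s\<in>{0..t}. \<gamma> \<bar>v s\<bar>) \<and>
         norm (\<zeta> t) \<le> \<mu> t * (a (norm x\<^sub>0 + norm \<zeta>\<^sub>0) + (SUP s\<in>{0..t}. p \<bar>v s\<bar>)))"
proof -
  \<comment> \<open>A relation rather than a function, since many runs share the same
    \<open>s\<close> and \<open>t\<close>. Subtracting the gain of \<open>sup_norm v t\<close> from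
    the error makes bounds that are uniform in \<open>v\<close> possible.\<close>
  define P where "P s t e \<longleftrightarrow> (\<exists>d v x\<^sub>0 \<zeta>\<^sub>0 x \<zeta>. is_run d v x\<^sub>0 \<zeta>\<^sub>0 x \<zeta> \<and> s = norm x\<^sub>0 + norm \<zeta>\<^sub>0 \<and>
    e = norm (\<Psi> (fst (\<zeta> t)) - x t) - \<gamma> (2 * (c * sup_norm v t)))" for s t e
  define B where "B s = \<sigma> s 0 + \<gamma> (M s)" for s
  have "B \<in> class_N"
    unfolding B_def
    by (rule class_N_add[OF class_K_imp_class_N[OF class_KL_class_K[OF \<sigma> order_refl]] class_N_compose[OF \<gamma> M_class_N]])
  moreover have "e \<le> B s" if "0 \<le> t" "P s t e" for s t e
    using that(2) error_bound(1)[OF _ that(1)] unfolding P_def B_def by blast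
  moreover have "\<exists>T. \<forall>s t e. 0 \<le> s \<longrightarrow> s \<le> R \<longrightarrow> 0 \<le> t \<longrightarrow> T \<le> t \<longrightarrow> P s t e \<longrightarrow> e \<le> \<epsilon>" if R: "0 \<le> R" and \<epsilon>: "0 < \<epsilon>" for R \<epsilon>
  proof -
    obtain T where T: "\<forall>d v x\<^sub>0 \<zeta>\<^sub>0 x \<zeta> t. is_run d v x\<^sub>0 \<zeta>\<^sub>0 x \<zeta> \<longrightarrow> norm x\<^sub>0 + norm \<zeta>\<^sub>0 \<le> R \<longrightarrow> 0 \<le> t \<longrightarrow> T \<le> t \<longrightarrow>
      norm (\<Psi> (fst (\<zeta> t)) - x t) - \<gamma> (2 * (c * sup_norm v t)) \<le> \<epsilon>"
      using error_decay[OF R \<epsilon>] ..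
    show ?thesis
    proof (intro exI[of _ T] allI impI)
      fix s t e assume s: "s \<le> R" and t: "0 \<le> t" "T \<le> t" and P: "P s t e"
      from P[unfolded P_def] obtain d v x\<^sub>0 \<zeta>\<^sub>0 x \<zeta> where hyb: "is_run d v x\<^sub>0 \<zeta>\<^sub>0 x \<zeta>"
        and eq: "s = norm x\<^sub>0 + norm \<zeta>\<^sub>0" "e = norm (\<Psi> (fst (\<zeta> t)) - x t) - \<gamma> (2 * (c * sup_norm v t))"
        by (elim exE conjE)
      show "e \<le> \<epsilon>" unfolding eq(2) by (rule T[rule_format, OF hyb s[unfolded eq(1)] t])
    qed
  qed
  ultimately have "\<exists>\<beta>\<in>class_KL. \<forall>s t e. 0 \<le> s \<longrightarrow> 0 \<le> t \<longrightarrow> P s t e \<longrightarrow> e \<le> \<beta> s t"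
    by (intro class_KL_majorant)
  then obtain \<beta> where \<beta>: "\<beta> \<in> class_KL" "\<forall>s t e. 0 \<le> s \<longrightarrow> 0 \<le> t \<longrightarrow> P s t e \<longrightarrow> e \<le> \<beta> s t" ..
  have scale: "(\<lambda>s. k * s) \<in> class_N" if "0 \<le> k" for k :: real
    by (rule class_N_scale[OF class_N_id that])
  have c0: "0 \<le> c" "0 \<le> 2 * c" using c(1) by simp_all
  define g where "g V = \<gamma> (2 * (c * V))" for V
  define q where "q V = p (2 * (c * V)) + c * V" for V
  have g: "g \<in> class_N" unfolding g_def using class_N_compose[OF \<gamma> scale[OF c0(2)]] by (simp add: mult.assoc)
  have q: "q \<in> class_N" unfolding q_def
    using class_N_add[OF class_N_compose[OF p scale[OF c0(2)]] scale[OF c0(1)]] by (simp add: mult.assoc)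
  define \<mu>' where "\<mu>' t = 1 + \<mu> t + \<mu>\<^sub>x t * (1 + m ((\<mu>\<^sub>x t)\<^sup>2))" for t
  define a' where "a' s = a s + (p (2 * b s) + b s + a\<^sub>x s * (1 + m ((a\<^sub>x s)\<^sup>2)))" for s
  have \<mu>': "\<mu>' \<in> Kplus"
    unfolding Kplus_def
  proof (intro CollectI conjI allI impI)
    have "continuous_on {0..} \<mu>" "continuous_on {0..} \<mu>\<^sub>x" using \<mu> \<mu>x by (simp_all add: Kplus_def)
    then show "continuous_on {0..} \<mu>'"
      unfolding \<mu>'_def
      by (intro continuous_intros continuous_on_compose2[OF m_continuous]) auto
    show "0 < \<mu>' t" if "0 \<le> t" for t
      unfolding \<mu>'_def using \<mu>_nonneg[OF that] \<mu>x_nonneg[OF that] m_nonneg[of "(\<mu>\<^sub>x t)\<^sup>2"]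
      by (intro add_pos_nonneg mult_nonneg_nonneg) auto
  qed
  have axN: "a\<^sub>x \<in> class_N" by (rule class_K_imp_class_N[OF class_K_inf_K[OF ax]])
  have "(\<lambda>s. a\<^sub>x s * (1 + m ((a\<^sub>x s)\<^sup>2))) \<in> class_N"
  proof (rule class_N_mult[OF axN])
    show "continuous_on {0..} (\<lambda>s. 1 + m ((a\<^sub>x s)\<^sup>2))"
      by (intro continuous_intros continuous_on_compose2[OF m_continuous] class_N_continuous[OF axN]) auto
    show "mono_on {0..} (\<lambda>s. 1 + m ((a\<^sub>x s)\<^sup>2))"
    proof (rule mono_onI)
      fix s t :: real assume st: "s \<in> {0..}" "t \<in> {0..}" "s \<le> t"
      have "(a\<^sub>x s)\<^sup>2 \<le> (a\<^sub>x t)\<^sup>2" using st by (intro power_mono ax_mono ax_nonneg) auto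
      then show "1 + m ((a\<^sub>x s)\<^sup>2) \<le> 1 + m ((a\<^sub>x t)\<^sup>2)" using mono_onD[OF m_mono] by simp
    qed
  qed (simp add: m_nonneg)
  moreover have "(\<lambda>s. p (2 * b s)) \<in> class_N"
    by (rule class_N_compose[OF p class_N_scale[OF b_class_N]]) simp
  ultimately have a': "a' \<in> class_K_inf"
    unfolding a'_def by (intro class_K_inf_add_class_N[OF a] class_N_add[OF class_N_add[OF _ b_class_N]])
  have main: "norm (\<Psi> (fst (\<zeta> t)) - x t) \<le> \<beta> (norm x\<^sub>0 + norm \<zeta>\<^sub>0) t + (SUP s\<in>{0..t}. g (2 * \<bar>v s\<bar>)) \<and>
      norm (\<zeta> t) \<le> \<mu>' t * (a' (norm x\<^sub>0 + norm \<zeta>\<^sub>0) + (SUP s\<in>{0..t}. q (2 * \<bar>v s\<bar>)))"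
    if hyb: "is_run d v x\<^sub>0 \<zeta>\<^sub>0 x \<zeta>" and t: "0 \<le> t" for d v x\<^sub>0 \<zeta>\<^sub>0 x \<zeta> t
  proof
    interpret hybrid_run f h F \<Psi> K r \<sigma>' \<sigma> \<gamma> p \<mu> a \<mu>\<^sub>x a\<^sub>x m d v x\<^sub>0 \<zeta>\<^sub>0 x \<zeta> by (rule hyb)
    have "P s\<^sub>0 t (norm (\<Psi> (z t) - x t) - \<gamma> (2 * (c * sup_norm v t)))"
      unfolding P_def by (intro exI conjI) (rule hyb, rule refl, rule refl)
    then have "norm (\<Psi> (z t) - x t) - \<gamma> (2 * (c * sup_norm v t)) \<le> \<beta> s\<^sub>0 t"
      by (rule \<beta>(2)[rule_format, OF s0_nonneg t])
    then show "norm (\<Psi> (z t) - x t) \<le> \<beta> s\<^sub>0 t + (SUP s\<in>{0..t}. g (2 * \<bar>v s\<bar>))"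
      using class_N_sup_norm_le[OF g v t] unfolding g_def by linarith
    have "norm (\<zeta> t) \<le> \<mu>' t * (a' s\<^sub>0 + q (sup_norm v t))"
      using \<zeta>_bound[OF t] unfolding \<mu>'_def a'_def q_def .
    also have "\<dots> \<le> \<mu>' t * (a' s\<^sub>0 + (SUP s\<in>{0..t}. q (2 * \<bar>v s\<bar>)))"
      using \<mu>' t class_N_sup_norm_le[OF q v t]
      by (intro mult_left_mono add_left_mono) (auto simp: Kplus_def intro: less_imp_le)
    finally show "norm (\<zeta> t) \<le> \<mu>' t * (a' s\<^sub>0 + (SUP s\<in>{0..t}. q (2 * \<bar>v s\<bar>)))" .
  qed
  show ?thesis
  \<comment> \<open>The gains enter with doubled argument, the price for passing from the gain of
    the supremum to the supremum of the gains.\<close>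
  proof (rule bexI[OF _ \<beta>(1)], rule bexI[OF _ class_N_compose[OF g scale[of 2]]],
      rule bexI[OF _ class_N_compose[OF q scale[of 2]]], rule bexI[OF _ \<mu>'], rule bexI[OF _ a'],
      intro allI ballI)
    fix x\<^sub>0 \<zeta>\<^sub>0 and d v :: "real \<Rightarrow> real"
    assume d: "d \<in> Linf_loc {0..}" and v: "v \<in> Linf_loc UNIV"
    show "the_solution_satisfies (hybrid_solution f h r observer_field observer_reset d v x\<^sub>0 \<zeta>\<^sub>0) (\<lambda>(x, \<zeta>). \<forall>t\<ge>0.
         norm (\<Psi> (fst (\<zeta> t)) - x t) \<le> \<beta> (norm x\<^sub>0 + norm \<zeta>\<^sub>0) t + (SUP s\<in>{0..t}. g (2 * \<bar>v s\<bar>)) \<and>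
         norm (\<zeta> t) \<le> \<mu>' t * (a' (norm x\<^sub>0 + norm \<zeta>\<^sub>0) + (SUP s\<in>{0..t}. q (2 * \<bar>v s\<bar>))))"
      unfolding the_solution_satisfies_def
    proof (intro conjI allI impI)
      obtain x where x: "classical_solution f x\<^sub>0 x"
        using complete[of x\<^sub>0] unfolding the_solution_satisfies_def by (elim conjE exE)
      obtain \<zeta> where "hybrid_solution f h r observer_field observer_reset d v x\<^sub>0 \<zeta>\<^sub>0 (x, \<zeta>)"
        by (rule hybrid_solution_exists[OF d x])
      then show "\<exists>X. hybrid_solution f h r observer_field observer_reset d v x\<^sub>0 \<zeta>\<^sub>0 X" ..
      fix X assume X: "hybrid_solution f h r observer_field observer_reset d v x\<^sub>0 \<zeta>\<^sub>0 X"
      obtain x \<zeta> where eq: "X = (x, \<zeta>)" by (cases X)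
      have "is_run d v x\<^sub>0 \<zeta>\<^sub>0 x \<zeta>"
        by unfold_locales (rule d, rule v, rule X[unfolded eq])
      then show "case X of (x, \<zeta>) \<Rightarrow> \<forall>t\<ge>0.
         norm (\<Psi> (fst (\<zeta> t)) - x t) \<le> \<beta> (norm x\<^sub>0 + norm \<zeta>\<^sub>0) t + (SUP s\<in>{0..t}. g (2 * \<bar>v s\<bar>)) \<and>
         norm (\<zeta> t) \<le> \<mu>' t * (a' (norm x\<^sub>0 + norm \<zeta>\<^sub>0) + (SUP s\<in>{0..t}. q (2 * \<bar>v s\<bar>)))"
        unfolding eq prod.case by (intro allI impI main)
    qed
  qed simp_all
qed

text \<open>Since \<open>\<Psi> (z' t)\<close> is the true state, the pair of the observer state and
  the true output solves the same differential equation as \<open>\<zeta>\<close>. It also starts at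
  \<open>(z\<^sub>0, h x\<^sub>0)\<close>, and without measurement error the resets leave it
  unchanged; uniqueness in each cell identifies it with the run.\<close>

lemma exact_reconstruction:
  assumes z0: "the_solution_satisfies (observer_solution f h F (\<lambda>_. 0) x\<^sub>0 z\<^sub>0) (\<lambda>(x, z). \<forall>t\<ge>0. x t = \<Psi> (z t))"
    and d: "d \<in> Linf_loc {0..}"
  shows "the_solution_satisfies (hybrid_solution f h r observer_field observer_reset d (\<lambda>_. 0) x\<^sub>0 (z\<^sub>0, h x\<^sub>0))
     (\<lambda>(x, \<zeta>). \<forall>t\<ge>0. x t = \<Psi> (fst (\<zeta> t)))"
  unfolding the_solution_satisfies_def
proof (intro conjI allI impI)
  obtain x where x: "classical_solution f x\<^sub>0 x"
    using complete[of x\<^sub>0] unfolding the_solution_satisfies_def by (elim conjE exE)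
  obtain \<zeta> where "hybrid_solution f h r observer_field observer_reset d (\<lambda>_. 0) x\<^sub>0 (z\<^sub>0, h x\<^sub>0) (x, \<zeta>)"
    by (rule hybrid_solution_exists[OF d x])
  then show "\<exists>X. hybrid_solution f h r observer_field observer_reset d (\<lambda>_. 0) x\<^sub>0 (z\<^sub>0, h x\<^sub>0) X" ..
  fix X assume X: "hybrid_solution f h r observer_field observer_reset d (\<lambda>_. 0) x\<^sub>0 (z\<^sub>0, h x\<^sub>0) X"
  obtain x \<zeta> where eq: "X = (x, \<zeta>)" by (cases X)
  have "is_run d (\<lambda>_. 0) x\<^sub>0 (z\<^sub>0, h x\<^sub>0) x \<zeta>"
    by unfold_locales (rule d, rule continuous_Linf_loc, simp, rule X[unfolded eq])
  then interpret hybrid_run f h F \<Psi> K r \<sigma>' \<sigma> \<gamma> p \<mu> a \<mu>\<^sub>x a\<^sub>x m d "\<lambda>_. 0" x\<^sub>0 "(z\<^sub>0, h x\<^sub>0)" x \<zeta> .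
  obtain Y where Y: "observer_solution f h F (\<lambda>_. 0) x\<^sub>0 z\<^sub>0 Y"
    and Y': "case Y of (x', z') \<Rightarrow> \<forall>t\<ge>0. x' t = \<Psi> (z' t)"
  proof -
    obtain Y where Y: "observer_solution f h F (\<lambda>_. 0) x\<^sub>0 z\<^sub>0 Y"
      using conjunct1[OF z0[unfolded the_solution_satisfies_def]] ..
    show thesis by (rule that[OF Y mp[OF spec[OF conjunct2[OF z0[unfolded the_solution_satisfies_def]]] Y]])
  qed
  obtain x' z' where Y_eq: "Y = (x', z')" by (cases Y)
  have x': "classical_solution f x\<^sub>0 x'"
    and z': "caratheodory_solution (\<lambda>t \<xi>. F (\<xi>, h (x' t) + 0)) z\<^sub>0 z'"
    using conjunct1[OF Y[unfolded Y_eq observer_solution_def prod.case]]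
      conjunct2[OF Y[unfolded Y_eq observer_solution_def prod.case]] .
  have \<Psi>: "x' t = \<Psi> (z' t)" if "0 \<le> t" for t using Y' that unfolding Y_eq by simp
  have x'_deriv: "(x' has_vector_derivative f (x' t)) (at t within {0..})" if "0 \<le> t" for t
    using x' that by (simp add: classical_solution_def)
  \<comment> \<open>The hypothesis supplies its own plant solution \<open>x'\<close> along with
    \<open>z'\<close>, which has to be identified with the \<open>x\<close> of the run.\<close>
  have x_eq: "x t = x' t" if t: "0 \<le> t" for t
  proof (rule C1_ode_unique[OF C1_f, where a=0 and b=t])
    show "(x has_vector_derivative f (x s)) (at s within {0..t})" if "s \<in> {0..t}" for s
      by (rule has_vector_derivative_within_subset[OF x_deriv]) (use that in auto)
    show "(x' has_vector_derivative f (x' s)) (at s within {0..t})" if "s \<in> {0..t}" for s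
      by (rule has_vector_derivative_within_subset[OF x'_deriv]) (use that in auto)
    show "x 0 = x' 0" using x' by (simp add: x_init classical_solution_def)
  qed (use t in simp)
  have hx': "continuous_on {0..} (\<lambda>t. h (x' t))"
    by (rule continuous_on_eq[OF hx_continuous]) (simp add: x_eq)
  define y where "y t = (z' t, h (x' t))" for t
  have y_deriv: "(y has_vector_derivative field (y t)) (at t within {0..T})" if t: "t \<in> {0..T}" for t T
  proof -
    have "continuous_on {0..T} (\<lambda>t. h (x' t) + 0)"
      unfolding add_0_right by (rule continuous_on_subset[OF hx']) auto
    then have "(z' has_vector_derivative F (z' t, h (x' t) + 0)) (at t within {0..T})"
      by (rule caratheodory_has_vector_derivative[OF z' C1_continuous_on[OF C1_F] _ t])
    moreover have "((\<lambda>t. h (x' t)) has_vector_derivative Lie_deriv f h (x' t)) (at t within {0..T})"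
    proof (rule has_vector_derivative_Lie_deriv[OF C2_h])
      show "(x' has_vector_derivative f (x' t)) (at t within {0..T})"
        by (rule has_vector_derivative_within_subset[OF x'_deriv]) (use t in auto)
    qed
    ultimately have "((\<lambda>t. (z' t, h (x' t))) has_vector_derivative (F (z' t, h (x' t)), Lie_deriv f h (x' t))) (at t within {0..T})"
      by (intro has_vector_derivative_Pair) simp_all
    then show ?thesis unfolding y_def field_def using \<Psi> t by simp
  qed
  have cell: "\<zeta> t = y t" if start: "\<zeta> (\<tau> i) = y (\<tau> i)" and t: "t \<in> {\<tau> i..<\<tau> (Suc i)}" for i t
  proof (rule C1_ode_unique[OF C1_field, where a="\<tau> i" and b=t])
    show "(\<zeta> has_vector_derivative field (\<zeta> s)) (at s within {\<tau> i..t})" if "s \<in> {\<tau> i..t}" for s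
      by (rule has_vector_derivative_within_subset[OF \<zeta>_deriv]) (use that t in auto)
    show "(y has_vector_derivative field (y s)) (at s within {\<tau> i..t})" if "s \<in> {\<tau> i..t}" for s
      by (rule has_vector_derivative_within_subset[OF y_deriv[of s t]]) (use that \<tau>_nonneg[of i] in auto)
  qed (use start t in auto)
  have start: "\<zeta> (\<tau> i) = y (\<tau> i)" for i
  proof (induction i)
    case 0
    show ?case using z' x' by (simp add: \<zeta>_init y_def caratheodory_solution_def classical_solution_def)
  next
    case (Suc i)
    \<comment> \<open>At the end of the cell \<open>z\<close> and \<open>z'\<close> are both
      continuous and agree on the left, so they agree there; \<open>w\<close> is reset to the exact
      output.\<close>
    have "(z \<longlongrightarrow> z (\<tau> (Suc i))) (at_left (\<tau> (Suc i)))"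
      by (rule continuous_on_Icc_at_leftD[OF continuous_on_subset[OF z_continuous] \<tau>_less_Suc[of i]])
        (use \<tau>_nonneg[of i] in auto)
    moreover have "\<forall>\<^sub>F t in at_left (\<tau> (Suc i)). z t = z' t"
    proof (rule eventually_at_leftI[OF _ \<tau>_less_Suc[of i]])
      fix t assume "t \<in> {\<tau> i<..<\<tau> (Suc i)}"
      then have "\<zeta> t = y t" by (intro cell[OF Suc]) auto
      then show "z t = z' t" by (simp add: y_def)
    qed
    ultimately have "(z' \<longlongrightarrow> z (\<tau> (Suc i))) (at_left (\<tau> (Suc i)))" by (rule Lim_transform_eventually)
    moreover have "(z' \<longlongrightarrow> z' (\<tau> (Suc i))) (at_left (\<tau> (Suc i)))"
      by (rule continuous_on_Icc_at_leftD[OF continuous_on_subset[OF caratheodory_solution_continuous[OF z']] \<tau>_less_Suc[of i]])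
        (use \<tau>_nonneg[of i] in auto)
    ultimately have "z (\<tau> (Suc i)) = z' (\<tau> (Suc i))" by (intro tendsto_unique[OF trivial_limit_at_left_real])
    moreover have "w (\<tau> (Suc i)) = h (x' (\<tau> (Suc i)))"
      using u_sample[of i] x_eq[OF \<tau>_nonneg[of "Suc i"]] by (simp add: u_def)
    ultimately show ?case by (simp add: y_def prod_eq_iff)
  qed
  have "x t = \<Psi> (z t)" if t: "0 \<le> t" for t
  proof -
    obtain i where i: "t \<in> {\<tau> i..<\<tau> (Suc i)}" using \<tau>_covers[OF t] .
    show ?thesis unfolding cell[OF start i] x_eq[OF t] \<Psi>[OF t] by (simp add: y_def)
  qed
  then show "case X of (x, \<zeta>) \<Rightarrow> \<forall>t\<ge>0. x t = \<Psi> (fst (\<zeta> t))" unfolding eq by simp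
qed

section \<open>Assembly of the observer property\<close>

lemma robust_sampled_data_observerI:
  assumes "\<And>x\<^sub>0. \<exists>z\<^sub>0. the_solution_satisfies (observer_solution f h F (\<lambda>_. 0) x\<^sub>0 z\<^sub>0) (\<lambda>(x, z). \<forall>t\<ge>0. x t = \<Psi> (z t))"
  shows "robust_sampled_data_observer f h r observer_field observer_reset (\<lambda>(z, w). \<Psi> z)"
proof -
  have \<Phi>: "(\<lambda>(z, w :: real). \<Psi> z) = (\<lambda>q. \<Psi> (fst q))" by auto
  show ?thesis
    unfolding robust_sampled_data_observer_def \<Phi>
  proof (intro conjI)
    have "observer_field = (\<lambda>q. field (fst q))" by (simp add: fun_eq_iff field_def)
    then show "C1 observer_field"
      using C1_compose[OF C1_field C1_bounded_linear[OF bounded_linear_fst]] by simp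
    have "observer_reset = (\<lambda>q. (fst (fst q), snd q))" by (simp add: fun_eq_iff)
    moreover have "continuous_on UNIV (\<lambda>q :: ('k \<times> real) \<times> real. (fst (fst q), snd q))"
      by (intro continuous_intros)
    ultimately show "continuous_on UNIV observer_reset" by simp
    show "C1 (\<lambda>q. \<Psi> (fst q))"
      by (rule C1_compose[OF C1_\<Psi> C1_bounded_linear[OF bounded_linear_fst]])
    show "observer_field (0, 0, 0) = 0" "observer_reset (0, 0) = 0"
      by (simp_all add: zero_prod_def F_0 \<Psi>_0 Lie_deriv_0)
    show "\<Psi> (fst 0) = 0" by (simp add: \<Psi>_0)
    show "\<forall>x\<^sub>0. \<exists>\<zeta>\<^sub>0. \<forall>d\<in>Linf_loc {0..}.
       the_solution_satisfies (hybrid_solution f h r observer_field observer_reset d (\<lambda>_. 0) x\<^sub>0 \<zeta>\<^sub>0)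
            (\<lambda>(x, \<zeta>). \<forall>t\<ge>0. x t = \<Psi> (fst (\<zeta> t)))"
    proof
      fix x\<^sub>0
      obtain z\<^sub>0 where "the_solution_satisfies (observer_solution f h F (\<lambda>_. 0) x\<^sub>0 z\<^sub>0) (\<lambda>(x, z). \<forall>t\<ge>0. x t = \<Psi> (z t))"
        using assms[of x\<^sub>0] ..
      then show "\<exists>\<zeta>\<^sub>0. \<forall>d\<in>Linf_loc {0..}.
       the_solution_satisfies (hybrid_solution f h r observer_field observer_reset d (\<lambda>_. 0) x\<^sub>0 \<zeta>\<^sub>0)
            (\<lambda>(x, \<zeta>). \<forall>t\<ge>0. x t = \<Psi> (fst (\<zeta> t)))"
        by (intro exI[of _ "(z\<^sub>0, h x\<^sub>0)"] ballI exact_reconstruction)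
    qed
qed (rule r, rule robust_estimates)
qed

end

theorem theorem3p1:
  fixes f :: "real ^ 'n \<Rightarrow> real ^ 'n" and h :: "real ^ 'n \<Rightarrow> real"
    and F :: "(real ^ 'k) \<times> real \<Rightarrow> real ^ 'k" and \<Psi> :: "real ^ 'k \<Rightarrow> real ^ 'n"
    and K r :: real and \<sigma>' :: "real \<Rightarrow> real \<Rightarrow> real"
  assumes "C1 f" and "C2 h" and "f 0 = 0" and "h 0 = 0"
    and "robustly_forward_complete f"
    and "C1 F" and "C1 \<Psi>" and "F (0, 0) = 0" and "\<Psi> 0 = 0"
    and "robust_observer f h F \<Psi>"
    and "K \<ge> 0" and "\<sigma>' \<in> class_KL"
    and "\<And>x\<^sub>0 z\<^sub>0 v. v \<in> Linf_loc UNIV \<Longrightarrow>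
      the_solution_satisfies (observer_solution f h F v x\<^sub>0 z\<^sub>0) (\<lambda>(x, z). \<forall>t\<ge>0.
        \<bar>Lie_deriv f h (\<Psi> (z t)) - Lie_deriv f h (x t)\<bar>
          \<le> \<sigma>' (norm x\<^sub>0 + norm z\<^sub>0) t + K * (SUP s\<in>{0..t}. \<bar>v s\<bar>))"
    and "r > 0" and "r * K < 1"
  shows "robust_sampled_data_observer f h r
    (\<lambda>((z, w), _, _). (F (z, w), Lie_deriv f h (\<Psi> z)))
    (\<lambda>((z, w), y). (z, y))
    (\<lambda>(z, w). \<Psi> z)"
proof -
  obtain \<mu>\<^sub>x a\<^sub>x where plant: "\<mu>\<^sub>x \<in> Kplus" "a\<^sub>x \<in> class_K_inf"
    "\<forall>x\<^sub>0. the_solution_satisfies (classical_solution f x\<^sub>0)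
       (\<lambda>x. \<forall>t\<ge>0. norm (x t) \<le> \<mu>\<^sub>x t * a\<^sub>x (norm x\<^sub>0))"
    using assms(5) unfolding robustly_forward_complete_def by (elim bexE)
  note rob = assms(10)[unfolded robust_observer_def, THEN conjunct2, THEN conjunct2, THEN conjunct2, THEN conjunct2]
  have obs: "\<exists>\<sigma>\<in>class_KL. \<exists>\<gamma>\<in>class_N. \<exists>p\<in>class_N. \<exists>\<mu>\<in>Kplus. \<exists>a\<in>class_K_inf.
      \<forall>x\<^sub>0 z\<^sub>0. \<forall>v\<in>Linf_loc UNIV.
        the_solution_satisfies (observer_solution f h F v x\<^sub>0 z\<^sub>0) (\<lambda>(x, z). \<forall>t\<ge>0.
          norm (\<Psi> (z t) - x t) \<le> \<sigma> (norm x\<^sub>0 + norm z\<^sub>0) t + (SUP s\<in>{0..t}. \<gamma> \<bar>v s\<bar>) \<and>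
          norm (z t) \<le> \<mu> t * (a (norm x\<^sub>0 + norm z\<^sub>0) + (SUP s\<in>{0..t}. p \<bar>v s\<bar>)))"
    and exact: "\<forall>x\<^sub>0. \<exists>z\<^sub>0.
        the_solution_satisfies (observer_solution f h F (\<lambda>_. 0) x\<^sub>0 z\<^sub>0)
          (\<lambda>(x, z). \<forall>t\<ge>0. x t = \<Psi> (z t))"
    using conjunct1[OF rob] conjunct2[OF rob] .
  obtain \<sigma> \<gamma> p \<mu> a where est: "\<sigma> \<in> class_KL" "\<gamma> \<in> class_N" "p \<in> class_N" "\<mu> \<in> Kplus" "a \<in> class_K_inf"
    "\<forall>x\<^sub>0 z\<^sub>0. \<forall>v\<in>Linf_loc UNIV.
        the_solution_satisfies (observer_solution f h F v x\<^sub>0 z\<^sub>0) (\<lambda>(x, z). \<forall>t\<ge>0.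
          norm (\<Psi> (z t) - x t) \<le> \<sigma> (norm x\<^sub>0 + norm z\<^sub>0) t + (SUP s\<in>{0..t}. \<gamma> \<bar>v s\<bar>) \<and>
          norm (z t) \<le> \<mu> t * (a (norm x\<^sub>0 + norm z\<^sub>0) + (SUP s\<in>{0..t}. p \<bar>v s\<bar>)))"
    using obs by (elim bexE)
  obtain m where m: "continuous_on {0..} m" "mono_on {0..} m" "\<And>s. s \<ge> 0 \<Longrightarrow> m s \<ge> 0"
    "\<And>x. norm (h x) \<le> norm x * m (norm x)"
    by (rule C1_growth[OF C2_imp_C1[OF assms(2)] assms(4)]) (rule that)
  interpret sampled_observer f h F \<Psi> K r \<sigma>' \<sigma> \<gamma> p \<mu> a \<mu>\<^sub>x a\<^sub>x m
  proof
    show "the_solution_satisfies (classical_solution f x\<^sub>0) (\<lambda>x. \<forall>t\<ge>0. norm (x t) \<le> \<mu>\<^sub>x t * a\<^sub>x (norm x\<^sub>0))" for x\<^sub>0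
      by (rule spec[OF plant(3)])
    show "the_solution_satisfies (observer_solution f h F v x\<^sub>0 z\<^sub>0) (\<lambda>(x, z). \<forall>t\<ge>0.
          norm (\<Psi> (z t) - x t) \<le> \<sigma> (norm x\<^sub>0 + norm z\<^sub>0) t + (SUP s\<in>{0..t}. \<gamma> \<bar>v s\<bar>) \<and>
          norm (z t) \<le> \<mu> t * (a (norm x\<^sub>0 + norm z\<^sub>0) + (SUP s\<in>{0..t}. p \<bar>v s\<bar>)))"
      if "v \<in> Linf_loc UNIV" for v x\<^sub>0 z\<^sub>0
      by (rule bspec[OF spec[OF spec[OF est(6)]] that])
  qed (fact assms plant est m)+
  show ?thesis by (rule robust_sampled_data_observerI) (rule spec[OF exact])
qed

end
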